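(* Suppose that the common null sets condition, the smoothness and moment condition, the comparable information condition, the non-degenerate modified score condition, and the dense non-critical points condition (all stated in the context) hold. For $\alpha\in(0,1)$ let $$\mathcal{R}_n(\alpha)=\{\theta\in\Theta:\ T_n(\theta;Y^n)\le q_{d,1-\alpha}\},$$ where $q_{d,1-\alpha}$ is the $(1-\alpha)$th quantile of the chi-square distribution with $d$ degrees of freedom and $T_n$ denotes the continuously extended test statistic. Then for every $\alpha\in(0,1)$ and every non-empty compact $C\subseteq\Theta$, $$\lim_{n\to\infty}\ \inf_{\theta\in C}\ \mathsf{P}_\theta\{\theta\in\mathcal{R}_n(\alpha)\}=1-\alpha .$$
   Context: Setting. Let $d\ge1$ and $\Theta\subseteq\mathbb{R}^d$. For $i=1,2,\dots$, the random vectors $Y_i\in\mathbb{R}^{r_i}$ ($r_i\ge1$) are independent and, when the parameter is $\theta\in\Theta$, $Y_i$ has density $f^i_\theta$ (also written $f_\theta(y_i)$) with respect to a dominating measure $\gamma_i$. Write $Y^n=(Y_1,\dots,Y_n)$, with realization $y^n=(y_1,\dots,y_n)$. A subscript $\theta$ on $\mathsf P,\mathbb{E},\operatorname{var},\operatorname{cov}$ means the data have the distribution indexed by $\theta$. Let $\nabla$ be the gradient with respect to $\theta$, $\nabla_j^l$ the $l$th order partial derivative with respect to $\theta_j$, and $\ell^i(\theta;y_i)=\log f_\theta(y_i)$, $\ell_n(\theta;y^n)=\sum_{i=1}^n\ell^i(\theta;y_i)$, $s^i=\nabla\ell^i$, $s_n=\nabla\ell_n$, $\mathcal{I}^i(\theta)=\operatorname{cov}_\theta\{s^i(\theta;Y_i)\}$,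 $\mathcal{I}_n(\theta)=\operatorname{cov}_\theta\{s_n(\theta;Y^n)\}$. A point $\theta\in\Theta$ is critical if $\mathcal{I}_n(\theta)$ is singular, and non-critical otherwise. "Almost every $y_i$" (or $y^n$) and "full measure" refer to the distribution $f_\theta(y_i)\gamma_i(\mathrm{d}y_i)$ (or the corresponding product measure) for any $\theta\in\Theta$. For symmetric matrices, $A\preceq B$ means $B-A$ is positive semi-definite. Common null sets condition: for every $i$, the distributions $f_\theta(y_i)\gamma_i(\mathrm{d}y_i)$, $\theta\in\Theta$, all have the same null sets. Smoothness and moment condition: for every $\theta'\in\Theta$ there is an open ball $B=B(\theta')\subseteq\mathbb{R}^d$ centered at $\theta'$ on which, for every $i$ and almost every $y_i$, partial derivatives of $\theta\mapsto\ell^i(\theta;y_i)$ of an order $k=k(\theta')\ge2$ exist and are jointly continuous in $(\theta,y_i)$; moreover there is a $\delta=\delta(\theta')>0$ such that for all non-negative integers $l_1,\dots,l_d$ summing to $l\le k$, $$\sup_{i}\ \sup_{\theta\in B\cap\Theta,\ \tilde\theta\in B}\int\left|\frac{\partial^l}{\partial\theta_1^{l_1}\cdots\partial\theta_d^{l_d}}\ell^i(\theta;y_i)\Big|_{\theta=\tilde\theta}\right|^{2+\delta}f_\theta(y_i)\,\gamma_i(\mathrm{d}y_i)<\infty .$$ If $B\not\subseteq\Theta$ this means that extensions of the partial derivatives to $B\times\mathcal{Y}_i$, for some set $\mathcal{Y}_i$ of full measure, exist and satisfy these conditions. Comparable information condition: there exist continuous $c_1,c_2:\Theta\to(0,\infty)$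 such that, for every $i=1,2,\dots$ and $\theta\in\Theta$, $c_1(\theta)\mathcal I^1(\theta)\preceq\mathcal I^i(\theta)\preceq c_2(\theta)\mathcal I^1(\theta)$. Modified score: given, for each $\theta\in\Theta$ and $n$, positive integers $k_j=k_j(\theta,n)$ and orthonormal eigenvectors $v^n_{\theta1},\dots,v^n_{\theta d}$ of $\mathcal{I}_n(\theta)$, let $\tilde s^i_n(\theta;y_i)\in\mathbb{R}^d$ have $j$th element $\{\nabla_j^{k_j-1}s^i(\theta;y_i)\}^{\mathsf T}v^n_{\theta j}$, and let $\tilde s_n(\theta;y^n)=\sum_{i=1}^n\tilde s_n^i(\theta;y_i)$, $\tilde{\mathcal I}_n(\theta)=\operatorname{cov}_\theta\{\tilde s_n(\theta;Y^n)\}$. Non-degenerate modified score condition: for every $\theta\in\Theta$ and $n=1,2,\dots$ there exist integers $k_j=k_j(\theta,n)\in\{1,2,\dots\}$ ($j=1,\dots,d$) and a set of orthonormal eigenvectors $\{v^n_{\theta1},\dots,v^n_{\theta d}\}$ of $\mathcal I_n(\theta)$ such that (i) $\tilde{\mathcal I}_n(\theta)$ is positive definite; (ii) $\{\nabla_j^l s_n(\tilde\theta;y^n)\}^{\mathsf T}v^n_{\theta j}=0$, $l=0,\dots,k_j-2$, for every $\tilde\theta$ with $\tilde\theta_j=\theta_j$ and almost every $y^n$; (iii) $k_j(\theta,n)$ is upper bounded by the $k=k(\theta)$ in the smoothness and moment condition for every $j,\theta,n$. Dense non-critical points condition: for every $\theta\in\Theta$ there is a sequence of non-critical points in $\Theta$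 tending to $\theta$. Test statistic: at non-critical $\theta$, $T_n(\theta;y^n)=s_n(\theta;y^n)^{\mathsf T}\mathcal I_n(\theta)^{-1}s_n(\theta;y^n)$. Under the common null sets condition, the smoothness and moment condition, the non-degenerate modified score condition, and the dense non-critical points condition (the comparable information condition is not needed for this) there is a set $\mathcal Y^n$ of full measure such that $T_n$ has a continuous extension to $\Theta\times\mathcal Y^n$, given by $T_n(\theta;y^n)=\tilde s_n(\theta;y^n)^{\mathsf T}\tilde{\mathcal I}_n(\theta)^{-1}\tilde s_n(\theta;y^n)$ with $k_j,v_{\theta j}^n$ as in the non-degenerate modified score condition; $T_n$ denotes this extension.
   Formalization: Adds that a dense set of points of Θ are limit points of Θ along every coordinate axis (true for open sets and sets in the closure of their interior); otherwise, e.g. for a one-point Θ, the extended score need not have mean zero and the claim fails. *)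

theory Defs
  imports "HOL-Probability.Probability"
begin

section \<open>Derivatives with respect to the parameter\<close>

definition partial :: "'d \<Rightarrow> (real ^ 'd \<Rightarrow> real) \<Rightarrow> real ^ 'd \<Rightarrow> real" where
  "partial j g \<theta> = deriv (\<lambda>t. g (\<theta> + t *\<^sub>R axis j 1)) 0"

definition has_partial :: "'d \<Rightarrow> (real ^ 'd \<Rightarrow> real) \<Rightarrow> real ^ 'd \<Rightarrow> bool" where
  "has_partial j g \<theta> \<longleftrightarrow> (\<lambda>t. g (\<theta> + t *\<^sub>R axis j 1)) differentiable (at 0)"

text \<open>Mixed partial derivatives are indexed by the list of the coordinates along which one
  differentiates; the multi-index $(l_1,\dots,l_d)$ is the list of length $l$ in which coordinate
  $j$ occurs $l_j$ times. All orderings are allowed, which is immaterial for the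
  functions of class $C^k$ considered below.\<close>

definition partials :: "'d list \<Rightarrow> (real ^ 'd \<Rightarrow> real) \<Rightarrow> real ^ 'd \<Rightarrow> real" where
  "partials js g = foldr partial js g"

definition grad :: "(real ^ 'd \<Rightarrow> real) \<Rightarrow> real ^ 'd \<Rightarrow> real ^ 'd" where
  "grad g \<theta> = (\<chi> j. partial j g \<theta>)"

text \<open>The $l$-th order partial derivative with respect to coordinate $j$ of a
  vector-valued function.\<close>

definition vpartial :: "'d \<Rightarrow> nat \<Rightarrow> (real ^ 'd \<Rightarrow> real ^ 'd) \<Rightarrow> real ^ 'd \<Rightarrow> real ^ 'd" where
  "vpartial j l G \<theta> = (\<chi> m. (partial j ^^ l) (\<lambda>\<eta>. G \<eta> $ m) \<theta>)"

text \<open>The parameter set need not be open. For functions known only on \<open>\<Theta>\<close>, the difference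
  quotient along coordinate $j$ has a limit in a meaningful sense at the points of \<open>\<Theta>\<close> that are
  limit points of \<open>\<Theta>\<close> along that coordinate. If the points where this holds for all $j$
  are dense in \<open>\<Theta>\<close>, then continuous extensions of the partial derivatives are determined on \<open>\<Theta>\<close>
  by the values of the function on \<open>\<Theta>\<close>. Open sets, and more generally sets contained
  in the closure of their interior, have this property.\<close>

definition partials_determined :: "(real ^ 'd) set \<Rightarrow> bool" where
  "partials_determined \<Theta> \<longleftrightarrow>
     \<Theta> \<subseteq> closure {\<theta> \<in> \<Theta>. \<forall>j. \<theta> islimpt (\<Theta> \<inter> range (\<lambda>t. \<theta> + t *\<^sub>R axis j 1))}"


section \<open>Covariance matrices and matrix order\<close>

text \<open>Expectations and probabilities are taken in the completed probability space, because the
  functions of the data below are specified only up to null sets.\<close>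

definition expect :: "'w measure \<Rightarrow> ('w \<Rightarrow> real) \<Rightarrow> real" where
  "expect N g = (LINT w|completion N. g w)"

definition cov_matrix :: "'w measure \<Rightarrow> ('w \<Rightarrow> real ^ 'd) \<Rightarrow> real ^ 'd ^ 'd" where
  "cov_matrix N X = (\<chi> i j. expect N (\<lambda>w.
     (X w $ i - expect N (\<lambda>w. X w $ i)) * (X w $ j - expect N (\<lambda>w. X w $ j))))"

definition loewner_le :: "real ^ 'd ^ 'd \<Rightarrow> real ^ 'd ^ 'd \<Rightarrow> bool" where
  "loewner_le A B \<longleftrightarrow> (\<forall>x. 0 \<le> x \<bullet> ((B - A) *v x))"

definition pos_definite :: "real ^ 'd ^ 'd \<Rightarrow> bool" where
  "pos_definite A \<longleftrightarrow> (\<forall>x. x \<noteq> 0 \<longrightarrow> 0 < x \<bullet> (A *v x))"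


section \<open>Quantiles of the chi-square distribution\<close>

definition chi_square :: "nat \<Rightarrow> real measure" where
  "chi_square d = distr (\<Pi>\<^sub>M i\<in>{..<d}. density lborel (\<lambda>x. ennreal (std_normal_density x))) borel
     (\<lambda>x. \<Sum>i<d. (x i)\<^sup>2)"

definition quantile :: "real measure \<Rightarrow> real \<Rightarrow> real" where
  "quantile N p = Inf {x. p \<le> cdf N x}"


section \<open>The statistical model\<close>

text \<open>An observation in $\mathbb{R}^{r_i}$ is a function on \<open>{..<r i}\<close>, so that the dimension may
  depend on $i$. Such functions carry the product topology, and the random vector \<open>Y i\<close> is defined
  on a space \<open>'w\<close> with probability measure \<open>M \<theta>\<close> when the parameter is \<open>\<theta>\<close>. Observations are
  numbered from 1; what is assigned to index 0 is never used.\<close>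

type_synonym obs = "nat \<Rightarrow> real"

definition law :: "(nat \<Rightarrow> obs measure) \<Rightarrow> (nat \<Rightarrow> 'p \<Rightarrow> obs \<Rightarrow> real) \<Rightarrow> nat \<Rightarrow> 'p \<Rightarrow> obs measure" where
  "law \<gamma> f i \<theta> = density (\<gamma> i) (\<lambda>y. ennreal (f i \<theta> y))"

definition independent_model ::
  "('p \<Rightarrow> 'w measure) \<Rightarrow> (nat \<Rightarrow> 'w \<Rightarrow> obs) \<Rightarrow> 'p set \<Rightarrow> (nat \<Rightarrow> nat) \<Rightarrow> (nat \<Rightarrow> obs measure)
    \<Rightarrow> (nat \<Rightarrow> 'p \<Rightarrow> obs \<Rightarrow> real) \<Rightarrow> bool" where
  "independent_model M Y \<Theta> r \<gamma> f \<longleftrightarrow>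
     (\<forall>i\<ge>1. r i \<ge> 1 \<and> sets (\<gamma> i) = sets (\<Pi>\<^sub>M j\<in>{..<r i}. (borel :: real measure))) \<and>
     (\<forall>\<theta>\<in>\<Theta>. prob_space (M \<theta>)
        \<and> prob_space.indep_vars (M \<theta>) \<gamma> Y {1..}
        \<and> (\<forall>i\<ge>1. (\<forall>y\<in>space (\<gamma> i). 0 \<le> f i \<theta> y)
             \<and> distributed (M \<theta>) (\<gamma> i) (Y i) (\<lambda>y. ennreal (f i \<theta> y))))"

definition common_null_sets ::
  "'p set \<Rightarrow> (nat \<Rightarrow> obs measure) \<Rightarrow> (nat \<Rightarrow> 'p \<Rightarrow> obs \<Rightarrow> real) \<Rightarrow> bool" where
  "common_null_sets \<Theta> \<gamma> f \<longleftrightarrow>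
     (\<forall>i\<ge>1. \<forall>\<theta>\<in>\<Theta>. \<forall>\<theta>'\<in>\<Theta>. null_sets (law \<gamma> f i \<theta>) = null_sets (law \<gamma> f i \<theta>'))"

text \<open>The function \<open>L i \<theta> y\<close> is the log-density on \<open>\<Theta>\<close>, extended to the balls \<open>ball \<theta>' (\<rho> \<theta>')\<close>
  around the points \<open>\<theta>'\<close> of \<open>\<Theta>\<close>; \<open>\<Y>\<close> is a set of full measure.\<close>

definition smooth_with_moments ::
  "(real ^ 'd) set \<Rightarrow> (nat \<Rightarrow> obs measure) \<Rightarrow> (nat \<Rightarrow> real ^ 'd \<Rightarrow> obs \<Rightarrow> real)
    \<Rightarrow> (nat \<Rightarrow> real ^ 'd \<Rightarrow> obs \<Rightarrow> real)
    \<Rightarrow> (real ^ 'd \<Rightarrow> real) \<Rightarrow> (real ^ 'd \<Rightarrow> nat) \<Rightarrow> (real ^ 'd \<Rightarrow> real) \<Rightarrow> bool" where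
  "smooth_with_moments \<Theta> \<gamma> f L \<rho> k \<delta> \<longleftrightarrow>
     (\<forall>\<theta>'\<in>\<Theta>. \<rho> \<theta>' > 0 \<and> k \<theta>' \<ge> 2 \<and> \<delta> \<theta>' > 0 \<and>
        (\<forall>i\<ge>1. \<exists>\<Y>\<subseteq>space (\<gamma> i). (AE y in law \<gamma> f i \<theta>'. y \<in> \<Y>) \<and>
            (\<forall>y\<in>\<Y>. \<forall>\<theta> \<in> ball \<theta>' (\<rho> \<theta>') \<inter> \<Theta>. 0 < f i \<theta> y \<and> L i \<theta> y = ln (f i \<theta> y)) \<and>
            (\<forall>y\<in>\<Y>. \<forall>\<theta> \<in> ball \<theta>' (\<rho> \<theta>'). \<forall>js j. length js < k \<theta>' \<longrightarrow>
                has_partial j (partials js (\<lambda>\<eta>. L i \<eta> y)) \<theta>) \<and>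
            (\<forall>js. 1 \<le> length js \<and> length js \<le> k \<theta>' \<longrightarrow>
                continuous_on (ball \<theta>' (\<rho> \<theta>') \<times> \<Y>) (\<lambda>(\<theta>, y). partials js (\<lambda>\<eta>. L i \<eta> y) \<theta>))) \<and>
        (\<forall>js. length js \<le> k \<theta>' \<longrightarrow>
          (SUP i\<in>{1..}. SUP (\<theta>, \<theta>t) \<in> (ball \<theta>' (\<rho> \<theta>') \<inter> \<Theta>) \<times> ball \<theta>' (\<rho> \<theta>').
             \<integral>\<^sup>+y. ennreal (\<bar>partials js (\<lambda>\<eta>. L i \<eta> y) \<theta>t\<bar> powr (2 + \<delta> \<theta>')) \<partial>law \<gamma> f i \<theta>) < \<infinity>))"


section \<open>Scores and Fisher information\<close>

text \<open>A realization of the whole sequence is passed as \<open>y :: nat \<Rightarrow> obs\<close>; quantities with sample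
  size \<open>n\<close> depend only on \<open>y 1, \<dots>, y n\<close>.\<close>

definition score :: "(nat \<Rightarrow> real ^ 'd \<Rightarrow> obs \<Rightarrow> real) \<Rightarrow> nat \<Rightarrow> real ^ 'd \<Rightarrow> obs \<Rightarrow> real ^ 'd" where
  "score L i \<theta> y = grad (\<lambda>\<eta>. L i \<eta> y) \<theta>"

definition loglik :: "(nat \<Rightarrow> real ^ 'd \<Rightarrow> obs \<Rightarrow> real) \<Rightarrow> nat \<Rightarrow> real ^ 'd \<Rightarrow> (nat \<Rightarrow> obs) \<Rightarrow> real" where
  "loglik L n \<theta> y = (\<Sum>i=1..n. L i \<theta> (y i))"

definition score_n ::
  "(nat \<Rightarrow> real ^ 'd \<Rightarrow> obs \<Rightarrow> real) \<Rightarrow> nat \<Rightarrow> real ^ 'd \<Rightarrow> (nat \<Rightarrow> obs) \<Rightarrow> real ^ 'd" where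
  "score_n L n \<theta> y = grad (\<lambda>\<eta>. loglik L n \<eta> y) \<theta>"

definition info ::
  "(real ^ 'd \<Rightarrow> 'w measure) \<Rightarrow> (nat \<Rightarrow> 'w \<Rightarrow> obs) \<Rightarrow> (nat \<Rightarrow> real ^ 'd \<Rightarrow> obs \<Rightarrow> real)
    \<Rightarrow> nat \<Rightarrow> real ^ 'd \<Rightarrow> real ^ 'd ^ 'd" where
  "info M Y L i \<theta> = cov_matrix (M \<theta>) (\<lambda>w. score L i \<theta> (Y i w))"

definition info_n ::
  "(real ^ 'd \<Rightarrow> 'w measure) \<Rightarrow> (nat \<Rightarrow> 'w \<Rightarrow> obs) \<Rightarrow> (nat \<Rightarrow> real ^ 'd \<Rightarrow> obs \<Rightarrow> real)
    \<Rightarrow> nat \<Rightarrow> real ^ 'd \<Rightarrow> real ^ 'd ^ 'd" where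
  "info_n M Y L n \<theta> = cov_matrix (M \<theta>) (\<lambda>w. score_n L n \<theta> (\<lambda>i. Y i w))"

definition noncritical ::
  "(real ^ 'd \<Rightarrow> 'w measure) \<Rightarrow> (nat \<Rightarrow> 'w \<Rightarrow> obs) \<Rightarrow> (real ^ 'd) set
    \<Rightarrow> (nat \<Rightarrow> real ^ 'd \<Rightarrow> obs \<Rightarrow> real) \<Rightarrow> nat \<Rightarrow> (real ^ 'd) set" where
  "noncritical M Y \<Theta> L n = {\<theta> \<in> \<Theta>. invertible (info_n M Y L n \<theta>)}"

definition comparable_information ::
  "(real ^ 'd \<Rightarrow> 'w measure) \<Rightarrow> (nat \<Rightarrow> 'w \<Rightarrow> obs) \<Rightarrow> (real ^ 'd) set
    \<Rightarrow> (nat \<Rightarrow> real ^ 'd \<Rightarrow> obs \<Rightarrow> real) \<Rightarrow> bool" where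
  "comparable_information M Y \<Theta> L \<longleftrightarrow>
     (\<exists>c1 c2. continuous_on \<Theta> c1 \<and> continuous_on \<Theta> c2 \<and>
        (\<forall>\<theta>\<in>\<Theta>. 0 < c1 \<theta> \<and> 0 < c2 \<theta> \<and>
          (\<forall>i\<ge>1. loewner_le (c1 \<theta> *\<^sub>R info M Y L 1 \<theta>) (info M Y L i \<theta>) \<and>
                  loewner_le (info M Y L i \<theta>) (c2 \<theta> *\<^sub>R info M Y L 1 \<theta>))))"

definition dense_noncritical ::
  "(real ^ 'd \<Rightarrow> 'w measure) \<Rightarrow> (nat \<Rightarrow> 'w \<Rightarrow> obs) \<Rightarrow> (real ^ 'd) set
    \<Rightarrow> (nat \<Rightarrow> real ^ 'd \<Rightarrow> obs \<Rightarrow> real) \<Rightarrow> bool" where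
  "dense_noncritical M Y \<Theta> L \<longleftrightarrow>
     (\<forall>n\<ge>1. \<forall>\<theta>\<in>\<Theta>. \<exists>\<phi>. (\<forall>m. \<phi> m \<in> noncritical M Y \<Theta> L n) \<and> \<phi> \<longlonglongrightarrow> \<theta>)"


section \<open>The modified score\<close>

text \<open>Below, \<open>\<kappa> \<theta> n j\<close> is $k_j(\theta,n)$ and \<open>v \<theta> n j\<close> is $v^n_{\theta j}$.\<close>

definition mod_score ::
  "(nat \<Rightarrow> real ^ 'd \<Rightarrow> obs \<Rightarrow> real) \<Rightarrow> (real ^ 'd \<Rightarrow> nat \<Rightarrow> 'd \<Rightarrow> nat)
    \<Rightarrow> (real ^ 'd \<Rightarrow> nat \<Rightarrow> 'd \<Rightarrow> real ^ 'd) \<Rightarrow> nat \<Rightarrow> nat \<Rightarrow> real ^ 'd \<Rightarrow> obs \<Rightarrow> real ^ 'd" where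
  "mod_score L \<kappa> v n i \<theta> y =
     (\<chi> j. vpartial j (\<kappa> \<theta> n j - 1) (\<lambda>\<eta>. score L i \<eta> y) \<theta> \<bullet> v \<theta> n j)"

definition mod_score_n ::
  "(nat \<Rightarrow> real ^ 'd \<Rightarrow> obs \<Rightarrow> real) \<Rightarrow> (real ^ 'd \<Rightarrow> nat \<Rightarrow> 'd \<Rightarrow> nat)
    \<Rightarrow> (real ^ 'd \<Rightarrow> nat \<Rightarrow> 'd \<Rightarrow> real ^ 'd) \<Rightarrow> nat \<Rightarrow> real ^ 'd \<Rightarrow> (nat \<Rightarrow> obs) \<Rightarrow> real ^ 'd" where
  "mod_score_n L \<kappa> v n \<theta> y = (\<Sum>i=1..n. mod_score L \<kappa> v n i \<theta> (y i))"

definition mod_info_n ::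
  "(real ^ 'd \<Rightarrow> 'w measure) \<Rightarrow> (nat \<Rightarrow> 'w \<Rightarrow> obs) \<Rightarrow> (nat \<Rightarrow> real ^ 'd \<Rightarrow> obs \<Rightarrow> real)
    \<Rightarrow> (real ^ 'd \<Rightarrow> nat \<Rightarrow> 'd \<Rightarrow> nat) \<Rightarrow> (real ^ 'd \<Rightarrow> nat \<Rightarrow> 'd \<Rightarrow> real ^ 'd)
    \<Rightarrow> nat \<Rightarrow> real ^ 'd \<Rightarrow> real ^ 'd ^ 'd" where
  "mod_info_n M Y L \<kappa> v n \<theta> = cov_matrix (M \<theta>) (\<lambda>w. mod_score_n L \<kappa> v n \<theta> (\<lambda>i. Y i w))"

text \<open>The vanishing condition (the last one) ranges over the ball around \<open>\<theta>\<close> on which the smoothness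
  condition provides the derivatives of order up to \<open>k \<theta>\<close>. The bound \<open>l + 2 \<le> \<kappa> \<theta> n j\<close> is
  $l\le k_j-2$ without truncated subtraction.\<close>

definition nondegenerate_mod_score ::
  "(real ^ 'd \<Rightarrow> 'w measure) \<Rightarrow> (nat \<Rightarrow> 'w \<Rightarrow> obs) \<Rightarrow> (real ^ 'd) set
    \<Rightarrow> (nat \<Rightarrow> real ^ 'd \<Rightarrow> obs \<Rightarrow> real) \<Rightarrow> (real ^ 'd \<Rightarrow> real) \<Rightarrow> (real ^ 'd \<Rightarrow> nat)
    \<Rightarrow> (real ^ 'd \<Rightarrow> nat \<Rightarrow> 'd \<Rightarrow> nat) \<Rightarrow> (real ^ 'd \<Rightarrow> nat \<Rightarrow> 'd \<Rightarrow> real ^ 'd) \<Rightarrow> bool" where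
  "nondegenerate_mod_score M Y \<Theta> L \<rho> k \<kappa> v \<longleftrightarrow>
     (\<forall>\<theta>\<in>\<Theta>. \<forall>n\<ge>1.
        (\<forall>j. 1 \<le> \<kappa> \<theta> n j \<and> \<kappa> \<theta> n j \<le> k \<theta>) \<and>
        (\<forall>j j'. v \<theta> n j \<bullet> v \<theta> n j' = (if j = j' then 1 else 0)) \<and>
        (\<forall>j. \<exists>c. info_n M Y L n \<theta> *v v \<theta> n j = c *\<^sub>R v \<theta> n j) \<and>
        pos_definite (mod_info_n M Y L \<kappa> v n \<theta>) \<and>
        (\<forall>j l. l + 2 \<le> \<kappa> \<theta> n j \<longrightarrow>
          (\<forall>\<theta>t \<in> ball \<theta> (\<rho> \<theta>). \<theta>t $ j = \<theta> $ j \<longrightarrow>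
            (AE w in M \<theta>. vpartial j l (\<lambda>\<eta>. score_n L n \<eta> (\<lambda>i. Y i w)) \<theta>t \<bullet> v \<theta> n j = 0))))"


section \<open>Test statistic and confidence region\<close>

definition test_stat ::
  "(real ^ 'd \<Rightarrow> 'w measure) \<Rightarrow> (nat \<Rightarrow> 'w \<Rightarrow> obs) \<Rightarrow> (nat \<Rightarrow> real ^ 'd \<Rightarrow> obs \<Rightarrow> real)
    \<Rightarrow> nat \<Rightarrow> real ^ 'd \<Rightarrow> (nat \<Rightarrow> obs) \<Rightarrow> real" where
  "test_stat M Y L n \<theta> y =
     score_n L n \<theta> y \<bullet> (matrix_inv (info_n M Y L n \<theta>) *v score_n L n \<theta> y)"

text \<open>The continuous extension of the test statistic: at a critical point it takes the limit of the
  values at non-critical points. The limit is taken for fixed data and exists for almost all data.\<close>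

definition test_stat_ext ::
  "(real ^ 'd \<Rightarrow> 'w measure) \<Rightarrow> (nat \<Rightarrow> 'w \<Rightarrow> obs) \<Rightarrow> (real ^ 'd) set
    \<Rightarrow> (nat \<Rightarrow> real ^ 'd \<Rightarrow> obs \<Rightarrow> real) \<Rightarrow> nat \<Rightarrow> real ^ 'd \<Rightarrow> (nat \<Rightarrow> obs) \<Rightarrow> real" where
  "test_stat_ext M Y \<Theta> L n \<theta> y =
     (if \<theta> \<in> noncritical M Y \<Theta> L n then test_stat M Y L n \<theta> y
      else Lim (at \<theta> within noncritical M Y \<Theta> L n) (\<lambda>\<eta>. test_stat M Y L n \<eta> y))"

definition confidence_region ::
  "(real ^ 'd \<Rightarrow> 'w measure) \<Rightarrow> (nat \<Rightarrow> 'w \<Rightarrow> obs) \<Rightarrow> (real ^ 'd) set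
    \<Rightarrow> (nat \<Rightarrow> real ^ 'd \<Rightarrow> obs \<Rightarrow> real) \<Rightarrow> nat \<Rightarrow> real \<Rightarrow> (nat \<Rightarrow> obs) \<Rightarrow> (real ^ 'd) set" where
  "confidence_region M Y \<Theta> L n \<alpha> y =
     {\<theta> \<in> \<Theta>. test_stat_ext M Y \<Theta> L n \<theta> y \<le> quantile (chi_square CARD('d)) (1 - \<alpha>)}"

end

theory Submission
  imports Defs
begin

text \<open>
  Fix a parameter $\theta_0$, let $V_n$ have the columns $v^n_{\theta_0 j}$ and put $m_j = k_j - 1$.
  Since the derivatives of order below $m_j$ of the rotated score of the sample vanish on the slab
  $\eta_j = \theta_{0j}$, Taylor's formula in the direction of the $j$th axis gives
  $V_n^T s^i(\eta) = c^i_n(\eta) + D_n(\eta)\, \hat g^i_n(\eta)$ with deterministic $c^i_n$ whose sum over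
  $i \le n$ is 0, where $D_n(\eta)$ is diagonal with entries
  $(\eta_j - \theta_{0j})^{m_j} / m_j!$ and $\hat g^i_n(\theta_0)$ is the modified score. At non-critical
  points the statistic is thus $\hat g^T J^{-1} \hat g$ with $\hat g = \sum_i \hat g^i_n$ and
  $J = \mathop{\rm cov}\hat g$, and this expression is continuous at $\theta_0$, because moments of order
  $2 + \delta$ make expectations continuous in the parameter.

  Near $\theta_0$ the matrices $J$ grow at least like $n$ times the identity, uniformly in $n$: by
  comparability $I_n$ is of the order of $n I_1$, which bounds the entries of $D_n$ by those of $D_1$,
  and only finitely many exponents $m_j$ occur. With the bounded moments this is Lyapunov's condition,
  uniformly near $\theta_0$. The uniform convergence in law of $\hat g^T J^{-1} \hat g$ to the chi-square
  distribution is obtained without tightness arguments: $e^{-m |Z|^2}$ is a Gaussian average of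
  $e^{i u \cdot Z}$, so estimates of characteristic functions become estimates of the moments of the
  $[0,1]$-valued variable $e^{-|Z|^2}$. Compactness of $C$ makes the local statements uniform on $C$.
\<close>

section \<open>Convergence of integrals under a moment bound\<close>

text \<open>Exponents k_j(\<theta>, n) and eigenvectors may jump as \<theta> moves, so the modified
  score need not be continuous in \<theta>. They are therefore frozen at \<theta>0, and what varies
  is \<open>gh\<close>, which is continuous in \<eta> and equals the modified score at \<theta>0.
  The vanishing condition concerns the score of the whole sample; a single score obeys it only up to
  a constant. This is the origin of c, and it is why single summands may have nonzero mean although
  the means add up to 0: the summands are centred before the limit theorem is applied. The other
  obstacle is uniformity in n: continuity of J at \<theta>0 gives a neighbourhood that may shrink as
  n grows. Comparing D_n with D_1 moves the estimate to n = 1 and to one representative n for each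
  of finitely many patterns. Closeness in law is reduced to finitely many moments of exp (- T), with
  errors depending only on the number n of summands and the constants of the moment and coercivity
  bounds. Scores and statistics are determined only up to null sets, hence the passage to
  completions.\<close>

lemma linear_le_scaled_powr:
  fixes p e :: real
  assumes "1 < p" "0 < e"
  obtains C where "0 < C" "\<And>x. \<bar>x\<bar> \<le> e * \<bar>x\<bar> powr p + C"
proof -
  \<comment> \<open>The solution of e * C powr (p - 1) = 1; beyond it the power term alone
    dominates.\<close>
  define C where "C = (1 / e) powr (1 / (p - 1))"
  have C: "0 < C" using assms by (simp add: C_def)
  have "\<bar>x\<bar> \<le> e * \<bar>x\<bar> powr p + C" for x
  proof (cases "\<bar>x\<bar> \<le> C")
    case True
    then show ?thesis using assms(2) by (smt (verit) mult_nonneg_nonneg powr_ge_zero)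
  next
    case False
    then have "C powr (p - 1) \<le> \<bar>x\<bar> powr (p - 1)"
      using C assms by (intro powr_mono2) auto
    moreover have "C powr (p - 1) = 1 / e"
      using assms by (simp add: C_def powr_powr)
    ultimately have "1 \<le> e * \<bar>x\<bar> powr (p - 1)"
      using assms by (simp add: field_simps)
    then have "\<bar>x\<bar> * 1 \<le> \<bar>x\<bar> * (e * \<bar>x\<bar> powr (p - 1))"
      by (intro mult_left_mono) auto
    also have "\<dots> = e * \<bar>x\<bar> powr p"
      using False C by (simp add: powr_diff)
    finally show ?thesis using C by simp
  qed
  with C show ?thesis using that by blast
qed

text \<open>The bound $|x| \le \varepsilon |x|^p + C$ turns the moment condition into one-sided bounds to
  which Fatou's lemma applies.\<close>

lemma integral_convergence_weighted_upper:
  fixes r q w :: "nat \<Rightarrow> 'a \<Rightarrow> real" and r0 q0 w0 :: "'a \<Rightarrow> real"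
  assumes [measurable]: "\<And>m. r m \<in> borel_measurable M" "\<And>m. q m \<in> borel_measurable M"
      "\<And>m. w m \<in> borel_measurable M" "r0 \<in> borel_measurable M" "q0 \<in> borel_measurable M"
      "w0 \<in> borel_measurable M"
    and lim: "AE x in M. (\<lambda>m. r m x) \<longlonglongrightarrow> r0 x" "AE x in M. (\<lambda>m. q m x) \<longlonglongrightarrow> q0 x"
      "AE x in M. (\<lambda>m. w m x) \<longlonglongrightarrow> w0 x"
    and dom: "\<And>m. AE x in M. \<bar>r m x\<bar> \<le> \<bar>q m x\<bar> * w m x"
    and w_nonneg: "\<And>m. AE x in M. 0 \<le> w m x"
    and w_int: "\<And>m. integrable M (w m)" "integrable M w0" "(\<lambda>m. \<integral>x. w m x \<partial>M) \<longlonglongrightarrow> (\<integral>x. w0 x \<partial>M)"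
    and p: "1 < p"
    and bound: "\<And>m. (\<integral>\<^sup>+x. ennreal (\<bar>q m x\<bar> powr p * w m x) \<partial>M) \<le> ennreal K"
  shows "\<And>m. integrable M (r m)" "integrable M r0"
    "0 < e \<Longrightarrow> \<forall>\<^sub>F m in sequentially. (\<integral>x. r m x \<partial>M) < (\<integral>x. r0 x \<partial>M) + e"
proof -
  define g where "g m x = \<bar>q m x\<bar> powr p * w m x" for m x
  define g0 where "g0 x = \<bar>q0 x\<bar> powr p * w0 x" for x
  have gM[measurable]: "g m \<in> borel_measurable M" "g0 \<in> borel_measurable M" for m
    unfolding g_def g0_def by measurable
  have w_all: "AE x in M. \<forall>m. 0 \<le> w m x" "AE x in M. \<forall>m. \<bar>r m x\<bar> \<le> \<bar>q m x\<bar> * w m x"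
    using w_nonneg dom by (auto simp: AE_all_countable)
  have w0: "AE x in M. 0 \<le> w0 x"
    using lim(3) w_all(1) by eventually_elim (auto intro!: LIMSEQ_le_const)
  have g_lim: "AE x in M. (\<lambda>m. g m x) \<longlonglongrightarrow> g0 x"
    using lim(2,3) by eventually_elim (use p in \<open>auto simp: g_def g0_def intro!: tendsto_intros\<close>)
  have r0_dom: "AE x in M. \<bar>r0 x\<bar> \<le> \<bar>q0 x\<bar> * w0 x"
    using lim w_all(2)
    by eventually_elim
      (rule LIMSEQ_le[OF tendsto_rabs tendsto_mult[OF tendsto_rabs]], assumption+, auto)
  have g_nonneg: "AE x in M. 0 \<le> g m x" "AE x in M. 0 \<le> g0 x" for m
    using w_nonneg[of m] w0 by (auto simp: g_def g0_def)
  have g_bound: "(\<integral>\<^sup>+x. ennreal (g m x) \<partial>M) \<le> ennreal K" for m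
    using bound by (simp add: g_def)
  have g_int: "integrable M (g m)" for m
    using g_nonneg(1) g_bound[of m] by (intro integrableI_nonneg) (auto simp: le_less_trans)
  have g_le: "(\<integral>x. g m x \<partial>M) \<le> max K 0" for m
  proof -
    have "ennreal (\<integral>x. g m x \<partial>M) \<le> ennreal K"
      using g_bound[of m] nn_integral_eq_integral[OF g_int g_nonneg(1)] by simp
    then show ?thesis using integral_nonneg_AE[OF g_nonneg(1)[of m]]
      by (cases "0 \<le> K") (auto simp: ennreal_le_iff ennreal_neg)
  qed
  have "(\<integral>\<^sup>+x. ennreal (g0 x) \<partial>M) = (\<integral>\<^sup>+x. liminf (\<lambda>m. ennreal (g m x)) \<partial>M)"
    using g_lim by (intro nn_integral_cong_AE, elim AE_mp)
      (auto intro!: AE_I2 lim_imp_Liminf[symmetric] tendsto_ennrealI)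
  also have "\<dots> \<le> liminf (\<lambda>m. \<integral>\<^sup>+x. ennreal (g m x) \<partial>M)"
    by (intro nn_integral_liminf) auto
  also have "\<dots> \<le> liminf (\<lambda>m. ennreal K)"
    using bound by (intro Liminf_mono) (auto simp: g_def)
  also have "\<dots> < \<infinity>" by (simp add: Liminf_const)
  finally have g0_int: "integrable M g0"
    using g_nonneg(2) by (intro integrableI_nonneg) auto
  have dom': "AE x in M. \<bar>r m x\<bar> \<le> e * g m x + C * w m x"
    if "\<And>x. \<bar>x\<bar> \<le> e * \<bar>x\<bar> powr p + C" for e C m
    using dom[of m] w_nonneg[of m]
  proof eventually_elim
    case (elim x)
    have "\<bar>q m x\<bar> * w m x \<le> (e * \<bar>q m x\<bar> powr p + C) * w m x"
      using elim that by (intro mult_right_mono) auto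
    with elim show ?case by (simp add: g_def algebra_simps)
  qed
  have dom0: "AE x in M. \<bar>r0 x\<bar> \<le> e * g0 x + C * w0 x"
    if "\<And>x. \<bar>x\<bar> \<le> e * \<bar>x\<bar> powr p + C" for e C
    using r0_dom w0
  proof eventually_elim
    case (elim x)
    have "\<bar>q0 x\<bar> * w0 x \<le> (e * \<bar>q0 x\<bar> powr p + C) * w0 x"
      using elim that by (intro mult_right_mono) auto
    with elim show ?case by (simp add: g0_def algebra_simps)
  qed
  obtain C1 where C1: "0 < C1" "\<And>x. \<bar>x\<bar> \<le> 1 * \<bar>x\<bar> powr p + C1"
    using linear_le_scaled_powr[OF p zero_less_one] by blast
  show r_int: "integrable M (r m)" for m
    by (rule Bochner_Integration.integrable_bound[where f="\<lambda>x. 1 * g m x + C1 * w m x"])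
      (use g_int[of m] w_int(1)[of m] dom'[OF C1(2), of m] in \<open>auto elim!: AE_mp\<close>)
  show r0_int: "integrable M r0"
    by (rule Bochner_Integration.integrable_bound[where f="\<lambda>x. 1 * g0 x + C1 * w0 x"])
      (use g0_int w_int(2) dom0[OF C1(2)] in \<open>auto elim!: AE_mp\<close>)
  show "\<forall>\<^sub>F m in sequentially. (\<integral>x. r m x \<partial>M) < (\<integral>x. r0 x \<partial>M) + e" if e: "0 < e"
  proof -
    \<comment> \<open>The moment term then costs at most e / 4. Two further quarters go to Fatou's
      lemma and to the convergence of the integrals of \<open>w\<close>.\<close>
    define d where "d = e / (4 * (max K 0 + 1))"
    have d: "0 < d" "d * max K 0 \<le> e / 4"
      using e by (auto simp: d_def field_simps)
    obtain C where C: "0 < C" "\<And>x. \<bar>x\<bar> \<le> d * \<bar>x\<bar> powr p + C"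
      using linear_le_scaled_powr[OF p d(1)] by blast
    \<comment> \<open>Nonnegative by the choice of \<open>C\<close>. Since \<open>r\<close> enters
      with a minus sign, the lower bound that Fatou gives for \<open>u\<close> is an upper bound for
      \<open>r\<close>.\<close>
    define u where "u m x = d * g m x + C * w m x - r m x" for m x
    define u0 where "u0 x = d * g0 x + C * w0 x - r0 x" for x
    have [measurable]: "u m \<in> borel_measurable M" "u0 \<in> borel_measurable M" for m
      unfolding u_def u0_def by measurable
    have u_nonneg: "AE x in M. 0 \<le> u m x" "AE x in M. 0 \<le> u0 x" for m
      using dom'[OF C(2), of m] dom0[OF C(2)] by (auto simp: u_def u0_def elim!: AE_mp)
    have ui: "(\<integral>x. u m x \<partial>M) = d * (\<integral>x. g m x \<partial>M) + C * (\<integral>x. w m x \<partial>M) - (\<integral>x. r m x \<partial>M)"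
      "integrable M (u m)" for m
      unfolding u_def using g_int w_int(1) r_int by auto
    have u0i: "(\<integral>x. u0 x \<partial>M) = d * (\<integral>x. g0 x \<partial>M) + C * (\<integral>x. w0 x \<partial>M) - (\<integral>x. r0 x \<partial>M)"
      "integrable M u0"
      unfolding u0_def using g0_int w_int(2) r0_int by auto
    have "AE x in M. (\<lambda>m. u m x) \<longlonglongrightarrow> u0 x"
      using g_lim lim by eventually_elim (auto simp: u_def u0_def intro!: tendsto_intros)
    then have "(\<integral>\<^sup>+x. ennreal (u0 x) \<partial>M) = (\<integral>\<^sup>+x. liminf (\<lambda>m. ennreal (u m x)) \<partial>M)"
      by (intro nn_integral_cong_AE, elim AE_mp)
        (auto intro!: AE_I2 lim_imp_Liminf[symmetric] tendsto_ennrealI)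
    also have "\<dots> \<le> liminf (\<lambda>m. \<integral>\<^sup>+x. ennreal (u m x) \<partial>M)"
      by (intro nn_integral_liminf) auto
    also have "(\<lambda>m. \<integral>\<^sup>+x. ennreal (u m x) \<partial>M) = (\<lambda>m. ennreal (\<integral>x. u m x \<partial>M))"
      using u_nonneg(1) ui(2) by (intro ext nn_integral_eq_integral)
    also have "(\<integral>\<^sup>+x. ennreal (u0 x) \<partial>M) = ennreal (\<integral>x. u0 x \<partial>M)"
      using u_nonneg(2) u0i(2) by (intro nn_integral_eq_integral)
    finally have lin: "ennreal (\<integral>x. u0 x \<partial>M) \<le> liminf (\<lambda>m. ennreal (\<integral>x. u m x \<partial>M))" .
    \<comment> \<open>\<open>ennreal\<close> truncates at 0, so a negative threshold cannot be
      compared there; it lies below every integral of the nonnegative \<open>u m\<close>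
      anyway.\<close>
    have ev: "\<forall>\<^sub>F m in sequentially. (\<integral>x. u0 x \<partial>M) - e / 4 < (\<integral>x. u m x \<partial>M)"
    proof (cases "(\<integral>x. u0 x \<partial>M) - e / 4 < 0")
      case True
      have "0 \<le> (\<integral>x. u m x \<partial>M)" for m using u_nonneg by (intro integral_nonneg_AE) auto
      then show ?thesis by (intro always_eventually allI less_le_trans[OF True])
    next
      case False
      then have "ennreal ((\<integral>x. u0 x \<partial>M) - e / 4) < ennreal (\<integral>x. u0 x \<partial>M)"
        using e by (intro ennreal_lessI) auto
      then have "\<forall>\<^sub>F m in sequentially. ennreal ((\<integral>x. u0 x \<partial>M) - e / 4) < ennreal (\<integral>x. u m x \<partial>M)"
        using lin by (auto simp: le_Liminf_iff)
      then show ?thesis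
        by eventually_elim (use False in \<open>simp add: ennreal_less_iff\<close>)
    qed
    have "\<forall>\<^sub>F m in sequentially. C * (\<integral>x. w m x \<partial>M) < C * (\<integral>x. w0 x \<partial>M) + e / 4"
      using w_int(3) e by (intro order_tendstoD(2)[of _ "C * (\<integral>x. w0 x \<partial>M)"] tendsto_intros) auto
    with ev show ?thesis
    proof eventually_elim
      case (elim m)
      have "d * (\<integral>x. g m x \<partial>M) \<le> e / 4"
        using g_le[of m] d mult_left_mono[OF g_le[of m], of d] by linarith
      moreover have "0 \<le> d * (\<integral>x. g0 x \<partial>M)"
        using d g_nonneg(2) by (intro mult_nonneg_nonneg integral_nonneg_AE) auto
      ultimately show ?case using elim unfolding ui u0i using e by linarith
    qed
  qed
qed

text \<open>The one-sided estimate applied to \<open>r\<close> and to \<open>- r\<close>. It serves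
  as a dominated convergence theorem for varying laws: in the applications \<open>w\<close> is built
  from densities at moving parameters, and the moments of \<open>q\<close> are taken with weight
  \<open>w\<close>.\<close>

lemma integral_convergence_weighted:
  fixes r q w :: "nat \<Rightarrow> 'a \<Rightarrow> real" and r0 q0 w0 :: "'a \<Rightarrow> real"
  assumes meas: "\<And>m. r m \<in> borel_measurable M" "\<And>m. q m \<in> borel_measurable M"
      "\<And>m. w m \<in> borel_measurable M" "r0 \<in> borel_measurable M" "q0 \<in> borel_measurable M"
      "w0 \<in> borel_measurable M"
    and lim: "AE x in M. (\<lambda>m. r m x) \<longlonglongrightarrow> r0 x" "AE x in M. (\<lambda>m. q m x) \<longlonglongrightarrow> q0 x"
      "AE x in M. (\<lambda>m. w m x) \<longlonglongrightarrow> w0 x"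
    and dom: "\<And>m. AE x in M. \<bar>r m x\<bar> \<le> \<bar>q m x\<bar> * w m x"
    and w_nonneg: "\<And>m. AE x in M. 0 \<le> w m x"
    and w_int: "\<And>m. integrable M (w m)" "integrable M w0" "(\<lambda>m. \<integral>x. w m x \<partial>M) \<longlonglongrightarrow> (\<integral>x. w0 x \<partial>M)"
    and p: "1 < p"
    and bound: "\<And>m. (\<integral>\<^sup>+x. ennreal (\<bar>q m x\<bar> powr p * w m x) \<partial>M) \<le> ennreal K"
  shows "\<And>m. integrable M (r m)" "integrable M r0" "(\<lambda>m. \<integral>x. r m x \<partial>M) \<longlonglongrightarrow> (\<integral>x. r0 x \<partial>M)"
proof -
  note A = integral_convergence_weighted_upper[OF meas lim dom w_nonneg w_int p bound]
  have lim': "AE x in M. (\<lambda>m. - r m x) \<longlonglongrightarrow> - r0 x"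
    using lim(1) by eventually_elim (rule tendsto_minus)
  note B = integral_convergence_weighted_upper(3)[OF borel_measurable_uminus[OF meas(1)] meas(2,3)
    borel_measurable_uminus[OF meas(4)] meas(5,6) lim' lim(2,3) _ w_nonneg w_int p bound]
  show "\<And>m. integrable M (r m)" "integrable M r0" by (rule A)+
  show "(\<lambda>m. \<integral>x. r m x \<partial>M) \<longlonglongrightarrow> (\<integral>x. r0 x \<partial>M)"
  proof (rule order_tendstoI)
    fix a assume a: "a < (\<integral>x. r0 x \<partial>M)"
    from B[of "(\<integral>x. r0 x \<partial>M) - a"] dom a
    have "\<forall>\<^sub>F m in sequentially. (\<integral>x. - r m x \<partial>M) < (\<integral>x. - r0 x \<partial>M) + ((\<integral>x. r0 x \<partial>M) - a)"
      by simp
    then show "\<forall>\<^sub>F m in sequentially. a < (\<integral>x. r m x \<partial>M)"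
      by eventually_elim simp
  next
    fix a assume "(\<integral>x. r0 x \<partial>M) < a"
    then show "\<forall>\<^sub>F m in sequentially. (\<integral>x. r m x \<partial>M) < a"
      using A(3)[of "a - (\<integral>x. r0 x \<partial>M)"] by simp
  qed
qed

section \<open>Positive definite matrices and characteristic functions\<close>

lemma exp_minus_quadratic_bound:
  fixes x :: real assumes "0 \<le> x"
  shows "\<bar>exp (- x) - (1 - x)\<bar> \<le> x\<^sup>2 / 2"
proof -
  \<comment> \<open>The product equals 1 + x ^ 4 / 4.\<close>
  have "1 * 1 \<le> (1 + x + x\<^sup>2 / 2) * (1 - x + x\<^sup>2 / 2)"
    using assms by (simp add: algebra_simps power2_eq_square)
  also have "\<dots> \<le> exp x * (1 - x + x\<^sup>2 / 2)"
  proof (intro mult_right_mono exp_lower_Taylor_quadratic assms)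
    have "0 \<le> (1 - x)\<^sup>2 + 1" by simp
    then show "0 \<le> 1 - x + x\<^sup>2 / 2" by (simp add: power2_eq_square algebra_simps)
  qed
  finally have "exp (- x) \<le> 1 - x + x\<^sup>2 / 2"
    by (simp add: exp_minus field_simps)
  moreover have "1 - x \<le> exp (- x)" using exp_ge_add_one_self[of "-x"] by simp
  ultimately show ?thesis by simp
qed

text \<open>The minimum is the remainder in the third order expansion of a characteristic function.
  The power p between 2 and 3 dominates the cube on [-1, 1] and the square outside.\<close>

lemma min_square_cube_le_powr:
  fixes x p :: real assumes "2 < p" "p \<le> 3"
  shows "min (6 * x\<^sup>2) (\<bar>x\<bar> ^ 3) \<le> 6 * \<bar>x\<bar> powr p"
proof (cases "\<bar>x\<bar> \<le> 1")
  case True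
  then have "\<bar>x\<bar> powr 3 \<le> \<bar>x\<bar> powr p"
    using assms by (cases "x = 0") (auto simp del: powr_numeral intro!: powr_mono')
  moreover have "\<bar>x\<bar> powr 3 = \<bar>x\<bar> ^ 3"
    by (cases "x = 0") (auto simp: powr_numeral)
  moreover have "0 \<le> \<bar>x\<bar> powr p" by simp
  ultimately show ?thesis by linarith
next
  case False
  then have "\<bar>x\<bar> powr 2 \<le> \<bar>x\<bar> powr p" using assms by (intro powr_mono) auto
  moreover have "\<bar>x\<bar> powr 2 = x\<^sup>2" using False by (auto simp: powr_numeral)
  ultimately show ?thesis by linarith
qed

lemma square_le_one_plus_powr:
  fixes x p :: real assumes "2 \<le> p"
  shows "x\<^sup>2 \<le> 1 + \<bar>x\<bar> powr p"
proof (cases "\<bar>x\<bar> \<le> 1")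
  case True
  then have "x\<^sup>2 \<le> 1" by (simp add: abs_square_le_1)
  then show ?thesis by (smt (verit) powr_ge_zero)
next
  case False
  then have "\<bar>x\<bar> powr 2 \<le> \<bar>x\<bar> powr p" using assms by (intro powr_mono) auto
  moreover have "\<bar>x\<bar> powr 2 = x\<^sup>2" using False by (auto simp: powr_numeral)
  ultimately show ?thesis by linarith
qed

lemma (in prob_space) integrable_powr_imp_square:
  fixes X :: "'a \<Rightarrow> real"
  assumes [measurable]: "X \<in> borel_measurable M" and "2 \<le> p" "integrable M (\<lambda>w. \<bar>X w\<bar> powr p)"
  shows "integrable M (\<lambda>w. (X w)\<^sup>2)" "integrable M X"
proof -
  show *: "integrable M (\<lambda>w. (X w)\<^sup>2)"
    by (rule Bochner_Integration.integrable_bound[where f="\<lambda>w. 1 + \<bar>X w\<bar> powr p"])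
      (use assms square_le_one_plus_powr[OF assms(2)] in \<open>auto simp: abs_of_nonneg\<close>)
  show "integrable M X" by (rule square_integrable_imp_integrable[OF _ *]) simp
qed

text \<open>Both terms are products over \<open>I\<close> of factors of modulus at most 1, so the
  error is at most the sum of the errors of the factors. Each factor is compared with 1 - s/2, where
  s is the variance of the summand: on one side by the third order expansion, on the other by
  \<open>exp_minus_quadratic_bound\<close>. The bound is explicit and hence uniform over probability
  spaces.\<close>

lemma (in prob_space) lyapunov_char_bound:
  fixes X :: "'i \<Rightarrow> 'a \<Rightarrow> real"
  assumes ind: "indep_vars (\<lambda>_. borel) X I" and fin: "finite I"
    and int: "\<And>i. i \<in> I \<Longrightarrow> integrable M (\<lambda>w. \<bar>X i w\<bar> powr p)"
    and mean: "\<And>i. i \<in> I \<Longrightarrow> expectation (X i) = 0"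
    and p: "2 < p" "p \<le> 3"
  shows "cmod ((CLINT w|M. iexp (\<Sum>i\<in>I. X i w)) - exp (- (\<Sum>i\<in>I. expectation (\<lambda>w. (X i w)\<^sup>2)) / 2))
    \<le> (\<Sum>i\<in>I. expectation (\<lambda>w. \<bar>X i w\<bar> powr p) + (expectation (\<lambda>w. (X i w)\<^sup>2))\<^sup>2 / 8)"
proof -
  have [measurable]: "i \<in> I \<Longrightarrow> X i \<in> borel_measurable M" for i
    using ind by (auto simp: indep_vars_def)
  define \<phi> where "\<phi> i = char (distr M borel (X i)) 1" for i
  define s where "s i = expectation (\<lambda>w. (X i w)\<^sup>2)" for i
  have s0: "0 \<le> s i" for i by (simp add: s_def)
  have "(CLINT w|M. iexp (\<Sum>i\<in>I. X i w)) = char (distr M borel (\<lambda>w. \<Sum>i\<in>I. X i w)) 1"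
    by (simp add: char_def integral_distr)
  also have "\<dots> = (\<Prod>i\<in>I. \<phi> i)" unfolding \<phi>_def by (rule char_distr_sum[OF ind])
  finally have 1: "(CLINT w|M. iexp (\<Sum>i\<in>I. X i w)) = (\<Prod>i\<in>I. \<phi> i)" .
  have 2: "complex_of_real (exp (- (\<Sum>i\<in>I. s i) / 2)) = (\<Prod>i\<in>I. complex_of_real (exp (- s i / 2)))"
    using fin by (simp add: exp_sum sum_negf[symmetric] sum_divide_distrib flip: of_real_prod)
  have "cmod ((\<Prod>i\<in>I. \<phi> i) - (\<Prod>i\<in>I. complex_of_real (exp (- s i / 2))))
      \<le> (\<Sum>i\<in>I. cmod (\<phi> i - complex_of_real (exp (- s i / 2))))"
  proof (rule norm_prod_diff)
    fix i assume i: "i \<in> I"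
    interpret D: real_distribution "distr M borel (X i)"
      using i by (intro real_distribution_distr) auto
    show "cmod (\<phi> i) \<le> 1" unfolding \<phi>_def by (rule D.cmod_char_le_1)
    show "cmod (complex_of_real (exp (- s i / 2))) \<le> 1" using s0[of i] by simp
  qed
  also have "\<dots> \<le> (\<Sum>i\<in>I. expectation (\<lambda>w. \<bar>X i w\<bar> powr p) + (s i)\<^sup>2 / 8)"
  proof (rule sum_mono)
    fix i assume i: "i \<in> I"
    note sq = integrable_powr_imp_square[OF _ less_imp_le[OF p(1)] int[OF i]]
    have rv: "X i \<in> borel_measurable M" using i by measurable
    have "cmod (\<phi> i - complex_of_real (1 - 1\<^sup>2 * s i / 2))
      \<le> 1\<^sup>2 / 6 * expectation (\<lambda>w. min (6 * (X i w)\<^sup>2) (\<bar>1\<bar> * \<bar>X i w\<bar> ^ 3))"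
      unfolding \<phi>_def of_real_diff of_real_divide of_real_mult of_real_power
      using char_approx3'[OF rv sq(2) sq(1) mean[OF i] _ refl, of "s i" 1] rv mean[OF i]
      by (simp add: s_def)
    also have "\<dots> \<le> 1\<^sup>2 / 6 * expectation (\<lambda>w. 6 * \<bar>X i w\<bar> powr p)"
    proof (intro mult_left_mono integral_mono)
      show "integrable M (\<lambda>w. min (6 * (X i w)\<^sup>2) (\<bar>1\<bar> * \<bar>X i w\<bar> ^ 3))"
        by (rule Bochner_Integration.integrable_bound[where f="\<lambda>w. 6 * \<bar>X i w\<bar> powr p"])
          (use int[OF i] i min_square_cube_le_powr[OF p] in \<open>auto simp: abs_of_nonneg\<close>)
    qed (use int[OF i] min_square_cube_le_powr[OF p] in auto)
    finally have a: "cmod (\<phi> i - complex_of_real (1 - s i / 2)) \<le> expectation (\<lambda>w. \<bar>X i w\<bar> powr p)"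
      by simp
    have "cmod (complex_of_real (1 - s i / 2) - complex_of_real (exp (- s i / 2))) = \<bar>exp (- (s i / 2)) - (1 - s i / 2)\<bar>"
      unfolding of_real_diff[symmetric] norm_of_real by simp
    also have "\<dots> \<le> (s i / 2)\<^sup>2 / 2"
      using s0[of i] by (intro exp_minus_quadratic_bound) auto
    finally have b: "cmod (complex_of_real (1 - s i / 2) - complex_of_real (exp (- s i / 2))) \<le> (s i)\<^sup>2 / 8"
      by (simp add: power_divide)
    show "cmod (\<phi> i - complex_of_real (exp (- s i / 2))) \<le> expectation (\<lambda>w. \<bar>X i w\<bar> powr p) + (s i)\<^sup>2 / 8"
      using norm_triangle_mono[OF a b] by simp
  qed
  finally show ?thesis unfolding 1 2[unfolded s_def] s_def .
qed

text \<open>Gram-Schmidt for the form A: fewer than d vectors \<open>A *v b j\<close> leave a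
  nonzero \<open>x\<close> orthogonal to all of them, and positivity allows it to be scaled. Such a
  basis takes the place of a square root of the inverse matrix when a sum is standardized.\<close>

lemma pos_definite_orthonormal_basis:
  fixes A :: "real ^ 'd ^ 'd"
  assumes pd: "pos_definite A" and sym: "\<And>x y. x \<bullet> (A *v y) = y \<bullet> (A *v x)"
  shows "\<exists>b :: 'd \<Rightarrow> real ^ 'd. \<forall>i j. b i \<bullet> (A *v b j) = (if i = j then 1 else 0)"
proof -
  have "\<exists>b. \<forall>i\<in>J. \<forall>j\<in>J. b i \<bullet> (A *v b j) = (if i = j then 1 else 0)" for J :: "'d set"
    using finite[of J]
  proof (induction J rule: finite_induct)
    case (insert k J)
    then obtain b where b: "\<forall>i\<in>J. \<forall>j\<in>J. b i \<bullet> (A *v b j) = (if i = j then 1 else 0)" by blast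
    define S where "S = (\<lambda>j. A *v b j) ` J"
    have "dim S \<le> card S" by (intro dim_le_card' ) (auto simp: S_def)
    also have "\<dots> \<le> card J" unfolding S_def by (intro card_image_le) auto
    also have "\<dots> < card (insert k J)" using insert by simp
    also have "\<dots> \<le> DIM(real ^ 'd)" by (simp add: card_mono)
    finally obtain x where x: "x \<noteq> 0" "\<And>y. y \<in> span S \<Longrightarrow> orthogonal x y"
      using orthogonal_to_subspace_exists by blast
    have pos: "0 < x \<bullet> (A *v x)" using pd x by (auto simp: pos_definite_def)
    define z where "z = (1 / sqrt (x \<bullet> (A *v x))) *\<^sub>R x"
    have z1: "z \<bullet> (A *v z) = 1"
      using pos by (simp add: z_def matrix_vector_mult_scaleR)
    have z2: "z \<bullet> (A *v b j) = 0" if "j \<in> J" for j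
      using x(2)[of "A *v b j"] that by (auto simp: z_def orthogonal_def S_def span_base)
    have z3: "b j \<bullet> (A *v z) = 0" if "j \<in> J" for j
      using z2[OF that] sym by metis
    show ?case
      using b z1 z2 z3 insert.hyps by (intro exI[of _ "b(k := z)"]) auto
  qed auto
  from this[of UNIV] show ?thesis by simp
qed

text \<open>For $B$ with columns \<open>b j\<close> one has $B^T A B = I$, hence $A^{-1} = B B^T$.\<close>

lemma pos_definite_basis_quadratic:
  fixes A :: "real ^ 'd ^ 'd" and b :: "'d \<Rightarrow> real ^ 'd"
  assumes b: "\<And>i j. b i \<bullet> (A *v b j) = (if i = j then 1 else 0)"
    and x: "A *v x = s"
  shows "s \<bullet> x = (\<Sum>j\<in>UNIV. (b j \<bullet> s)\<^sup>2)"
    and "(\<Sum>j\<in>UNIV. t j *\<^sub>R b j) \<bullet> (A *v (\<Sum>j\<in>UNIV. t j *\<^sub>R b j)) = (\<Sum>j\<in>UNIV. (t j)\<^sup>2)"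
proof -
  have lin: "A *v (\<Sum>j\<in>UNIV. t j *\<^sub>R b j) = (\<Sum>j\<in>UNIV. t j *\<^sub>R (A *v b j))" for t
    by (simp add: linear_sum[OF matrix_vector_mul_linear] matrix_vector_mult_scaleR)
  have comb: "b i \<bullet> (A *v (\<Sum>j\<in>UNIV. t j *\<^sub>R b j)) = t i" for t i
    unfolding lin by (simp add: inner_sum_right b if_distrib sum.delta' cong: if_cong)
  show "(\<Sum>j\<in>UNIV. t j *\<^sub>R b j) \<bullet> (A *v (\<Sum>j\<in>UNIV. t j *\<^sub>R b j)) = (\<Sum>j\<in>UNIV. (t j)\<^sup>2)"
    by (subst inner_sum_left) (simp add: comb power2_eq_square)
  have inj: "inj b"
  proof (rule injI)
    fix i j assume "b i = b j" with b[of i i] b[of i j] show "i = j" by (auto split: if_splits)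
  qed
  \<comment> \<open>Pairing a combination with \<open>b i\<close> through A reads off its i-th
    coefficient, so these d vectors are independent and span the space.\<close>
  have "independent (range b)"
  proof (rule independent_if_scalars_zero)
    fix f y assume 0: "(\<Sum>x\<in>range b. f x *\<^sub>R x) = 0" and y: "y \<in> range b"
    have "(\<Sum>j\<in>UNIV. f (b j) *\<^sub>R b j) = 0" using 0 by (simp add: sum.reindex[OF inj] o_def)
    then have "f (b i) = 0" for i using comb[of i "\<lambda>j. f (b j)"] by simp
    then show "f y = 0" using y by auto
  qed auto
  moreover have "card (range b) = DIM(real ^ 'd)" using inj by (simp add: card_image)
  ultimately have "x \<in> span (range b)"
    using card_eq_dim[of "range b" UNIV] by auto
  then obtain c where c: "x = (\<Sum>y\<in>range b. c y *\<^sub>R y)"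
    by (auto simp: span_finite)
  define t where "t j = c (b j)" for j
  have x': "x = (\<Sum>j\<in>UNIV. t j *\<^sub>R b j)" unfolding c t_def by (simp add: sum.reindex[OF inj] o_def)
  have bs: "b j \<bullet> s = t j" for j using comb[of j t] x x' by simp
  have "s \<bullet> x = (\<Sum>j\<in>UNIV. t j * (b j \<bullet> s))"
    by (subst x') (simp add: inner_sum_right inner_commute)
  then show "s \<bullet> x = (\<Sum>j\<in>UNIV. (b j \<bullet> s)\<^sup>2)"
    by (simp add: bs power2_eq_square)
qed

section \<open>Laplace transforms and the chi-square distribution\<close>

lemma exp_moment_std_normal:
  fixes t :: real
  shows "(CLINT x|std_normal_distribution. iexp (t * x)) = exp (- (t\<^sup>2) / 2)"
  using char_std_normal_distribution by (simp add: char_def fun_eq_iff)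

lemma prob_space_std_normal: "prob_space std_normal_distribution"
  by (rule prob_space_normal_density) simp

lemma product_sigma_finite_std_normal: "product_sigma_finite (\<lambda>i. std_normal_distribution)"
  by (intro product_sigma_finite.intro prob_space_imp_sigma_finite prob_space_std_normal)

lemma prob_space_std_normal_prod: "prob_space (\<Pi>\<^sub>M i\<in>J. std_normal_distribution)"
  by (intro prob_space_PiM prob_space_std_normal)

lemma gaussian_linearization:
  fixes z :: "'i \<Rightarrow> real" and m :: real
  assumes J: "finite J" and m: "0 \<le> m"
  shows "(CLINT G|(\<Pi>\<^sub>M i\<in>J. std_normal_distribution). iexp (\<Sum>j\<in>J. sqrt (2 * m) * G j * z j))
    = exp (- (m * (\<Sum>j\<in>J. (z j)\<^sup>2)))"
proof -
  have "iexp (\<Sum>j\<in>J. sqrt (2 * m) * G j * z j) = (\<Prod>j\<in>J. iexp ((sqrt (2 * m) * z j) * G j))" for G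
    using J by (simp add: sum_distrib_left exp_sum[symmetric] mult_ac)
  then have "(CLINT G|(\<Pi>\<^sub>M i\<in>J. std_normal_distribution). iexp (\<Sum>j\<in>J. sqrt (2 * m) * G j * z j))
    = (\<Prod>j\<in>J. CLINT x|std_normal_distribution. iexp ((sqrt (2 * m) * z j) * x))"
    by (simp only:, intro product_sigma_finite.product_integral_prod[OF product_sigma_finite_std_normal] J prob_space.integrable_iexp prob_space_std_normal) auto
  also have "\<dots> = (\<Prod>j\<in>J. complex_of_real (exp (- (m * (z j)\<^sup>2))))"
    using m by (intro prod.cong refl, subst exp_moment_std_normal) (simp add: power_mult_distrib del: of_real_exp)
  also have "\<dots> = complex_of_real (exp (\<Sum>j\<in>J. - (m * (z j)\<^sup>2)))"
    using J by (simp add: exp_sum)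
  finally show ?thesis by (simp add: sum_negf sum_distrib_left)
qed

lemma laplace_std_normal_prod:
  assumes J: "finite J"
  shows "(\<integral>G. exp (- (m * (\<Sum>j\<in>J. (G j)\<^sup>2))) \<partial>(\<Pi>\<^sub>M i\<in>J. std_normal_distribution))
    = (\<integral>x. exp (- (real m * x\<^sup>2)) \<partial>std_normal_distribution) ^ card J"
proof -
  have "exp (- (m * (\<Sum>j\<in>J. (G j)\<^sup>2))) = (\<Prod>j\<in>J. exp (- (real m * (G j)\<^sup>2)))" for G :: "'a \<Rightarrow> real"
    using J by (simp add: sum_distrib_left exp_sum sum_negf[symmetric])
  moreover have "(\<integral>G. (\<Prod>j\<in>J. exp (- (real m * (G j)\<^sup>2))) \<partial>(\<Pi>\<^sub>M i\<in>J. std_normal_distribution))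
    = (\<Prod>j\<in>J. \<integral>x. exp (- (real m * x\<^sup>2)) \<partial>std_normal_distribution)"
    by (intro product_sigma_finite.product_integral_prod[OF product_sigma_finite_std_normal] J finite_measure.integrable_const_bound[of _ _ 1]
      prob_space.finite_measure[OF prob_space_std_normal]) auto
  ultimately show ?thesis by simp
qed

text \<open>With $G$ standard normal and independent of $Z$, $e^{-m|Z|^2} = E_G e^{i\sqrt{2m}\, G \cdot Z}$, so
  the Laplace transform of $|Z|^2$ is an average of values of the characteristic function of $Z$.\<close>

lemma (in prob_space) laplace_norm_square_bound:
  fixes Z :: "'i \<Rightarrow> 'a \<Rightarrow> real"
  assumes J: "finite J" and [measurable]: "\<And>j. j \<in> J \<Longrightarrow> Z j \<in> borel_measurable M"
    and m: "0 \<le> (m::real)"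
    and [measurable]: "\<beta> \<in> borel_measurable (\<Pi>\<^sub>M i\<in>J. std_normal_distribution)"
    and bound: "\<And>G. cmod ((CLINT w|M. iexp (\<Sum>j\<in>J. sqrt (2 * m) * G j * Z j w))
      - exp (- (m * (\<Sum>j\<in>J. (G j)\<^sup>2)))) \<le> \<beta> G"
  shows "\<bar>expectation (\<lambda>w. exp (- (m * (\<Sum>j\<in>J. (Z j w)\<^sup>2))))
      - (\<integral>G. exp (- (m * (\<Sum>j\<in>J. (G j)\<^sup>2))) \<partial>(\<Pi>\<^sub>M i\<in>J. std_normal_distribution))\<bar>
    \<le> (\<integral>G. min 2 (\<beta> G) \<partial>(\<Pi>\<^sub>M i\<in>J. std_normal_distribution))"
proof -
  let ?N = "\<Pi>\<^sub>M i\<in>J. std_normal_distribution"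
  interpret N: prob_space ?N by (rule prob_space_std_normal_prod)
  interpret P: pair_sigma_finite M ?N by unfold_locales
  interpret PP: pair_prob_space M ?N by unfold_locales
  define h where "h w G = iexp (\<Sum>j\<in>J. sqrt (2 * m) * G j * Z j w)" for w and G :: "'i \<Rightarrow> real"
  have [measurable]: "(\<lambda>G. G j) \<in> borel_measurable ?N" if "j \<in> J" for j
    using measurable_component_singleton[OF that, of "\<lambda>_. std_normal_distribution"] by simp
  have [measurable]: "(\<lambda>(w, G). h w G) \<in> borel_measurable (M \<Otimes>\<^sub>M ?N)"
    unfolding h_def by measurable
  have [measurable]: "(\<lambda>w. h w G) \<in> borel_measurable M" for G
    unfolding h_def by measurable
  have h1: "cmod (h w G) = 1" for w G by (simp add: h_def)
  have "complex_of_real (expectation (\<lambda>w. exp (- (m * (\<Sum>j\<in>J. (Z j w)\<^sup>2)))))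
    = (CLINT w|M. CLINT G|?N. h w G)"
    unfolding h_def gaussian_linearization[OF J m] integral_complex_of_real[symmetric] ..
  also have "\<dots> = (CLINT G|?N. CLINT w|M. h w G)"
    by (intro P.Fubini_integral[symmetric] PP.integrable_const_bound[of _ 1]) (auto simp: h1)
  finally have 1: "complex_of_real (expectation (\<lambda>w. exp (- (m * (\<Sum>j\<in>J. (Z j w)\<^sup>2)))))
    = (CLINT G|?N. CLINT w|M. h w G)" .
  have hE1: "cmod (CLINT w|M. h w G) \<le> 1" for G
    using integral_norm_bound[of M "\<lambda>w. h w G"] by (simp add: h1 prob_space)
  have hEm[measurable]: "(\<lambda>G. CLINT w|M. h w G) \<in> borel_measurable ?N"
    by measurable
  have 2: "complex_of_real (\<integral>G. exp (- (m * (\<Sum>j\<in>J. (G j)\<^sup>2))) \<partial>?N)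
    = (CLINT G|?N. complex_of_real (exp (- (m * (\<Sum>j\<in>J. (G j)\<^sup>2)))))"
    by (rule integral_complex_of_real[symmetric])
  have e1: "\<bar>exp (- (m * (\<Sum>j\<in>J. (G j)\<^sup>2)))\<bar> \<le> 1" for G :: "'i \<Rightarrow> real"
    using m by (simp add: sum_nonneg)
  have i1: "integrable ?N (\<lambda>G. CLINT w|M. h w G)"
    by (intro N.integrable_const_bound[of _ 1]) (auto simp: hE1)
  have i2: "integrable ?N (\<lambda>G. complex_of_real (exp (- (m * (\<Sum>j\<in>J. (G j)\<^sup>2)))))"
    by (intro N.integrable_const_bound[of _ 1] AE_I2) (use e1 in \<open>auto simp del: of_real_exp\<close>)
  \<comment> \<open>The trivial bound for two quantities of modulus at most 1. Capping at 2 keeps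
    the average integrable whatever the growth of \<beta>, and later provides the dominating
    constant.\<close>
  have d2: "cmod ((CLINT w|M. h w G) - complex_of_real (exp (- (m * (\<Sum>j\<in>J. (G j)\<^sup>2))))) \<le> 2" for G
    using norm_triangle_ineq4[of "CLINT w|M. h w G" "complex_of_real (exp (- (m * (\<Sum>j\<in>J. (G j)\<^sup>2))))"]
      hE1[of G] e1[of G] unfolding norm_of_real by linarith
  have \<beta>0: "0 \<le> \<beta> G" for G using order_trans[OF norm_ge_zero bound] .
  have "\<bar>expectation (\<lambda>w. exp (- (m * (\<Sum>j\<in>J. (Z j w)\<^sup>2))))
      - (\<integral>G. exp (- (m * (\<Sum>j\<in>J. (G j)\<^sup>2))) \<partial>?N)\<bar>
     = cmod (CLINT G|?N. (CLINT w|M. h w G) - complex_of_real (exp (- (m * (\<Sum>j\<in>J. (G j)\<^sup>2)))))"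
    by (subst Bochner_Integration.integral_diff[OF i1 i2])
      (simp only: 1[symmetric] 2[symmetric] of_real_diff[symmetric] norm_of_real)
  also have "\<dots> \<le> (\<integral>G. cmod ((CLINT w|M. h w G) - complex_of_real (exp (- (m * (\<Sum>j\<in>J. (G j)\<^sup>2))))) \<partial>?N)"
    by (rule integral_norm_bound)
  also have "\<dots> \<le> (\<integral>G. min 2 (\<beta> G) \<partial>?N)"
  proof (intro integral_mono)
    show "integrable ?N (\<lambda>G. cmod ((CLINT w|M. h w G) - complex_of_real (exp (- (m * (\<Sum>j\<in>J. (G j)\<^sup>2))))))"
      using i1 i2 by (intro integrable_norm Bochner_Integration.integrable_diff)
    show "integrable ?N (\<lambda>G. min 2 (\<beta> G))"
      by (intro N.integrable_const_bound[of _ 2]) (use \<beta>0 in auto)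
    show "cmod ((CLINT w|M. h w G) - complex_of_real (exp (- (m * (\<Sum>j\<in>J. (G j)\<^sup>2))))) \<le> min 2 (\<beta> G)" for G
      using d2[of G] bound[of G] by (simp add: h_def)
  qed
  finally show ?thesis .
qed

text \<open>The Laplace transform of \<open>T\<close> at m is the m-th moment of exp (- T), a
  variable with values in (0,1]; finitely many of these moments are compared. Nonnegativity is
  required at every point, so that exp (- T) never leaves [0,1].\<close>

definition laplace_close ::
  "nat \<Rightarrow> real \<Rightarrow> 'a measure \<Rightarrow> ('a \<Rightarrow> real) \<Rightarrow> 'b measure \<Rightarrow> ('b \<Rightarrow> real) \<Rightarrow> bool" where
  "laplace_close N d P T Q U \<longleftrightarrow>
     prob_space P \<and> prob_space Q \<and> T \<in> borel_measurable P \<and> U \<in> borel_measurable Q \<and>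
     (\<forall>w. 0 \<le> T w) \<and> (\<forall>w. 0 \<le> U w) \<and>
     (\<forall>m\<le>N. \<bar>(\<integral>w. exp (- (real m * T w)) \<partial>P) - (\<integral>w. exp (- (real m * U w)) \<partial>Q)\<bar> \<le> d)"

text \<open>Continuous functions on $[0,1]$ are uniformly approximated by polynomials in $e^{-x}$.\<close>

lemma laplace_controls_expectation:
  fixes h :: "real \<Rightarrow> real"
  assumes h: "continuous_on {0..1} h" and e: "0 < e"
  shows "\<exists>N d. 0 < d \<and> (\<forall>P T Q U. laplace_close N d P T Q U \<longrightarrow>
      \<bar>(\<integral>w. h (exp (- T w)) \<partial>P) - (\<integral>w. h (exp (- U w)) \<partial>Q)\<bar> \<le> e)"
proof -
  obtain g where g: "real_polynomial_function g" "\<And>x. x \<in> {0..1} \<Longrightarrow> \<bar>h x - g x\<bar> < e / 3"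
    using Stone_Weierstrass_real_polynomial_function[OF compact_Icc h, of "e / 3"] e by auto
  then obtain a N where ga: "g = (\<lambda>x. \<Sum>i\<le>N. a i * x ^ i)"
    by (auto simp: real_polynomial_function_iff_sum)
  define A where "A = (\<Sum>i\<le>N. \<bar>a i\<bar>)"
  have A0: "0 \<le> A" by (simp add: A_def sum_nonneg)
  \<comment> \<open>\<open>A\<close> bounds the coefficients of the polynomial, so errors
    \<open>d\<close> in the moments change the integral of \<open>g\<close> by at most e / 3.
    \<open>N\<close> and \<open>d\<close> depend on \<open>h\<close> and \<open>e\<close> alone;
    this is the uniformity in the measures.\<close>
  define d where "d = e / (3 * (A + 1))"
  have d: "0 < d" "d * A \<le> e / 3" using e A0 by (auto simp: d_def field_simps)
  have ghm: "(\<lambda>x. indicator {0..1} x *\<^sub>R h x) \<in> borel_measurable borel"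
    using h by (rule borel_measurable_continuous_on_indicator[rotated]) simp
  have E: "(\<integral>w. g (exp (- T w)) \<partial>P) = (\<Sum>i\<le>N. a i * (\<integral>w. exp (- (real i * T w)) \<partial>P))"
      "\<bar>(\<integral>w. h (exp (- T w)) \<partial>P) - (\<integral>w. g (exp (- T w)) \<partial>P)\<bar> \<le> e / 3"
    if P: "prob_space P" and T[measurable]: "T \<in> borel_measurable P" and T0: "\<And>w. 0 \<le> T w"
    for P :: "'z measure" and T
  proof -
    interpret prob_space P by (rule P)
    have i: "integrable P (\<lambda>w. exp (- (real i * T w)))" for i
      using T0 by (intro integrable_const_bound[of _ 1]) auto
    show "(\<integral>w. g (exp (- T w)) \<partial>P) = (\<Sum>i\<le>N. a i * (\<integral>w. exp (- (real i * T w)) \<partial>P))"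
      unfolding ga using i by (simp add: exp_of_nat_mult[symmetric])
    have ig: "integrable P (\<lambda>w. g (exp (- T w)))"
      unfolding ga using i by (simp add: exp_of_nat_mult[symmetric])
    have in01: "exp (- T w) \<in> {0..1}" for w using T0 by simp
    have hm: "(\<lambda>w. h (exp (- T w))) \<in> borel_measurable P"
      using measurable_compose[OF _ ghm, of "\<lambda>w. exp (- T w)" P] in01 by simp
    have ih: "integrable P (\<lambda>w. h (exp (- T w)))"
    proof (rule Bochner_Integration.integrable_bound[where f="\<lambda>w. \<bar>g (exp (- T w))\<bar> + e / 3"])
      show "AE w in P. norm (h (exp (- T w))) \<le> norm (\<bar>g (exp (- T w))\<bar> + e / 3)"
        using g(2)[OF in01] by (intro AE_I2) (smt (verit) real_norm_def)
    qed (use ig hm in auto)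
    have "\<bar>(\<integral>w. h (exp (- T w)) \<partial>P) - (\<integral>w. g (exp (- T w)) \<partial>P)\<bar> = \<bar>\<integral>w. h (exp (- T w)) - g (exp (- T w)) \<partial>P\<bar>"
      using ih ig by simp
    also have "\<dots> \<le> (\<integral>w. \<bar>h (exp (- T w)) - g (exp (- T w))\<bar> \<partial>P)"
      by (rule integral_abs_bound)
    also have "\<dots> \<le> (\<integral>w. e / 3 \<partial>P)"
      using ih ig g(2)[OF in01] by (intro integral_mono) (auto intro: less_imp_le)
    finally show "\<bar>(\<integral>w. h (exp (- T w)) \<partial>P) - (\<integral>w. g (exp (- T w)) \<partial>P)\<bar> \<le> e / 3"
      by (simp add: prob_space)
  qed
  show ?thesis
  proof (intro exI[of _ N] exI[of _ d] conjI allI impI d)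
    fix P T Q U
    assume lc: "laplace_close N d P T Q U"
    then have P: "prob_space P" "prob_space Q" "T \<in> borel_measurable P" "U \<in> borel_measurable Q"
      "\<And>w. 0 \<le> T w" "\<And>w. 0 \<le> U w" and D:
      "\<And>m. m \<le> N \<Longrightarrow> \<bar>(\<integral>w. exp (- (real m * T w)) \<partial>P) - (\<integral>w. exp (- (real m * U w)) \<partial>Q)\<bar> \<le> d"
      by (simp_all add: laplace_close_def)
    note EP = E[OF P(1,3,5)] and EQ = E[OF P(2,4,6)]
    have "\<bar>(\<integral>w. g (exp (- T w)) \<partial>P) - (\<integral>w. g (exp (- U w)) \<partial>Q)\<bar>
      = \<bar>\<Sum>i\<le>N. a i * ((\<integral>w. exp (- (real i * T w)) \<partial>P) - (\<integral>w. exp (- (real i * U w)) \<partial>Q))\<bar>"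
      unfolding EP(1) EQ(1) by (simp add: sum_subtractf[symmetric] algebra_simps)
    also have "\<dots> \<le> (\<Sum>i\<le>N. \<bar>a i\<bar> * d)"
      using D by (intro order_trans[OF sum_abs] sum_mono) (auto simp: abs_mult intro!: mult_left_mono)
    also have "\<dots> \<le> e / 3" using d(2) by (simp only: A_def sum_distrib_left mult.commute[of _ d])
    finally show "\<bar>(\<integral>w. h (exp (- T w)) \<partial>P) - (\<integral>w. h (exp (- U w)) \<partial>Q)\<bar> \<le> e"
      using EP(2) EQ(2) by linarith
  qed
qed


section \<open>The chi-square law and its quantiles\<close>

lemma chi_square_properties:
  assumes d: "0 < d"
  shows "prob_space (chi_square d)" "sets (chi_square d) = sets borel" "space (chi_square d) = UNIV"
    "AE x in chi_square d. 0 \<le> x" "measure (chi_square d) {x} = 0"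
    "(\<integral>x. exp (- (real m * x)) \<partial>chi_square d) = (\<integral>x. exp (- (real m * x\<^sup>2)) \<partial>std_normal_distribution) ^ d"
proof -
  let ?N = "\<Pi>\<^sub>M i\<in>{..<d}. std_normal_distribution"
  interpret N: prob_space ?N by (rule prob_space_std_normal_prod)
  have [measurable]: "(\<lambda>G. G j) \<in> borel_measurable ?N" if "j < d" for j
    using measurable_component_singleton[of j "{..<d}" "\<lambda>_. std_normal_distribution"] that by simp
  have sq[measurable]: "(\<lambda>G. \<Sum>i<d. (G i)\<^sup>2) \<in> borel_measurable ?N"
    by measurable
  show "prob_space (chi_square d)" unfolding chi_square_def by (rule N.prob_space_distr) (rule sq)
  show "sets (chi_square d) = sets borel" "space (chi_square d) = UNIV" by (simp_all add: chi_square_def)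
  show "AE x in chi_square d. 0 \<le> x"
    unfolding chi_square_def by (subst AE_distr_iff[OF sq]) (auto simp: sum_nonneg)
  show "(\<integral>x. exp (- (real m * x)) \<partial>chi_square d) = (\<integral>x. exp (- (real m * x\<^sup>2)) \<partial>std_normal_distribution) ^ d"
    unfolding chi_square_def using laplace_std_normal_prod[of "{..<d}" m]
    by (subst integral_distr[OF sq]) auto
  obtain k where k: "d = Suc k" using d by (cases d) auto
  let ?A = "{G \<in> space ?N. (\<Sum>i<d. (G i)\<^sup>2) = x}"
  have A: "?A \<in> sets ?N" by measurable
  have "emeasure (chi_square d) {x} = emeasure ?N ?A"
    unfolding chi_square_def by (subst emeasure_distr[OF sq]) (auto intro!: arg_cong[where f="emeasure ?N"])
  also have "\<dots> = (\<integral>\<^sup>+G. indicator ?A G \<partial>?N)" using A by simp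
  \<comment> \<open>The last coordinate is integrated first: once the others are fixed, the equation
    for the sum of squares leaves at most two values for it, a Lebesgue null set.\<close>
  also have "\<dots> = (\<integral>\<^sup>+H. \<integral>\<^sup>+g. indicator ?A (H(k := g)) \<partial>std_normal_distribution \<partial>(\<Pi>\<^sub>M i\<in>{..<k}. std_normal_distribution))"
    unfolding k lessThan_Suc
    using A unfolding k lessThan_Suc by (intro product_sigma_finite.product_nn_integral_insert[OF product_sigma_finite_std_normal]) auto
  also have "\<dots> = (\<integral>\<^sup>+H. 0 \<partial>(\<Pi>\<^sub>M i\<in>{..<k}. std_normal_distribution))"
  proof (rule nn_integral_cong)
    fix H :: "nat \<Rightarrow> real"
    define c where "c = x - (\<Sum>i<k. (H i)\<^sup>2)"
    have "(\<integral>\<^sup>+g. indicator ?A (H(k := g)) \<partial>std_normal_distribution)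
      \<le> (\<integral>\<^sup>+g. indicator {sqrt c, - sqrt c} g \<partial>std_normal_distribution)"
    proof (intro nn_integral_mono)
      fix g
      have "g \<in> {sqrt c, - sqrt c}" if "H(k := g) \<in> ?A"
      proof -
        have "(\<Sum>i<k. ((H(k := g)) i)\<^sup>2) = (\<Sum>i<k. (H i)\<^sup>2)" by (intro sum.cong) auto
        then have "g\<^sup>2 = c" using that by (simp add: k c_def)
        then show ?thesis by (auto simp: real_sqrt_abs abs_if split: if_splits)
      qed
      then show "(indicator ?A (H(k := g)) :: ennreal) \<le> indicator {sqrt c, - sqrt c} g"
        by (auto simp: indicator_def)
    qed
    also have "\<dots> = 0"
    proof -
      have "AE g in lborel. g \<noteq> sqrt c" "AE g in lborel. g \<noteq> - sqrt c"
        by (rule AE_lborel_singleton)+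
      then have "AE g in lborel. ennreal (std_normal_density g) * indicator {sqrt c, - sqrt c} g = 0"
        by eventually_elim auto
      then show ?thesis by (subst nn_integral_density) (simp_all add: nn_integral_0_iff_AE del: nn_integral_indicator)
    qed
    finally show "(\<integral>\<^sup>+g. indicator ?A (H(k := g)) \<partial>std_normal_distribution) = 0" by simp
  qed
  finally show "measure (chi_square d) {x} = 0" by (simp add: measure_def)
qed

lemma real_distribution_chi_square: "0 < d \<Longrightarrow> real_distribution (chi_square d)"
  using chi_square_properties(1-3) by (simp add: real_distribution_def real_distribution_axioms_def)

text \<open>Without atoms the cdf is continuous, so the set whose infimum is the quantile is closed
  and contains it. To the left of the infimum the cdf stays below p, which gives the other
  inequality in the limit.\<close>

lemma cdf_quantile:
  assumes "real_distribution N" and atom: "\<And>x. measure N {x} = 0" and p: "0 < p" "p < 1"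
  shows "cdf N (quantile N p) = p"
proof -
  interpret real_distribution N by fact
  have cont: "isCont (cdf N) x" for x using atom by (simp add: isCont_cdf)
  define S where "S = {x. p \<le> cdf N x}"
  have "\<forall>\<^sub>F x in at_top. p < cdf N x" "\<forall>\<^sub>F x in at_bot. cdf N x < p"
    using order_tendstoD(1)[OF cdf_lim_at_top_prob p(2)] order_tendstoD(2)[OF cdf_lim_at_bot p(1)] by auto
  then obtain a b where a: "p < cdf N a" and b: "\<And>x. x \<le> b \<Longrightarrow> cdf N x < p"
    by (auto simp: eventually_at_top_linorder eventually_at_bot_linorder)
  have ne: "S \<noteq> {}" using less_imp_le[OF a] by (auto simp: S_def)
  have bdd: "bdd_below S" using b by (intro bdd_belowI[of _ b]) (smt (verit) S_def mem_Collect_eq)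
  have "closed S" unfolding S_def
    using cont by (intro closed_Collect_le continuous_on_const) (auto intro: continuous_at_imp_continuous_on)
  then have "Inf S \<in> S" using ne bdd by (rule closed_contains_Inf[rotated 2])
  then have 1: "p \<le> cdf N (quantile N p)" by (simp add: S_def quantile_def)
  have "cdf N x \<le> p" if "x < Inf S" for x
    using cInf_lower[OF _ bdd, of x] that by (force simp: S_def)
  then have "\<forall>\<^sub>F x in at_left (Inf S). cdf N x \<le> p"
    by (auto simp: eventually_at_filter intro!: always_eventually)
  moreover have "(cdf N \<longlongrightarrow> cdf N (Inf S)) (at_left (Inf S))"
    using cont by (intro filterlim_at_split[THEN iffD1, THEN conjunct1]) (auto simp: isCont_def)
  ultimately have "cdf N (Inf S) \<le> p"
    by (intro tendsto_upperbound) auto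
  with 1 show ?thesis by (simp add: S_def quantile_def)
qed

section \<open>A central limit theorem uniform in the measure\<close>

definition ramp :: "real \<Rightarrow> real \<Rightarrow> real \<Rightarrow> real" where
  "ramp a b x = min 1 (max 0 ((x - a) / (b - a)))"

lemma continuous_on_ramp: "continuous_on S (ramp a b)"
  unfolding ramp_def by (cases "b = a") (auto intro!: continuous_intros)

lemma ramp_bounds: "0 \<le> ramp a b x" "ramp a b x \<le> 1"
  by (simp_all add: ramp_def)

text \<open>As t \<mapsto> exp (- t) reverses the order, this ramp is 1 where T \<le> x and 0 where
  T > y: a continuous function of exp (- T) between two indicators.\<close>

lemma (in prob_space) ramp_sandwich:
  assumes [measurable]: "T \<in> borel_measurable M" and xy: "x < y"
  shows "prob {w \<in> space M. T w \<le> x} \<le> expectation (\<lambda>w. ramp (exp (- y)) (exp (- x)) (exp (- T w)))"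
    and "expectation (\<lambda>w. ramp (exp (- y)) (exp (- x)) (exp (- T w))) \<le> prob {w \<in> space M. T w \<le> y}"
proof -
  let ?r = "\<lambda>w. ramp (exp (- y)) (exp (- x)) (exp (- T w))"
  have [measurable]: "?r \<in> borel_measurable M" unfolding ramp_def by measurable
  have int: "integrable M ?r"
    using ramp_bounds by (intro integrable_const_bound[of _ 1]) auto
  have ii: "integrable M (indicator {w \<in> space M. T w \<le> z} :: 'a \<Rightarrow> real)" for z
    by (intro integrable_const_bound[of _ 1]) auto
  have 1: "ramp (exp (- y)) (exp (- x)) (exp (- t)) = 1" if "t \<le> x" for t
  proof -
    have "exp (- x) \<le> exp (- t)" "exp (- y) < exp (- x)" using that xy by auto
    then have "1 \<le> (exp (- t) - exp (- y)) / (exp (- x) - exp (- y))" by (simp add: field_simps)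
    then show ?thesis by (simp add: ramp_def)
  qed
  have 2: "ramp (exp (- y)) (exp (- x)) (exp (- t)) = 0" if "\<not> t \<le> y" for t
  proof -
    have "exp (- t) \<le> exp (- y)" "exp (- y) < exp (- x)" using that xy by auto
    then have "(exp (- t) - exp (- y)) / (exp (- x) - exp (- y)) \<le> 0" by (simp add: divide_le_0_iff)
    then show ?thesis by (simp add: ramp_def)
  qed
  have "prob {w \<in> space M. T w \<le> x} = (\<integral>w. indicator {w \<in> space M. T w \<le> x} w \<partial>M)" by simp
  also have "\<dots> \<le> expectation ?r"
    using int ii 1 ramp_bounds by (intro integral_mono) (auto split: split_indicator)
  finally show "prob {w \<in> space M. T w \<le> x} \<le> expectation ?r" .
  have "expectation ?r \<le> (\<integral>w. indicator {w \<in> space M. T w \<le> y} w \<partial>M)"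
    using int ii 2 ramp_bounds by (intro integral_mono) (auto split: split_indicator)
  then show "expectation ?r \<le> prob {w \<in> space M. T w \<le> y}" by simp
qed

text \<open>Ramps just below and just above \<open>q\<close> squeeze the probability. The width of
  the gap is measured by the fixed law \<open>N\<close>, whose cdf is continuous at
  \<open>q\<close>, so the estimate is uniform in \<open>P\<close> and \<open>T\<close>. On
  \<open>N\<close> the variable is \<open>abs\<close>, which is nonnegative everywhere as
  \<open>laplace_close\<close> demands and almost surely equal to the identity.\<close>

lemma laplace_controls_cdf:
  assumes "real_distribution N" and atom: "\<And>x. measure N {x} = 0" and pos: "AE x in N. 0 \<le> x" and e: "0 < e"
  shows "\<exists>k d. 0 < d \<and> (\<forall>(P :: 'a measure) T. laplace_close k d P T N abs \<longrightarrow>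
      \<bar>measure P {w \<in> space P. T w \<le> q} - cdf N q\<bar> < e)"
proof -
  interpret real_distribution N by fact
  have "isCont (cdf N) q" using atom by (simp add: isCont_cdf)
  then obtain s where s: "0 < s" "\<And>x. \<bar>x - q\<bar> < s \<Longrightarrow> \<bar>cdf N x - cdf N q\<bar> < e / 2"
    using e unfolding continuous_at_eps_delta dist_real_def by (metis half_gt_zero)
  define x y where "x = q - s / 2" and "y = q + s / 2"
  have xy: "x < q" "q < y" "\<bar>cdf N x - cdf N q\<bar> < e / 2" "\<bar>cdf N y - cdf N q\<bar> < e / 2"
    using s(1) s(2)[of x] s(2)[of y] by (auto simp: x_def y_def)
  have e2: "0 < e / 2" using e by simp
  obtain k1 d1 where kd1: "0 < d1" "\<forall>(P :: 'a measure) T (Q :: real measure) U. laplace_close k1 d1 P T Q U \<longrightarrow>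
      \<bar>(\<integral>w. ramp (exp (- q)) (exp (- x)) (exp (- T w)) \<partial>P)
        - (\<integral>w. ramp (exp (- q)) (exp (- x)) (exp (- U w)) \<partial>Q)\<bar> \<le> e / 2"
    using laplace_controls_expectation[OF continuous_on_ramp e2, of "exp (- q)" "exp (- x)"] by blast
  obtain k2 d2 where kd2: "0 < d2" "\<forall>(P :: 'a measure) T (Q :: real measure) U. laplace_close k2 d2 P T Q U \<longrightarrow>
      \<bar>(\<integral>w. ramp (exp (- y)) (exp (- q)) (exp (- T w)) \<partial>P)
        - (\<integral>w. ramp (exp (- y)) (exp (- q)) (exp (- U w)) \<partial>Q)\<bar> \<le> e / 2"
    using laplace_controls_expectation[OF continuous_on_ramp e2, of "exp (- y)" "exp (- q)"] by blast
  have absm: "(\<lambda>x::real. \<bar>x\<bar>) \<in> borel_measurable N" by simp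
  have cdfN: "prob {w \<in> space N. \<bar>w\<bar> \<le> z} = cdf N z" for z
    unfolding cdf_def using pos by (intro finite_measure_eq_AE) (auto elim!: AE_mp)
  show ?thesis
  proof (intro exI[of _ "max k1 k2"] exI[of _ "min d1 d2"] conjI allI impI)
    show "0 < min d1 d2" using kd1 kd2 by simp
    fix P :: "'a measure" and T assume lc: "laplace_close (max k1 k2) (min d1 d2) P T N abs"
    then have P: "prob_space P" "T \<in> borel_measurable P" by (simp_all add: laplace_close_def)
    interpret P: prob_space P by (rule P)
    have lc': "laplace_close k1 d1 P T N abs" "laplace_close k2 d2 P T N abs"
      using lc by (auto simp: laplace_close_def)
    note kd1(2)[rule_format, OF lc'(1)] kd2(2)[rule_format, OF lc'(2)]
    moreover note P.ramp_sandwich(2)[OF P(2) xy(1)] P.ramp_sandwich(1)[OF P(2) xy(2)]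
      ramp_sandwich(1)[OF absm xy(1)] ramp_sandwich(2)[OF absm xy(2)]
    ultimately show "\<bar>measure P {w \<in> space P. T w \<le> q} - cdf N q\<bar> < e"
      unfolding cdfN using xy(3,4) by linarith
  qed
qed

text \<open>The bound of \<open>lyapunov_char_bound\<close> for n summands u \<bullet> \<xi>_i with
  norm u \<le> \<tau> / sqrt (c n), once the moments of order p and 2 are replaced by the bounds of
  \<open>inner_moments\<close>.\<close>

definition clt_error :: "real \<Rightarrow> real \<Rightarrow> real \<Rightarrow> nat \<Rightarrow> real \<Rightarrow> real" where
  "clt_error p c K n \<tau> =
     real n * ((\<tau> / sqrt (c * real n)) powr p * K + ((\<tau> / sqrt (c * real n))\<^sup>2 * (1 + K))\<^sup>2 / 8)"

lemma clt_error_tendsto_0: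
  assumes p: "2 < p" and c: "0 < c" and \<tau>: "0 \<le> \<tau>"
  shows "(\<lambda>n. clt_error p c K n \<tau>) \<longlonglongrightarrow> 0"
proof -
  \<comment> \<open>The first term has order n powr (1 - p / 2), the second order 1 / n; p > 2 makes
    the first one vanish.\<close>
  have eq: "clt_error p c K n \<tau> = (\<tau> / sqrt c) powr p * K * real n powr (1 - p / 2)
      + ((\<tau> / sqrt c)\<^sup>2 * (1 + K))\<^sup>2 / 8 * (1 / real n)" if "1 \<le> n" for n
  proof -
    have n: "0 < real n" using that by simp
    have "sqrt (real n) powr p = real n powr (p / 2)"
      using n by (simp add: powr_half_sqrt[symmetric] powr_powr)
    then have 1: "(\<tau> / sqrt (c * real n)) powr p = (\<tau> / sqrt c) powr p / real n powr (p / 2)"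
      using c \<tau> n by (simp add: real_sqrt_mult powr_divide powr_mult)
    have 2: "(\<tau> / sqrt (c * real n))\<^sup>2 = (\<tau> / sqrt c)\<^sup>2 / real n"
      using c n by (simp add: real_sqrt_mult power_divide power_mult_distrib)
    have 3: "real n powr (1 - p / 2) = real n / real n powr (p / 2)"
      using n by (simp add: powr_diff)
    have "m * (X / Q * K + (Z / m * (1 + K))\<^sup>2 / 8) = X * K * (m / Q) + (Z * (1 + K))\<^sup>2 / 8 * (1 / m)"
      if "0 < m" "0 < Q" for m Q X Z :: real
      using that by (simp add: field_simps power2_eq_square)
    then show ?thesis unfolding clt_error_def 1 2 3 using n by simp
  qed
  have "(\<lambda>n. real n powr (1 - p / 2)) \<longlonglongrightarrow> 0"
    using p by (intro tendsto_neg_powr filterlim_real_sequentially) auto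
  then have "(\<lambda>n. (\<tau> / sqrt c) powr p * K * real n powr (1 - p / 2)
      + ((\<tau> / sqrt c)\<^sup>2 * (1 + K))\<^sup>2 / 8 * (1 / real n)) \<longlonglongrightarrow>
     (\<tau> / sqrt c) powr p * K * 0 + ((\<tau> / sqrt c)\<^sup>2 * (1 + K))\<^sup>2 / 8 * 0"
    by (intro tendsto_intros lim_1_over_n)
  then have lim: "(\<lambda>n. (\<tau> / sqrt c) powr p * K * real n powr (1 - p / 2)
      + ((\<tau> / sqrt c)\<^sup>2 * (1 + K))\<^sup>2 / 8 * (1 / real n)) \<longlonglongrightarrow> 0" by simp
  show ?thesis
    by (rule Lim_transform_eventually[OF lim]) (auto simp: eq intro!: eventually_sequentiallyI[of 1])
qed

lemma (in prob_space) inner_moments: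
  fixes X :: "'a \<Rightarrow> real ^ 'd"
  assumes [measurable]: "X \<in> borel_measurable M" and p: "2 \<le> p"
    and int: "integrable M (\<lambda>w. norm (X w) powr p)" and K: "expectation (\<lambda>w. norm (X w) powr p) \<le> K"
    and u: "norm u \<le> a"
  shows "integrable M (\<lambda>w. \<bar>u \<bullet> X w\<bar> powr p)"
    "expectation (\<lambda>w. \<bar>u \<bullet> X w\<bar> powr p) \<le> a powr p * K"
    "expectation (\<lambda>w. (u \<bullet> X w)\<^sup>2) \<le> a\<^sup>2 * (1 + K)"
proof -
  have a: "0 \<le> a" using u norm_ge_zero order_trans by blast
  have ux: "\<bar>u \<bullet> x\<bar> \<le> a * norm x" for x
    using Cauchy_Schwarz_ineq2[of u x] mult_right_mono[OF u, of "norm x"] by simp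
  have b: "\<bar>u \<bullet> x\<bar> powr p \<le> a powr p * norm x powr p" for x
    using powr_mono2[OF _ _ ux, of p x] p a by (simp add: powr_mult)
  show int1: "integrable M (\<lambda>w. \<bar>u \<bullet> X w\<bar> powr p)"
    by (rule Bochner_Integration.integrable_bound[where f="\<lambda>w. a powr p * norm (X w) powr p"])
      (use int b in auto)
  have "expectation (\<lambda>w. \<bar>u \<bullet> X w\<bar> powr p) \<le> expectation (\<lambda>w. a powr p * norm (X w) powr p)"
    using int int1 b by (intro integral_mono) auto
  also have "\<dots> \<le> a powr p * K" using K by (simp add: mult_left_mono)
  finally show "expectation (\<lambda>w. \<bar>u \<bullet> X w\<bar> powr p) \<le> a powr p * K" .
  have sq: "(u \<bullet> x)\<^sup>2 \<le> a\<^sup>2 * (1 + norm x powr p)" for x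
  proof -
    have "(u \<bullet> x)\<^sup>2 \<le> a\<^sup>2 * (norm x)\<^sup>2"
      using power_mono[OF ux, of x 2] by (simp add: power_mult_distrib)
    also have "\<dots> \<le> a\<^sup>2 * (1 + norm x powr p)"
      using square_le_one_plus_powr[OF p, of "norm x"] by (intro mult_left_mono) auto
    finally show ?thesis .
  qed
  have "expectation (\<lambda>w. (u \<bullet> X w)\<^sup>2) \<le> expectation (\<lambda>w. a\<^sup>2 * (1 + norm (X w) powr p))"
    using int sq integrable_powr_imp_square(1)[OF _ p int1] by (intro integral_mono) auto
  also have "\<dots> = a\<^sup>2 * (1 + expectation (\<lambda>w. norm (X w) powr p))"
    using int by (simp add: prob_space)
  also have "\<dots> \<le> a\<^sup>2 * (1 + K)" using K by (intro mult_left_mono) auto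
  finally show "expectation (\<lambda>w. (u \<bullet> X w)\<^sup>2) \<le> a\<^sup>2 * (1 + K)" .
qed

text \<open>\<open>A\<close> is the covariance matrix of the sum of the independent centred \<xi>_i,
  specified by its quadratic form and symmetry. The last clause says that its eigenvalues grow at
  least like c n. Together with the moment bound \<open>K\<close> this is all the quantitative
  information that a uniform Lyapunov theorem needs.\<close>

definition standardizable_sum ::
  "real \<Rightarrow> real \<Rightarrow> real \<Rightarrow> nat \<Rightarrow> 'w measure \<Rightarrow> (nat \<Rightarrow> 'w \<Rightarrow> real ^ 'd) \<Rightarrow> real ^ 'd ^ 'd \<Rightarrow> bool" where
  "standardizable_sum p c K n P \<xi> A \<longleftrightarrow>
     prob_space P \<and> prob_space.indep_vars P (\<lambda>_. borel) \<xi> {1..n} \<and>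
     (\<forall>i\<in>{1..n}. integrable P (\<lambda>w. norm (\<xi> i w) powr p) \<and> (\<integral>w. norm (\<xi> i w) powr p \<partial>P) \<le> K \<and>
        (\<forall>u. (\<integral>w. u \<bullet> \<xi> i w \<partial>P) = 0)) \<and>
     (\<forall>u. u \<bullet> (A *v u) = (\<Sum>i=1..n. \<integral>w. (u \<bullet> \<xi> i w)\<^sup>2 \<partial>P)) \<and>
     (\<forall>x y. x \<bullet> (A *v y) = y \<bullet> (A *v x)) \<and>
     (\<forall>u. c * real n * (norm u)\<^sup>2 \<le> u \<bullet> (A *v u))"

lemma standardizable_sum_mono:
  "standardizable_sum p c K n P \<xi> A \<Longrightarrow> K \<le> K' \<Longrightarrow> standardizable_sum p c K' n P \<xi> A"
  unfolding standardizable_sum_def by (meson order_trans)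

text \<open>In an A-orthonormal basis \<open>b\<close> the coordinates Z_j = b_j \<bullet> (sum of
  \<xi>_i) are uncorrelated with variance 1, and the quadratic statistic is the sum of their
  squares. Coercivity gives norm (b_j) \<le> 1 / sqrt (c n), the only place where the size of
  \<open>A\<close> enters. The vector \<open>x w\<close> stands for the inverse of \<open>A\<close>
  applied to the sum.\<close>

lemma uniform_laplace_bound:
  fixes \<xi> :: "nat \<Rightarrow> 'w \<Rightarrow> real ^ 'd" and A :: "real ^ 'd ^ 'd"
  assumes st: "standardizable_sum p c K n P \<xi> A" and p: "2 < p" "p \<le> 3" and c: "0 < c" and n: "1 \<le> n"
    and x: "\<And>w. A *v x w = (\<Sum>i=1..n. \<xi> i w)"
  shows "(\<lambda>w. (\<Sum>i=1..n. \<xi> i w) \<bullet> x w) \<in> borel_measurable P" "0 \<le> (\<Sum>i=1..n. \<xi> i w) \<bullet> x w"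
    "\<bar>(\<integral>w. exp (- (real m * ((\<Sum>i=1..n. \<xi> i w) \<bullet> x w))) \<partial>P)
      - (\<integral>x. exp (- (real m * x)) \<partial>chi_square CARD('d))\<bar>
     \<le> (\<integral>G. min 2 (clt_error p c K n (\<Sum>j\<in>UNIV. \<bar>sqrt (2 * real m) * G j\<bar>))
          \<partial>(\<Pi>\<^sub>M i\<in>(UNIV :: 'd set). std_normal_distribution))"
proof -
  interpret prob_space P using st by (simp add: standardizable_sum_def)
  have ind: "indep_vars (\<lambda>_. borel) \<xi> {1..n}" using st by (simp add: standardizable_sum_def)
  have \<xi>m[measurable]: "\<xi> i \<in> borel_measurable P" if "i \<in> {1..n}" for i
    using ind that by (auto simp: indep_vars_def)
  have mom: "integrable P (\<lambda>w. norm (\<xi> i w) powr p)" "(\<integral>w. norm (\<xi> i w) powr p \<partial>P) \<le> K"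
    "(\<integral>w. u \<bullet> \<xi> i w \<partial>P) = 0" if "i \<in> {1..n}" for i u
    using st that by (auto simp: standardizable_sum_def)
  have A: "u \<bullet> (A *v u) = (\<Sum>i=1..n. \<integral>w. (u \<bullet> \<xi> i w)\<^sup>2 \<partial>P)" and sym: "u \<bullet> (A *v v) = v \<bullet> (A *v u)"
    and low: "c * real n * (norm u)\<^sup>2 \<le> u \<bullet> (A *v u)" for u v
    using st by (auto simp: standardizable_sum_def)
  have cn: "0 < c * real n" using c n by simp
  have pd: "pos_definite A"
    unfolding pos_definite_def
  proof (intro allI impI)
    fix u :: "real ^ 'd" assume "u \<noteq> 0"
    then have "0 < c * real n * (norm u)\<^sup>2" using cn by simp
    then show "0 < u \<bullet> (A *v u)" using low[of u] by linarith
  qed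
  obtain b :: "'d \<Rightarrow> real ^ 'd" where b: "b i \<bullet> (A *v b j) = (if i = j then 1 else 0)" for i j
    using pos_definite_orthonormal_basis[OF pd sym] by metis
  define Z where "Z j w = b j \<bullet> (\<Sum>i=1..n. \<xi> i w)" for j w
  have Zm[measurable]: "Z j \<in> borel_measurable P" for j unfolding Z_def by measurable
  have T: "(\<Sum>i=1..n. \<xi> i w) \<bullet> x w = (\<Sum>j\<in>UNIV. (Z j w)\<^sup>2)" for w
    unfolding Z_def by (rule pos_definite_basis_quadratic(1)[OF b x])
  show "(\<lambda>w. (\<Sum>i=1..n. \<xi> i w) \<bullet> x w) \<in> borel_measurable P" unfolding T by measurable
  show "0 \<le> (\<Sum>i=1..n. \<xi> i w) \<bullet> x w" unfolding T by (simp add: sum_nonneg)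
  have nb: "norm (b j) \<le> 1 / sqrt (c * real n)" for j
  proof -
    have "c * real n * (norm (b j))\<^sup>2 \<le> 1" using low[of "b j"] b[of j j] by simp
    then have "(norm (b j))\<^sup>2 \<le> 1 / (c * real n)" using cn by (simp add: field_simps)
    then show ?thesis using real_sqrt_le_mono by (fastforce simp: real_sqrt_divide)
  qed
  let ?N = "\<Pi>\<^sub>M i\<in>(UNIV :: 'd set). std_normal_distribution"
  have Gm[measurable]: "(\<lambda>G. G j) \<in> borel_measurable ?N" for j :: 'd
    using measurable_component_singleton[of j UNIV "\<lambda>_. std_normal_distribution"] by simp
  have bd: "cmod ((CLINT w|P. iexp (\<Sum>j\<in>UNIV. sqrt (2 * real m) * G j * Z j w))
      - exp (- (real m * (\<Sum>j\<in>UNIV. (G j)\<^sup>2))))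
      \<le> clt_error p c K n (\<Sum>j\<in>UNIV. \<bar>sqrt (2 * real m) * G j\<bar>)" for G :: "'d \<Rightarrow> real"
  proof -
    define t where "t j = sqrt (2 * real m) * G j" for j
    define u where "u = (\<Sum>j\<in>UNIV. t j *\<^sub>R b j)"
    define \<tau> where "\<tau> = (\<Sum>j\<in>UNIV. \<bar>t j\<bar>)"
    have "norm u \<le> (\<Sum>j\<in>UNIV. \<bar>t j\<bar> * (1 / sqrt (c * real n)))"
      unfolding u_def
      by (intro order_trans[OF norm_sum] sum_mono, unfold norm_scaleR) (intro mult_left_mono nb abs_ge_zero)
    then have un: "norm u \<le> \<tau> / sqrt (c * real n)" by (simp add: \<tau>_def sum_divide_distrib)
    have e1: "(\<Sum>j\<in>UNIV. t j * Z j w) = (\<Sum>i=1..n. u \<bullet> \<xi> i w)" for w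
    proof -
      have "(\<Sum>j\<in>UNIV. t j * Z j w) = u \<bullet> (\<Sum>i=1..n. \<xi> i w)"
        by (simp only: Z_def u_def inner_sum_left inner_scaleR_left)
      then show ?thesis by (simp only: inner_sum_right)
    qed
    have e2: "(\<Sum>i=1..n. \<integral>w. (u \<bullet> \<xi> i w)\<^sup>2 \<partial>P) = 2 * (real m * (\<Sum>j\<in>UNIV. (G j)\<^sup>2))"
      unfolding A[symmetric] u_def pos_definite_basis_quadratic(2)[OF b refl]
      by (simp add: t_def power_mult_distrib sum_distrib_left mult_ac)
    note im = inner_moments[OF \<xi>m _ mom(1,2) un]
    have "cmod ((CLINT w|P. iexp (\<Sum>i\<in>{1..n}. u \<bullet> \<xi> i w))
        - exp (- (\<Sum>i\<in>{1..n}. expectation (\<lambda>w. (u \<bullet> \<xi> i w)\<^sup>2)) / 2))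
      \<le> (\<Sum>i\<in>{1..n}. expectation (\<lambda>w. \<bar>u \<bullet> \<xi> i w\<bar> powr p) + (expectation (\<lambda>w. (u \<bullet> \<xi> i w)\<^sup>2))\<^sup>2 / 8)"
    proof (rule lyapunov_char_bound)
      show "indep_vars (\<lambda>_. borel) (\<lambda>i w. u \<bullet> \<xi> i w) {1..n}"
        by (rule indep_vars_compose2[OF ind]) measurable
    qed (use im(1) mom(3) p in auto)
    also have "\<dots> \<le> (\<Sum>i\<in>{1..n}. (\<tau> / sqrt (c * real n)) powr p * K + ((\<tau> / sqrt (c * real n))\<^sup>2 * (1 + K))\<^sup>2 / 8)"
    proof (intro sum_mono add_mono divide_right_mono power_mono)
      fix i assume i: "i \<in> {1..n}"
      show "expectation (\<lambda>w. \<bar>u \<bullet> \<xi> i w\<bar> powr p) \<le> (\<tau> / sqrt (c * real n)) powr p * K"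
        using im(2)[OF i _ i i] p by simp
      show "expectation (\<lambda>w. (u \<bullet> \<xi> i w)\<^sup>2) \<le> (\<tau> / sqrt (c * real n))\<^sup>2 * (1 + K)"
        using im(3)[OF i _ i i] p by simp
    qed auto
    also have "\<dots> = clt_error p c K n \<tau>" by (simp add: clt_error_def)
    finally have *: "cmod ((CLINT w|P. iexp (\<Sum>j\<in>UNIV. t j * Z j w))
        - exp (- (2 * (real m * (\<Sum>j\<in>UNIV. (G j)\<^sup>2))) / 2)) \<le> clt_error p c K n \<tau>"
      unfolding e1 e2 .
    have "- (2 * (real m * S)) / 2 = - (real m * S)" for S by simp
    with * show ?thesis by (simp only: \<tau>_def t_def)
  qed
  have "(\<lambda>G. clt_error p c K n (\<Sum>j\<in>UNIV. \<bar>sqrt (2 * real m) * G j\<bar>)) \<in> borel_measurable ?N"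
    unfolding clt_error_def by measurable
  from laplace_norm_square_bound[OF finite Zm _ this bd]
  show "\<bar>(\<integral>w. exp (- (real m * ((\<Sum>i=1..n. \<xi> i w) \<bullet> x w))) \<partial>P)
      - (\<integral>x. exp (- (real m * x)) \<partial>chi_square CARD('d))\<bar>
     \<le> (\<integral>G. min 2 (clt_error p c K n (\<Sum>j\<in>UNIV. \<bar>sqrt (2 * real m) * G j\<bar>)) \<partial>?N)"
    unfolding T chi_square_properties(6)[OF zero_less_card_finite] laplace_std_normal_prod[OF finite] by simp
qed

text \<open>\<open>n0\<close> is fixed before the measure, the summands and the matrix are chosen.
  For each m the averaged error tends to 0 by dominated convergence under the Gaussian law, and only
  finitely many m are relevant at accuracy \<open>e\<close>.\<close>

lemma uniform_clt:
  fixes p c K e \<alpha> :: real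
  assumes p: "2 < p" "p \<le> 3" and c: "0 < c" and e: "0 < e" and \<alpha>: "0 < \<alpha>" "\<alpha> < 1"
  shows "\<exists>n0. \<forall>n P (\<xi> :: nat \<Rightarrow> 'w \<Rightarrow> real ^ 'd) A x. n0 \<le> n \<longrightarrow> standardizable_sum p c K n P \<xi> A \<longrightarrow>
     (\<forall>w. A *v x w = (\<Sum>i=1..n. \<xi> i w)) \<longrightarrow>
     \<bar>measure P {w \<in> space P. (\<Sum>i=1..n. \<xi> i w) \<bullet> x w \<le> quantile (chi_square CARD('d)) (1 - \<alpha>)} - (1 - \<alpha>)\<bar> < e"
proof -
  let ?N = "\<Pi>\<^sub>M i\<in>(UNIV :: 'd set). std_normal_distribution"
  interpret N: prob_space ?N by (rule prob_space_std_normal_prod)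
  have Gm[measurable]: "(\<lambda>G. G j) \<in> borel_measurable ?N" for j :: 'd
    using measurable_component_singleton[of j UNIV "\<lambda>_. std_normal_distribution"] by simp
  note cs = chi_square_properties[OF zero_less_card_finite[where 'a='d]]
  note rd = real_distribution_chi_square[OF zero_less_card_finite[where 'a='d]]
  \<comment> \<open>The sign of \<open>K\<close> is arbitrary; with \<open>K'\<close> the error is
    nonnegative, as the dominating constant 2 requires.\<close>
  define K' where "K' = max K 0"
  define r where "r m n = (\<integral>G. min 2 (clt_error p c K' n (\<Sum>j\<in>UNIV. \<bar>sqrt (2 * real m) * G j\<bar>)) \<partial>?N)" for m n
  have ce0: "0 \<le> clt_error p c K' n \<tau>" for n \<tau>
    by (auto simp: clt_error_def K'_def)
  have r: "r m \<longlonglongrightarrow> 0" for m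
  proof -
    have "(\<lambda>n. \<integral>G. min 2 (clt_error p c K' n (\<Sum>j\<in>UNIV. \<bar>sqrt (2 * real m) * G j\<bar>)) \<partial>?N) \<longlonglongrightarrow> (\<integral>G. 0 \<partial>?N)"
    proof (rule integral_dominated_convergence[where w="\<lambda>_. 2"])
      show "(\<lambda>G. min 2 (clt_error p c K' n (\<Sum>j\<in>UNIV. \<bar>sqrt (2 * real m) * G j\<bar>))) \<in> borel_measurable ?N" for n
        unfolding clt_error_def by measurable
      show "AE G in ?N. (\<lambda>n. min 2 (clt_error p c K' n (\<Sum>j\<in>UNIV. \<bar>sqrt (2 * real m) * G j\<bar>))) \<longlonglongrightarrow> 0"
      proof (rule AE_I2)
        fix G :: "'d \<Rightarrow> real"
        have "(\<lambda>n. min 2 (clt_error p c K' n (\<Sum>j\<in>UNIV. \<bar>sqrt (2 * real m) * G j\<bar>))) \<longlonglongrightarrow> min 2 0"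
          by (intro tendsto_min tendsto_const clt_error_tendsto_0 p c sum_nonneg) auto
        then show "(\<lambda>n. min 2 (clt_error p c K' n (\<Sum>j\<in>UNIV. \<bar>sqrt (2 * real m) * G j\<bar>))) \<longlonglongrightarrow> 0" by simp
      qed
    qed (use ce0 in auto)
    then show ?thesis by (simp add: r_def[abs_def])
  qed
  obtain k d where kd: "0 < d" "\<forall>(P :: 'w measure) T. laplace_close k d P T (chi_square CARD('d)) abs \<longrightarrow>
      \<bar>measure P {w :: 'w \<in> space P. T w \<le> quantile (chi_square CARD('d)) (1 - \<alpha>)}
        - cdf (chi_square CARD('d)) (quantile (chi_square CARD('d)) (1 - \<alpha>))\<bar> < e"
    using laplace_controls_cdf[OF rd cs(5,4) e] by blast
  have lap: "(\<integral>x. exp (- (real m * \<bar>x\<bar>)) \<partial>chi_square CARD('d)) = (\<integral>x. exp (- (real m * x)) \<partial>chi_square CARD('d))" for m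
    proof (rule integral_cong_AE)
    show "AE x in chi_square CARD('d). exp (- (real m * \<bar>x\<bar>)) = exp (- (real m * x))"
      using cs(4) by eventually_elim simp
  qed (simp_all add: measurable_cong_sets[OF cs(2) refl])
  have q: "cdf (chi_square CARD('d)) (quantile (chi_square CARD('d)) (1 - \<alpha>)) = 1 - \<alpha>"
    by (rule cdf_quantile[OF rd cs(5)]) (use \<alpha> in auto)
  have "\<forall>\<^sub>F n in sequentially. \<forall>m\<in>{..k}. r m n < d"
    using order_tendstoD(2)[OF r kd(1)] by (intro eventually_ball_finite) auto
  then obtain n1 where n1: "\<And>n m. n1 \<le> n \<Longrightarrow> m \<le> k \<Longrightarrow> r m n < d"
    unfolding eventually_sequentially by (meson atMost_iff)
  show ?thesis
  proof (intro exI[of _ "max n1 1"] allI impI)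
    fix n and P :: "'w measure" and \<xi> :: "nat \<Rightarrow> 'w \<Rightarrow> real ^ 'd" and A x
    assume n: "max n1 1 \<le> n" and st: "standardizable_sum p c K n P \<xi> A"
      and x0: "\<forall>w. A *v x w = (\<Sum>i=1..n. \<xi> i w)"
    note x = x0[rule_format]
    have st': "standardizable_sum p c K' n P \<xi> A"
      using standardizable_sum_mono[OF st] by (simp add: K'_def)
    have n': "1 \<le> n" using n by simp
    note ub = uniform_laplace_bound[OF st' p c n' x]
    have "\<bar>measure P {w \<in> space P. (\<Sum>i=1..n. \<xi> i w) \<bullet> x w \<le> quantile (chi_square CARD('d)) (1 - \<alpha>)}
        - cdf (chi_square CARD('d)) (quantile (chi_square CARD('d)) (1 - \<alpha>))\<bar> < e"
    proof (intro kd(2)[rule_format])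
      have "r m n < d" if "m \<le> k" for m using n n1 that by simp
      then have "\<bar>(\<integral>w. exp (- (real m * ((\<Sum>i=1..n. \<xi> i w) \<bullet> x w))) \<partial>P)
          - (\<integral>x. exp (- (real m * \<bar>x\<bar>)) \<partial>chi_square CARD('d))\<bar> \<le> d" if "m \<le> k" for m
        using ub(3)[of m] that unfolding lap by (force simp: r_def)
      then show "laplace_close k d P (\<lambda>w. (\<Sum>i=1..n. \<xi> i w) \<bullet> x w) (chi_square CARD('d)) abs"
        using ub(1,2) st cs(1) unfolding laplace_close_def
        by (simp add: standardizable_sum_def measurable_cong_sets[OF cs(2) refl])
    qed
    then show "\<bar>measure P {w \<in> space P. (\<Sum>i=1..n. \<xi> i w) \<bullet> x w \<le> quantile (chi_square CARD('d)) (1 - \<alpha>)} - (1 - \<alpha>)\<bar> < e"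
      unfolding q .
  qed
qed

section \<open>Averaged Taylor remainders\<close>

text \<open>For $m \ge 1$ this is the weight $m (1 - t)^{m - 1}\,dt$ on $[0,1]$ of the integral remainder in
  Taylor's formula of order $m$.\<close>

definition remainder_measure :: "nat \<Rightarrow> real measure" where
  "remainder_measure m =
     (if m = 0 then return borel 1
      else density lborel (\<lambda>t. ennreal (real m * (1 - t) ^ (m - 1) * indicator {0..1} t)))"

text \<open>Extends functions on [0,1] to the whole line by constants, so that they are continuous,
  bounded and Borel measurable there, while \<open>remainder_measure\<close> is concentrated on
  [0,1].\<close>

definition clamp01 :: "real \<Rightarrow> real" where
  "clamp01 t = max 0 (min 1 t)"

lemma clamp01_simps [simp]: "0 \<le> clamp01 t" "clamp01 t \<le> 1" "0 \<le> t \<Longrightarrow> t \<le> 1 \<Longrightarrow> clamp01 t = t"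
  by (auto simp: clamp01_def)

lemma continuous_on_clamp01 [continuous_intros]:
  "continuous_on S f \<Longrightarrow> continuous_on S (\<lambda>x. clamp01 (f x))"
  unfolding clamp01_def by (intro continuous_intros)

lemma sets_remainder_measure [simp, measurable_cong]: "sets (remainder_measure m) = sets borel"
  by (simp add: remainder_measure_def)

text \<open>The integral remainder written as a mean value with respect to a probability measure.
  For m = 0 the point mass at 1 turns the formula into an identity without Taylor terms, so
  coordinates with k_j = 1 need no separate treatment.\<close>

lemma taylor_remainder:
  fixes \<phi> :: "nat \<Rightarrow> real \<Rightarrow> real"
  assumes der: "\<And>l t. l < m \<Longrightarrow> 0 \<le> t \<Longrightarrow> t \<le> 1 \<Longrightarrow>
      (\<phi> l has_real_derivative \<phi> (Suc l) t) (at t within {0..1})"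
    and cont: "continuous_on {0..1} (\<phi> m)"
  shows "\<phi> 0 1 = (\<Sum>l<m. \<phi> l 0 / fact l) + (\<integral>t. \<phi> m (clamp01 t) \<partial>remainder_measure m) / fact m"
proof (cases m)
  case 0
  have "(\<lambda>t. \<phi> m (clamp01 t)) \<in> borel_measurable borel"
    by (intro borel_measurable_continuous_onI continuous_on_compose2[OF cont] continuous_intros) auto
  with 0 show ?thesis by (simp add: remainder_measure_def integral_return)
next
  case (Suc n)
  \<comment> \<open>The Taylor polynomial with moving base point t, evaluated at 1. Its derivative
    telescopes to the top order term.\<close>
  define F where "F t = (\<Sum>l<m. (1 - t) ^ l / fact l * \<phi> l t)" for t
  define w where "w t = real m * (1 - t) ^ n" for t :: real
  have F': "(F has_real_derivative (1 - t) ^ n / fact n * \<phi> m t) (at t within {0..1})"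
    if t: "0 \<le> t" "t \<le> 1" for t
  proof -
    define g where "g k = (if k = 0 then 0 else (1 - t) ^ (k - 1) / fact (k - 1) * \<phi> k t)" for k
    have "((\<lambda>t. (1 - t) ^ l / fact l * \<phi> l t) has_real_derivative g (Suc l) - g l) (at t within {0..1})"
      if l: "l < m" for l
    proof (cases l)
      case 0
      then show ?thesis using der[OF l t] by (simp add: g_def)
    next
      case (Suc j)
      have "((\<lambda>t. (1 - t) ^ l) has_real_derivative real l * (1 - t) ^ j * (-1)) (at t within {0..1})"
      proof -
        have "((\<lambda>t. 1 - t) has_real_derivative -1) (at t within {0..1})"
          by (auto intro!: derivative_eq_intros)
        from DERIV_power[OF this, of l] show ?thesis using Suc by simp
      qed
      from DERIV_mult[OF DERIV_cdivide[OF this, of "fact l"] der[OF l t]]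
      show ?thesis using Suc by (simp add: g_def field_simps del: of_nat_Suc)
    qed
    then have "(F has_real_derivative (\<Sum>l<m. g (Suc l) - g l)) (at t within {0..1})"
      unfolding F_def by (intro DERIV_sum) auto
    also have "(\<Sum>l<m. g (Suc l) - g l) = g m"
      using sum_lessThan_telescope[of g m] by (simp add: g_def)
    also have "g m = (1 - t) ^ n / fact n * \<phi> m t" by (simp add: g_def Suc)
    finally show ?thesis .
  qed
  have "(\<integral>t. indicator {0..1} t *\<^sub>R ((1 - t) ^ n / fact n * \<phi> m t) \<partial>lborel) = F 1 - F 0"
  proof (rule integral_FTC_Icc)
    show "(F has_vector_derivative (1 - t) ^ n / fact n * \<phi> m t) (at t within {0..1})"
      if "0 \<le> t" "t \<le> 1" for t
      using F'[OF that] by (simp add: has_real_derivative_iff_has_vector_derivative)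
    show "continuous_on {0..1} (\<lambda>t. (1 - t) ^ n / fact n * \<phi> m t)"
      using cont by (intro continuous_intros) auto
  qed simp
  moreover have "(\<integral>t. \<phi> m (clamp01 t) \<partial>remainder_measure m)
      = (\<integral>t. (w t * indicator {0..1} t) *\<^sub>R \<phi> m (clamp01 t) \<partial>lborel)"
  proof -
    have "remainder_measure m = density lborel (\<lambda>t. ennreal (w t * indicator {0..1} t))"
      by (simp add: remainder_measure_def w_def Suc del: of_nat_Suc)
    moreover have "(\<lambda>t. \<phi> m (clamp01 t)) \<in> borel_measurable borel"
      by (intro borel_measurable_continuous_onI continuous_on_compose2[OF cont] continuous_intros) auto
    moreover have "AE t in lborel. 0 \<le> w t * indicator {0..1} t" "(\<lambda>t. w t * indicator {0..1} t) \<in> borel_measurable lborel"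
      by (auto simp: w_def indicator_def)
    ultimately show ?thesis by (subst \<open>remainder_measure m = _\<close>, subst integral_density) auto
  qed
  moreover have "\<dots> = (\<integral>t. fact m * (indicator {0..1} t *\<^sub>R ((1 - t) ^ n / fact n * \<phi> m t)) \<partial>lborel)"
    by (intro Bochner_Integration.integral_cong) (auto simp: w_def Suc indicator_def)
  moreover have "F 1 = \<phi> 0 1"
    unfolding F_def Suc by (subst sum.lessThan_Suc_shift) simp
  moreover have "F 0 = (\<Sum>l<m. \<phi> l 0 / fact l)" by (simp add: F_def)
  ultimately show ?thesis by simp
qed

lemma prob_space_remainder_measure: "prob_space (remainder_measure m)"
proof (cases "m = 0")
  case True
  then show ?thesis by (simp add: remainder_measure_def prob_space_return)
next
  case False
  have "(\<integral>\<^sup>+t. ennreal (real m * (1 - t) ^ (m - 1)) * indicator {0..1} t \<partial>lborel)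
      = ennreal (- ((1 - 1) ^ m) - (- ((1 - 0) ^ m)))"
    using False
    by (intro nn_integral_FTC_Icc) (auto intro!: derivative_eq_intros simp: has_real_derivative_iff_has_vector_derivative[symmetric] zero_power)
  also have "\<dots> = 1" using False by (simp add: zero_power)
  finally show ?thesis using False
    by (intro prob_spaceI) (simp add: remainder_measure_def emeasure_density indicator_mult_ennreal
        mult.commute[of "indicator _ _"] flip: ennreal_indicator ennreal_mult'')
qed

text \<open>Jensen's inequality is applied to |X| + 1, which takes values in the open half line on
  which the power is convex. The shift accounts for the factor 2 powr p and for the summand
  1.\<close>

lemma (in prob_space) jensen_powr_bound:
  fixes X :: "'a \<Rightarrow> real"
  assumes X: "integrable M X" and p: "1 \<le> p" and Xp: "integrable M (\<lambda>t. \<bar>X t\<bar> powr p)"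
  shows "\<bar>expectation X\<bar> powr p \<le> 2 powr p * (1 + expectation (\<lambda>t. \<bar>X t\<bar> powr p))"
proof -
  have b: "(\<bar>x\<bar> + 1) powr p \<le> 2 powr p * (1 + \<bar>x\<bar> powr p)" for x :: real
  proof -
    have "(\<bar>x\<bar> + 1) powr p \<le> (2 * max \<bar>x\<bar> 1) powr p" using p by (intro powr_mono2) auto
    also have "\<dots> = 2 powr p * (max \<bar>x\<bar> 1) powr p" by (simp add: powr_mult)
    also have "(max \<bar>x\<bar> 1) powr p \<le> 1 + \<bar>x\<bar> powr p" by (auto simp: max_def)
    finally show ?thesis by simp
  qed
  have [measurable]: "X \<in> borel_measurable M" using X by auto
  have i: "integrable M (\<lambda>t. (\<bar>X t\<bar> + 1) powr p)"
    by (rule Bochner_Integration.integrable_bound[where f="\<lambda>t. 2 powr p * (1 + \<bar>X t\<bar> powr p)"])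
      (use Xp b in \<open>auto simp: abs_of_nonneg\<close>)
  have "\<bar>expectation X\<bar> powr p \<le> (expectation (\<lambda>t. \<bar>X t\<bar> + 1)) powr p"
  proof (rule powr_mono2)
    show "\<bar>expectation X\<bar> \<le> expectation (\<lambda>t. \<bar>X t\<bar> + 1)"
    proof -
      have "expectation (\<lambda>t. \<bar>X t\<bar> + 1) = expectation (\<lambda>t. \<bar>X t\<bar>) + 1" using X by (simp add: prob_space)
      then show ?thesis using integral_abs_bound[of M X] by linarith
    qed
  qed (use p in auto)
  also have "\<dots> \<le> expectation (\<lambda>t. (\<bar>X t\<bar> + 1) powr p)"
    by (rule jensens_inequality[where I="{0<..}"]) (use X i p powr_convex in \<open>auto\<close>)
  also have "\<dots> \<le> expectation (\<lambda>t. 2 powr p * (1 + \<bar>X t\<bar> powr p))"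
    using i Xp b by (intro integral_mono) auto
  also have "\<dots> = 2 powr p * (1 + expectation (\<lambda>t. \<bar>X t\<bar> powr p))"
    using Xp by (simp add: prob_space)
  finally show ?thesis .
qed

text \<open>Jensen's inequality in t at fixed y, then Fubini: a moment bound uniform in t passes to
  the average over t. Boundedness in t at each y makes the inner integrals finite.\<close>

lemma average_moment_bound:
  fixes \<phi> :: "real \<Rightarrow> 'a \<Rightarrow> real"
  assumes "prob_space \<tau>" and st: "sets \<tau> = sets borel" and "prob_space P"
    and meas[measurable]: "(\<lambda>(t, y). \<phi> t y) \<in> borel_measurable (borel \<Otimes>\<^sub>M P)"
    and bdd: "\<And>y. y \<in> space P \<Longrightarrow> \<exists>B. \<forall>t. \<bar>\<phi> t y\<bar> \<le> B"
    and p: "1 \<le> p" and K: "0 \<le> K"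
    and mom: "\<And>t. (\<integral>\<^sup>+y. ennreal (\<bar>\<phi> t y\<bar> powr p) \<partial>P) \<le> ennreal K"
  shows "(\<integral>\<^sup>+y. ennreal (\<bar>\<integral>t. \<phi> t y \<partial>\<tau>\<bar> powr p) \<partial>P) \<le> ennreal (2 powr p * (1 + K))"
    and "(\<lambda>y. \<integral>t. \<phi> t y \<partial>\<tau>) \<in> borel_measurable P"
proof -
  interpret \<tau>: prob_space \<tau> by fact
  interpret P: prob_space P by fact
  interpret pair_sigma_finite \<tau> P by unfold_locales
  note st[measurable_cong]
  have [measurable]: "(\<lambda>(t, y). \<phi> t y) \<in> borel_measurable (\<tau> \<Otimes>\<^sub>M P)" by measurable
  have [measurable]: "(\<lambda>(y, t). \<phi> t y) \<in> borel_measurable (P \<Otimes>\<^sub>M \<tau>)" by measurable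
  show "(\<lambda>y. \<integral>t. \<phi> t y \<partial>\<tau>) \<in> borel_measurable P" by measurable
  have J: "ennreal (\<bar>\<integral>t. \<phi> t y \<partial>\<tau>\<bar> powr p) \<le> ennreal (2 powr p) * (1 + (\<integral>\<^sup>+t. ennreal (\<bar>\<phi> t y\<bar> powr p) \<partial>\<tau>))"
    if y: "y \<in> space P" for y
  proof -
    obtain B where B: "\<And>t. \<bar>\<phi> t y\<bar> \<le> B" using bdd[OF y] by blast
    have [measurable]: "(\<lambda>t. \<phi> t y) \<in> borel_measurable \<tau>" using y by measurable
    have i1: "integrable \<tau> (\<lambda>t. \<phi> t y)" using B by (intro \<tau>.integrable_const_bound[of _ B]) auto
    have i2: "integrable \<tau> (\<lambda>t. \<bar>\<phi> t y\<bar> powr p)"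
      using B p by (intro \<tau>.integrable_const_bound[of _ "B powr p"]) (auto intro!: powr_mono2)
    have "ennreal (\<bar>\<integral>t. \<phi> t y \<partial>\<tau>\<bar> powr p) \<le> ennreal (2 powr p * (1 + (\<integral>t. \<bar>\<phi> t y\<bar> powr p \<partial>\<tau>)))"
      by (intro ennreal_leI \<tau>.jensen_powr_bound i1 i2 p)
    also have "\<dots> = ennreal (2 powr p) * (1 + ennreal (\<integral>t. \<bar>\<phi> t y\<bar> powr p \<partial>\<tau>))"
      by (simp add: ennreal_mult ennreal_plus)
    also have "ennreal (\<integral>t. \<bar>\<phi> t y\<bar> powr p \<partial>\<tau>) = (\<integral>\<^sup>+t. ennreal (\<bar>\<phi> t y\<bar> powr p) \<partial>\<tau>)"
      using i2 by (intro nn_integral_eq_integral[symmetric]) auto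
    finally show ?thesis .
  qed
  have "(\<integral>\<^sup>+y. ennreal (\<bar>\<integral>t. \<phi> t y \<partial>\<tau>\<bar> powr p) \<partial>P)
      \<le> (\<integral>\<^sup>+y. ennreal (2 powr p) * (1 + (\<integral>\<^sup>+t. ennreal (\<bar>\<phi> t y\<bar> powr p) \<partial>\<tau>)) \<partial>P)"
    using J by (intro nn_integral_mono) auto
  also have "\<dots> = ennreal (2 powr p) * (1 + (\<integral>\<^sup>+y. \<integral>\<^sup>+t. ennreal (\<bar>\<phi> t y\<bar> powr p) \<partial>\<tau> \<partial>P))"
    by (simp add: nn_integral_cmult nn_integral_add P.emeasure_space_1)
  also have "(\<integral>\<^sup>+y. \<integral>\<^sup>+t. ennreal (\<bar>\<phi> t y\<bar> powr p) \<partial>\<tau> \<partial>P) = (\<integral>\<^sup>+t. \<integral>\<^sup>+y. ennreal (\<bar>\<phi> t y\<bar> powr p) \<partial>P \<partial>\<tau>)"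
    by (rule Fubini') measurable
  also have "\<dots> \<le> (\<integral>\<^sup>+t. ennreal K \<partial>\<tau>)" using mom by (intro nn_integral_mono) auto
  also have "\<dots> = ennreal K" by (simp add: \<tau>.emeasure_space_1)
  finally show "(\<integral>\<^sup>+y. ennreal (\<bar>\<integral>t. \<phi> t y \<partial>\<tau>\<bar> powr p) \<partial>P) \<le> ennreal (2 powr p * (1 + K))"
    using K by (simp add: ennreal_mult ennreal_plus add_left_mono mult_left_mono)
qed

section \<open>Calculus of iterated partial derivatives\<close>

lemma has_partial_shift:
  assumes "has_partial j g (\<theta> + t *\<^sub>R axis j 1)"
  shows "((\<lambda>s. g (\<theta> + s *\<^sub>R axis j 1)) has_real_derivative partial j g (\<theta> + t *\<^sub>R axis j 1)) (at t)"
proof -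
  have "((\<lambda>s. g ((\<theta> + t *\<^sub>R axis j 1) + s *\<^sub>R axis j 1)) has_real_derivative partial j g (\<theta> + t *\<^sub>R axis j 1)) (at 0)"
    using assms unfolding has_partial_def partial_def
    by (simp only: DERIV_deriv_iff_real_differentiable)
  then have "((\<lambda>s. (\<lambda>u. g (\<theta> + u *\<^sub>R axis j 1)) (s + t)) has_real_derivative partial j g (\<theta> + t *\<^sub>R axis j 1)) (at 0)"
    by (simp add: algebra_simps)
  then show ?thesis using DERIV_shift[of "\<lambda>u. g (\<theta> + u *\<^sub>R axis j 1)" _ 0 t] by simp
qed

lemma eventually_axis_shift:
  fixes U :: "(real ^ 'd) set"
  assumes "open U" "\<theta> \<in> U"
  shows "\<forall>\<^sub>F t in nhds 0. \<theta> + t *\<^sub>R axis j 1 \<in> U"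
proof -
  define f where "f t = \<theta> + t *\<^sub>R axis j 1" for t
  have "isCont f 0" unfolding f_def by (intro continuous_intros)
  then have "(f \<longlongrightarrow> f 0) (nhds 0)"
    by (simp add: isCont_def tendsto_at_iff_tendsto_nhds)
  then show ?thesis using assms by (auto simp: tendsto_def f_def)
qed

text \<open>Each differentiation requires the identity of the previous order along a whole axis
  segment around the point, hence the open set \<open>U\<close>. Differentiability is essential
  because \<open>deriv\<close> is not additive in general.\<close>

lemma partials_sum:
  assumes U: "open U" and I: "finite I"
    and hp: "\<And>i \<theta> js j. i \<in> I \<Longrightarrow> \<theta> \<in> U \<Longrightarrow> length js < k \<Longrightarrow> has_partial j (partials js (g i)) \<theta>"
  shows "\<theta> \<in> U \<Longrightarrow> length js \<le> k \<Longrightarrow> partials js (\<lambda>\<eta>. \<Sum>i\<in>I. g i \<eta>) \<theta> = (\<Sum>i\<in>I. partials js (g i) \<theta>)"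
proof (induction js arbitrary: \<theta>)
  case (Cons j js)
  have "\<forall>\<^sub>F t in nhds 0. partials js (\<lambda>\<eta>. \<Sum>i\<in>I. g i \<eta>) (\<theta> + t *\<^sub>R axis j 1)
      = (\<Sum>i\<in>I. partials js (g i) (\<theta> + t *\<^sub>R axis j 1))"
    using eventually_axis_shift[OF U Cons.prems(1), of j]
    by eventually_elim (use Cons in auto)
  then have "deriv (\<lambda>t. partials js (\<lambda>\<eta>. \<Sum>i\<in>I. g i \<eta>) (\<theta> + t *\<^sub>R axis j 1)) 0
      = deriv (\<lambda>t. \<Sum>i\<in>I. partials js (g i) (\<theta> + t *\<^sub>R axis j 1)) 0"
    by (intro deriv_cong_ev) auto
  also have "\<dots> = (\<Sum>i\<in>I. partial j (partials js (g i)) \<theta>)"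
  proof (intro DERIV_imp_deriv DERIV_sum)
    fix i assume "i \<in> I"
    then show "((\<lambda>t. partials js (g i) (\<theta> + t *\<^sub>R axis j 1)) has_real_derivative partial j (partials js (g i)) \<theta>) (at 0)"
      using has_partial_shift[of j "partials js (g i)" \<theta> 0] hp[of i \<theta> js j] Cons.prems by simp
  qed
  finally show ?case by (simp add: partials_def partial_def)
qed (simp add: partials_def)

text \<open>The smoothness condition grants continuity of the derivatives of order at least 1 only;
  continuity of the log-density is recovered here. Partial derivatives that are bounded near a point
  give a Lipschitz estimate there, by the mean value inequality in one coordinate after
  another.\<close>

lemma continuous_from_partials:
  assumes U: "open U" and hp: "\<And>j \<theta>. \<theta> \<in> U \<Longrightarrow> has_partial j g \<theta>"
    and cont: "\<And>j. continuous_on U (partial j g)"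
  shows "continuous_on U g"
proof -
  have "isCont g \<theta>" if \<theta>: "\<theta> \<in> U" for \<theta>
  proof -
    define B where "B = (\<Sum>j\<in>UNIV. \<bar>partial j g \<theta>\<bar>) + 1"
    have B: "\<bar>partial j g \<theta>\<bar> < B" for j
      unfolding B_def using member_le_sum[of j UNIV "\<lambda>j. \<bar>partial j g \<theta>\<bar>"] by simp
    have "\<forall>\<^sub>F \<eta> in nhds \<theta>. \<bar>partial j g \<eta>\<bar> < B" for j
    proof -
      have "isCont (partial j g) \<theta>" using cont U \<theta> by (simp add: continuous_on_eq_continuous_at)
      then have "((\<lambda>\<eta>. \<bar>partial j g \<eta>\<bar>) \<longlongrightarrow> \<bar>partial j g \<theta>\<bar>) (nhds \<theta>)"
        by (intro tendsto_rabs) (simp add: isCont_def tendsto_at_iff_tendsto_nhds)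
      then show ?thesis using B by (rule order_tendstoD(2))
    qed
    then have "\<forall>\<^sub>F \<eta> in nhds \<theta>. (\<forall>j. \<bar>partial j g \<eta>\<bar> < B) \<and> \<eta> \<in> U"
      using U \<theta> by (intro eventually_conj eventually_all_finite) (auto simp: eventually_nhds)
    then obtain r where r: "0 < r" "\<And>\<eta>. dist \<eta> \<theta> < r \<Longrightarrow> (\<forall>j. \<bar>partial j g \<eta>\<bar> < B) \<and> \<eta> \<in> U"
      by (auto simp: eventually_nhds_metric)
    have step: "\<bar>g (\<chi> i. if i \<in> J then \<eta> $ i else \<theta> $ i) - g \<theta>\<bar> \<le> B * (\<Sum>j\<in>J. \<bar>\<eta> $ j - \<theta> $ j\<bar>)"
      if \<eta>: "dist \<eta> \<theta> < r" for \<eta> J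
      using finite[of J]
    proof (induction J rule: finite_induct)
      case (insert j J)
      let ?a = "\<chi> i. if i \<in> J then \<eta> $ i else \<theta> $ i"
      let ?h = "\<eta> $ j - \<theta> $ j"
      define q where "q s = g (?a + s *\<^sub>R axis j 1)" for s
      \<comment> \<open>The segment from 0 to \<open>?h\<close>, written as an image because the
        sign of \<open>?h\<close> is unknown.\<close>
      define S where "S = (\<lambda>u. u * ?h) ` {0..1}"
      have inr: "dist (?a + s *\<^sub>R axis j 1) \<theta> < r" if "s \<in> S" for s
      proof -
        obtain u where "u \<in> {0..1}" "s = u * ?h" using \<open>s \<in> S\<close> unfolding S_def by blast
        then have u: "s = u * ?h" "0 \<le> u" "u \<le> 1" by auto
        have "\<bar>((?a + s *\<^sub>R axis j 1) - \<theta>) $ i\<bar> \<le> \<bar>(\<eta> - \<theta>) $ i\<bar>" for i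
          using u insert.hyps by (auto simp: axis_def abs_mult mult_left_le_one_le)
        then have "norm ((?a + s *\<^sub>R axis j 1) - \<theta>) \<le> norm (\<eta> - \<theta>)"
          by (intro norm_le_componentwise_cart) simp
        then show ?thesis using \<eta> by (simp add: dist_norm)
      qed
      have cS: "convex S" unfolding S_def by (intro convex_linear_image) (auto intro!: linearI simp: algebra_simps)
      have "\<bar>q ?h - q 0\<bar> \<le> B * \<bar>?h - 0\<bar>"
        unfolding real_norm_def[symmetric]
      proof (rule field_differentiable_bound[OF cS])
        fix s assume s: "s \<in> S"
        show "(q has_field_derivative partial j g (?a + s *\<^sub>R axis j 1)) (at s within S)"
          unfolding q_def using r(2)[OF inr[OF s]]
          by (intro DERIV_subset[OF has_partial_shift[OF hp]]) auto
        show "norm (partial j g (?a + s *\<^sub>R axis j 1)) \<le> B"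
          using r(2)[OF inr[OF s]] by (simp add: less_imp_le)
      qed (auto simp: S_def intro: image_eqI[of _ _ 1] image_eqI[of _ _ 0])
      moreover have "?a + ?h *\<^sub>R axis j 1 = (\<chi> i. if i \<in> insert j J then \<eta> $ i else \<theta> $ i)"
        using insert.hyps by (auto simp: vec_eq_iff axis_def)
      ultimately have "\<bar>g (\<chi> i. if i \<in> insert j J then \<eta> $ i else \<theta> $ i) - g ?a\<bar> \<le> B * \<bar>?h\<bar>"
        by (simp add: q_def)
      then show ?case using insert by (simp add: distrib_left)
    qed auto
    have "(g \<longlongrightarrow> g \<theta>) (at \<theta>)"
    proof (rule Lim_transform_bound[of _ "\<lambda>\<eta>. B * (\<Sum>j\<in>UNIV. \<bar>\<eta> $ j - \<theta> $ j\<bar>)", THEN LIM_zero_cancel])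
      have "\<forall>\<^sub>F \<eta> in at \<theta>. dist \<eta> \<theta> < r" using r(1) by (auto simp: eventually_at)
      then show "\<forall>\<^sub>F \<eta> in at \<theta>. norm (g \<eta> - g \<theta>) \<le> norm (B * (\<Sum>j\<in>UNIV. \<bar>\<eta> $ j - \<theta> $ j\<bar>))"
        by eventually_elim (use step[of _ UNIV] in \<open>force intro: order_trans[OF _ abs_ge_self]\<close>)
      have "((\<lambda>\<eta>. B * (\<Sum>j\<in>UNIV. \<bar>\<eta> $ j - \<theta> $ j\<bar>)) \<longlongrightarrow> B * (\<Sum>j\<in>(UNIV::'a set). \<bar>\<theta> $ j - \<theta> $ j\<bar>)) (at \<theta>)"
        by (intro tendsto_intros)
      then show "((\<lambda>\<eta>. B * (\<Sum>j\<in>UNIV. \<bar>\<eta> $ j - \<theta> $ j\<bar>)) \<longlongrightarrow> 0) (at \<theta>)" by simp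
    qed
    then show ?thesis by (simp add: isCont_def)
  qed
  then show ?thesis by (simp add: continuous_at_imp_continuous_on)
qed

section \<open>Linear systems with invertible or coercive matrices\<close>

lemma invertible_iff_ker: "invertible (A :: real ^ 'd ^ 'd) \<longleftrightarrow> (\<forall>x. A *v x = 0 \<longrightarrow> x = 0)"
  by (simp add: invertible_left_inverse matrix_left_invertible_ker)

lemma matrix_inv_vector:
  assumes "invertible (A :: real ^ 'd ^ 'd)"
  shows "A *v (matrix_inv A *v x) = x"
proof -
  have "A ** matrix_inv A = mat 1"
    using assms unfolding invertible_def matrix_inv_def by (metis (mono_tags, lifting) someI_ex)
  then show ?thesis by (simp add: matrix_vector_mul_assoc)
qed

text \<open>Testing the equation for x a - x0 with x a - x0 itself gives c * norm (x a - x0) \<le>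
  norm (s a - A a *v x0). Convergence of solutions thus follows without continuity of the matrix
  inverse.\<close>

lemma coercive_solution_tendsto:
  fixes A :: "'a \<Rightarrow> real ^ 'd ^ 'd"
  assumes c: "0 < c" and coer: "\<forall>\<^sub>F a in F. \<forall>u. c * (norm u)\<^sup>2 \<le> u \<bullet> (A a *v u)"
    and A: "(A \<longlongrightarrow> A0) F" and s: "(s \<longlongrightarrow> s0) F"
    and x: "\<forall>\<^sub>F a in F. A a *v x a = s a" "A0 *v x0 = s0"
  shows "(x \<longlongrightarrow> x0) F"
proof -
  have bound: "\<forall>\<^sub>F a in F. norm (x a - x0) \<le> norm (s a - A a *v x0) / c"
    using coer x(1)
  proof eventually_elim
    case (elim a)
    have "c * (norm (x a - x0))\<^sup>2 \<le> (x a - x0) \<bullet> (A a *v (x a - x0))" using elim by blast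
    also have "\<dots> = (x a - x0) \<bullet> (s a - A a *v x0)"
      using elim by (simp add: matrix_vector_mult_diff_distrib)
    also have "\<dots> \<le> norm (x a - x0) * norm (s a - A a *v x0)" by (rule norm_cauchy_schwarz)
    finally have "norm (x a - x0) * (c * norm (x a - x0)) \<le> norm (x a - x0) * norm (s a - A a *v x0)"
      by (simp add: power2_eq_square mult_ac)
    then have "c * norm (x a - x0) \<le> norm (s a - A a *v x0)"
      by (cases "norm (x a - x0) = 0") (auto dest: mult_left_le_imp_le)
    then show ?case using c by (simp add: field_simps)
  qed
  have "((\<lambda>a. A a *v x0) \<longlongrightarrow> A0 *v x0) F"
    unfolding matrix_vector_mult_def using A by (intro tendsto_vec_lambda tendsto_sum tendsto_mult tendsto_vec_nth tendsto_const) 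
  from tendsto_norm[OF tendsto_diff[OF s this]]
  have "((\<lambda>a. norm (s a - A a *v x0)) \<longlongrightarrow> 0) F" by (simp add: x(2))
  from tendsto_divide[OF this tendsto_const[of c]] c
  have "((\<lambda>a. norm (s a - A a *v x0) / c) \<longlongrightarrow> 0) F" by simp
  from Lim_null_comparison[OF bound this] show ?thesis by (simp add: LIM_zero_cancel)
qed

section \<open>Expectations near a parameter\<close>

text \<open>The hypotheses as seen from one fixed point \<theta>0: its radius, order and exponent, a
  single bound \<open>K\<close> for all the moments, and measurable sets \<open>S i\<close> of full
  measure on which the log-density is regular for all parameters of the ball at once.\<close>

locale parameter_center =
  fixes \<Theta> :: "(real ^ 'd) set"
    and M :: "real ^ 'd \<Rightarrow> 'w measure"
    and Y :: "nat \<Rightarrow> 'w \<Rightarrow> obs"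
    and \<gamma> :: "nat \<Rightarrow> obs measure"
    and f :: "nat \<Rightarrow> real ^ 'd \<Rightarrow> obs \<Rightarrow> real"
    and L :: "nat \<Rightarrow> real ^ 'd \<Rightarrow> obs \<Rightarrow> real"
    and \<theta>0 :: "real ^ 'd" and \<rho>0 :: real and k0 :: nat and p K :: real
    and S :: "nat \<Rightarrow> obs set"
  assumes prob_M: "\<theta> \<in> \<Theta> \<Longrightarrow> prob_space (M \<theta>)"
    and Y_indep: "\<theta> \<in> \<Theta> \<Longrightarrow> prob_space.indep_vars (M \<theta>) \<gamma> Y {1..}"
    and f_measurable: "1 \<le> i \<Longrightarrow> \<theta> \<in> \<Theta> \<Longrightarrow> f i \<theta> \<in> borel_measurable (\<gamma> i)"
    and f_nonneg: "1 \<le> i \<Longrightarrow> \<theta> \<in> \<Theta> \<Longrightarrow> y \<in> space (\<gamma> i) \<Longrightarrow> 0 \<le> f i \<theta> y"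
    and Y_measurable: "1 \<le> i \<Longrightarrow> \<theta> \<in> \<Theta> \<Longrightarrow> Y i \<in> measurable (M \<theta>) (\<gamma> i)"
    and Y_distr: "1 \<le> i \<Longrightarrow> \<theta> \<in> \<Theta> \<Longrightarrow> distr (M \<theta>) (\<gamma> i) (Y i) = law \<gamma> f i \<theta>"
    and obs_measurable: "1 \<le> i \<Longrightarrow> (\<lambda>y. y) \<in> borel_measurable (\<gamma> i)"
    and AE_transfer: "1 \<le> i \<Longrightarrow> \<theta> \<in> \<Theta> \<Longrightarrow> \<theta>' \<in> \<Theta> \<Longrightarrow> (AE y in law \<gamma> f i \<theta>. P y) \<Longrightarrow> (AE y in law \<gamma> f i \<theta>'. P y)"
    and determined: "partials_determined \<Theta>"
    and \<theta>0: "\<theta>0 \<in> \<Theta>" and \<rho>0: "0 < \<rho>0" and k0: "2 \<le> k0" and p: "2 < p" and K: "0 \<le> K"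
    and S_sets: "1 \<le> i \<Longrightarrow> S i \<in> sets (\<gamma> i)"
    and AE_S0: "1 \<le> i \<Longrightarrow> AE y in law \<gamma> f i \<theta>0. y \<in> S i"
    and S_pos: "1 \<le> i \<Longrightarrow> y \<in> S i \<Longrightarrow> \<theta> \<in> ball \<theta>0 \<rho>0 \<inter> \<Theta> \<Longrightarrow> 0 < f i \<theta> y \<and> L i \<theta> y = ln (f i \<theta> y)"
    and S_partial: "1 \<le> i \<Longrightarrow> y \<in> S i \<Longrightarrow> \<theta> \<in> ball \<theta>0 \<rho>0 \<Longrightarrow> length js < k0 \<Longrightarrow> has_partial j (partials js (\<lambda>\<eta>. L i \<eta> y)) \<theta>"
    and S_cont: "1 \<le> i \<Longrightarrow> 1 \<le> length js \<Longrightarrow> length js \<le> k0 \<Longrightarrow>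
       continuous_on (ball \<theta>0 \<rho>0 \<times> S i) (\<lambda>(\<theta>, y). partials js (\<lambda>\<eta>. L i \<eta> y) \<theta>)"
    and moments: "1 \<le> i \<Longrightarrow> \<theta> \<in> ball \<theta>0 \<rho>0 \<inter> \<Theta> \<Longrightarrow> \<theta>t \<in> ball \<theta>0 \<rho>0 \<Longrightarrow> length js \<le> k0 \<Longrightarrow>
       (\<integral>\<^sup>+y. ennreal (\<bar>partials js (\<lambda>\<eta>. L i \<eta> y) \<theta>t\<bar> powr p) \<partial>law \<gamma> f i \<theta>) \<le> ennreal K"
begin

abbreviation "B \<equiv> ball \<theta>0 \<rho>0"
abbreviation "P i \<theta> \<equiv> law \<gamma> f i \<theta>"

lemma space_law [simp]: "space (law \<gamma> f i \<theta>) = space (\<gamma> i)"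
  and sets_law [simp, measurable_cong]: "sets (law \<gamma> f i \<theta>) = sets (\<gamma> i)"
  by (simp_all add: law_def)

lemma \<theta>0_B: "\<theta>0 \<in> B \<inter> \<Theta>" using \<theta>0 \<rho>0 by simp

lemma prob_law:
  assumes "1 \<le> i" "\<theta> \<in> \<Theta>" shows "prob_space (P i \<theta>)"
  using prob_space.prob_space_distr[OF prob_M[OF assms(2)] Y_measurable[OF assms]]
  unfolding Y_distr[OF assms] .

lemma AE_S:
  assumes "1 \<le> i" "\<theta> \<in> \<Theta>" shows "AE y in P i \<theta>. y \<in> S i"
  by (rule AE_transfer[OF assms(1) \<theta>0 assms(2) AE_S0[OF assms(1)]])

lemma AE_Y:
  assumes "1 \<le> i" "\<theta> \<in> \<Theta>" "AE y in P i \<theta>. Q y"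
  shows "AE w in M \<theta>. Q (Y i w)"
  using assms(3) unfolding Y_distr[OF assms(1,2), symmetric] by (rule AE_distrD[OF Y_measurable[OF assms(1,2)]])

text \<open>Cutting off outside \<open>S i\<close> makes measurability, continuity and the
  derivative rule hold for every y, so that limits can be taken without tracking null sets.\<close>

definition D :: "nat \<Rightarrow> 'd list \<Rightarrow> real ^ 'd \<Rightarrow> obs \<Rightarrow> real" where
  "D i js \<eta> y = (if y \<in> S i then partials js (\<lambda>\<eta>. L i \<eta> y) \<eta> else 0)"

text \<open>Joint continuity on the product of the ball and \<open>S i\<close> gives Borel
  measurability on the restricted space, and extension by 0 keeps it. The joint version, along a
  measurable path \<open>h\<close> in the ball, is what Fubini requires.\<close>

lemma D_joint_measurable:
  assumes i: "1 \<le> i" and js: "1 \<le> length js" "length js \<le> k0"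
    and h[measurable]: "h \<in> borel_measurable N" and hB: "\<And>x. h x \<in> B"
  shows "(\<lambda>(x, y). D i js (h x) y) \<in> borel_measurable (N \<Otimes>\<^sub>M \<gamma> i)"
proof -
  note S_sets[OF i, measurable] obs_measurable[OF i, measurable]
  let ?g = "\<lambda>(\<theta>, y). partials js (\<lambda>\<eta>. L i \<eta> y) \<theta>"
  let ?A = "{x \<in> space (N \<Otimes>\<^sub>M \<gamma> i). snd x \<in> S i}"
  have g: "?g \<in> borel_measurable (restrict_space borel (B \<times> S i))"
    by (rule borel_measurable_continuous_on_restrict[OF S_cont[OF i js]])
  have "(\<lambda>x. snd x) \<in> borel_measurable (N \<Otimes>\<^sub>M \<gamma> i)"
    using measurable_compose[OF measurable_snd obs_measurable[OF i], of N] by simp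
  then have "(\<lambda>x. (h (fst x), snd x)) \<in> borel_measurable (N \<Otimes>\<^sub>M \<gamma> i)"
    by measurable
  then have "(\<lambda>x. (h (fst x), snd x)) \<in> restrict_space (N \<Otimes>\<^sub>M \<gamma> i) ?A \<rightarrow>\<^sub>M restrict_space borel (B \<times> S i)"
    using hB by (intro measurable_restrict_space3) auto
  from measurable_compose[OF this g]
  have "(\<lambda>x. ?g (h (fst x), snd x)) \<in> borel_measurable (restrict_space (N \<Otimes>\<^sub>M \<gamma> i) ?A)" .
  then have "(\<lambda>x. if x \<in> ?A then ?g (h (fst x), snd x) else 0) \<in> borel_measurable (N \<Otimes>\<^sub>M \<gamma> i)"
    by (subst measurable_If_restrict_space_iff) auto
  then show ?thesis
    by (rule measurable_cong[THEN iffD1, rotated]) (auto simp: D_def split: prod.splits)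
qed

lemma D_measurable [measurable]:
  assumes "1 \<le> i" "1 \<le> length js" "length js \<le> k0" "\<eta> \<in> B"
  shows "D i js \<eta> \<in> borel_measurable (\<gamma> i)"
proof -
  have "(\<lambda>(x, y). D i js \<eta> y) \<in> borel_measurable (borel \<Otimes>\<^sub>M \<gamma> i)"
    by (rule D_joint_measurable[OF assms(1-3)]) (use assms(4) in simp_all)
  from measurable_compose[OF measurable_Pair1'[of "0::real"] this] show ?thesis
    by (simp only: prod.case space_borel UNIV_I)
qed

lemma D_continuous:
  assumes "1 \<le> i" "1 \<le> length js" "length js \<le> k0"
  shows "continuous_on B (\<lambda>\<eta>. D i js \<eta> y)"
proof (cases "y \<in> S i")
  case True
  then have "continuous_on B (\<lambda>\<eta>. (\<lambda>(\<theta>, y). partials js (\<lambda>\<eta>. L i \<eta> y) \<theta>) (\<eta>, y))"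
    by (intro continuous_on_compose2[OF S_cont[OF assms]] continuous_intros) auto
  then show ?thesis using True by (simp add: D_def)
qed (simp add: D_def)

lemma D_moment:
  assumes i: "1 \<le> i" and "\<theta> \<in> B \<inter> \<Theta>" "\<eta> \<in> B" "length js \<le> k0"
  shows "(\<integral>\<^sup>+y. ennreal (\<bar>D i js \<eta> y\<bar> powr p) \<partial>P i \<theta>) \<le> ennreal K"
proof -
  have "(\<integral>\<^sup>+y. ennreal (\<bar>D i js \<eta> y\<bar> powr p) \<partial>P i \<theta>)
      = (\<integral>\<^sup>+y. ennreal (\<bar>partials js (\<lambda>\<eta>. L i \<eta> y) \<eta>\<bar> powr p) \<partial>P i \<theta>)"
  proof (rule nn_integral_cong_AE)
    have "AE y in P i \<theta>. y \<in> S i" using AE_S[OF i] assms(2) by blast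
    then show "AE y in P i \<theta>. ennreal (\<bar>D i js \<eta> y\<bar> powr p) = ennreal (\<bar>partials js (\<lambda>\<eta>. L i \<eta> y) \<eta>\<bar> powr p)"
      by eventually_elim (simp add: D_def)
  qed
  also have "\<dots> \<le> ennreal K" by (rule moments) fact+
  finally show ?thesis .
qed

lemma D_derivative:
  assumes i: "1 \<le> i" and "\<eta> + t *\<^sub>R axis j 1 \<in> B" "length js < k0"
  shows "((\<lambda>s. D i js (\<eta> + s *\<^sub>R axis j 1) y) has_real_derivative D i (j # js) (\<eta> + t *\<^sub>R axis j 1) y) (at t)"
proof (cases "y \<in> S i")
  case True
  then show ?thesis using has_partial_shift[OF S_partial[OF i True assms(2,3)]]
    by (simp add: D_def partials_def)
qed (simp add: D_def)

lemma f_continuous: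
  assumes i: "1 \<le> i" and y: "y \<in> S i"
  shows "continuous_on (B \<inter> \<Theta>) (\<lambda>\<eta>. f i \<eta> y)"
proof -
  have "continuous_on B (\<lambda>\<eta>. L i \<eta> y)"
  proof (rule continuous_from_partials)
    show "has_partial j (\<lambda>\<eta>. L i \<eta> y) \<theta>" if "\<theta> \<in> B" for j \<theta>
      using S_partial[OF i y that, of "[]"] k0 by (simp add: partials_def)
    show "continuous_on B (partial j (\<lambda>\<eta>. L i \<eta> y))" for j
      using D_continuous[OF i, of "[j]" y] y k0 by (simp add: D_def partials_def)
  qed simp
  then have "continuous_on (B \<inter> \<Theta>) (\<lambda>\<eta>. exp (L i \<eta> y))"
    by (intro continuous_intros) (auto intro: continuous_on_subset)
  then show ?thesis
    by (rule continuous_on_cong[THEN iffD1, rotated 2]) (use S_pos[OF i y] in auto)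
qed

text \<open>Every law gives full mass to \<open>S i\<close>, so its density vanishes almost
  everywhere outside and may be multiplied by the indicator. On \<open>S i\<close> the density is
  positive and continuous in the parameter near \<theta>0; this is the weight used in the limit
  theorems.\<close>

lemma law_S:
  assumes i: "1 \<le> i" and \<eta>: "\<eta> \<in> \<Theta>"
  shows "integrable (\<gamma> i) (\<lambda>y. indicator (S i) y * f i \<eta> y)" "(\<integral>y. indicator (S i) y * f i \<eta> y \<partial>\<gamma> i) = 1"
    "X \<in> borel_measurable (\<gamma> i) \<Longrightarrow> integrable (P i \<eta>) X \<longleftrightarrow> integrable (\<gamma> i) (\<lambda>y. indicator (S i) y * (X y * f i \<eta> y))"
    "X \<in> borel_measurable (\<gamma> i) \<Longrightarrow> (\<integral>y. X y \<partial>P i \<eta>) = (\<integral>y. indicator (S i) y * (X y * f i \<eta> y) \<partial>\<gamma> i)"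
    "X \<in> borel_measurable (\<gamma> i) \<Longrightarrow> (\<And>y. 0 \<le> X y) \<Longrightarrow>
      (\<integral>\<^sup>+y. ennreal (X y) \<partial>P i \<eta>) = (\<integral>\<^sup>+y. ennreal (X y * (indicator (S i) y * f i \<eta> y)) \<partial>\<gamma> i)"
proof -
  note [measurable] = f_measurable[OF i \<eta>] S_sets[OF i]
  interpret prob_space "P i \<eta>" by (rule prob_law[OF i \<eta>])
  have f0: "AE y in \<gamma> i. 0 \<le> f i \<eta> y" using f_nonneg[OF i \<eta>] by auto
  have "AE y in \<gamma> i. 0 < ennreal (f i \<eta> y) \<longrightarrow> y \<in> S i"
    using AE_S[OF i \<eta>] unfolding law_def by (subst (asm) AE_density) auto
  then have off: "AE y in \<gamma> i. f i \<eta> y = indicator (S i) y * f i \<eta> y"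
    using f0 by eventually_elim (auto simp: indicator_def ennreal_eq_0_iff zero_less_iff_neq_zero)
  show A: "integrable (P i \<eta>) X \<longleftrightarrow> integrable (\<gamma> i) (\<lambda>y. indicator (S i) y * (X y * f i \<eta> y))"
    "(\<integral>y. X y \<partial>P i \<eta>) = (\<integral>y. indicator (S i) y * (X y * f i \<eta> y) \<partial>\<gamma> i)"
    if [measurable]: "X \<in> borel_measurable (\<gamma> i)" for X :: "obs \<Rightarrow> real"
  proof -
    have e: "AE y in \<gamma> i. f i \<eta> y * X y = indicator (S i) y * (X y * f i \<eta> y)"
      using off by eventually_elim (auto simp: indicator_def)
    show "integrable (P i \<eta>) X \<longleftrightarrow> integrable (\<gamma> i) (\<lambda>y. indicator (S i) y * (X y * f i \<eta> y))"
      unfolding law_def using f0 integrable_cong_AE[OF _ _ e] by (subst integrable_density) auto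
    show "(\<integral>y. X y \<partial>P i \<eta>) = (\<integral>y. indicator (S i) y * (X y * f i \<eta> y) \<partial>\<gamma> i)"
      unfolding law_def using f0 integral_cong_AE[OF _ _ e] by (subst integral_density) auto
  qed
  show "integrable (\<gamma> i) (\<lambda>y. indicator (S i) y * f i \<eta> y)" using A(1)[of "\<lambda>_. 1"] by simp
  show "(\<integral>y. indicator (S i) y * f i \<eta> y \<partial>\<gamma> i) = 1" using A(2)[of "\<lambda>_. 1"] prob_space by simp
  show "(\<integral>\<^sup>+y. ennreal (X y) \<partial>P i \<eta>) = (\<integral>\<^sup>+y. ennreal (X y * (indicator (S i) y * f i \<eta> y)) \<partial>\<gamma> i)"
    if [measurable]: "X \<in> borel_measurable (\<gamma> i)" and X0: "\<And>y. 0 \<le> X y" for X :: "obs \<Rightarrow> real"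
  proof -
    have "AE y in \<gamma> i. ennreal (f i \<eta> y) * ennreal (X y) = ennreal (X y * (indicator (S i) y * f i \<eta> y))"
      using off f0
    proof eventually_elim
      case (elim y)
      then show ?case using X0[of y]
        by (simp add: ennreal_mult[symmetric] mult.commute)
    qed
    then show ?thesis unfolding law_def by (subst nn_integral_density) (auto intro!: nn_integral_cong_AE)
  qed
qed

text \<open>Function and law vary together. The densities on \<open>S i\<close> are the weights;
  they converge pointwise and have total mass 1 throughout, so
  \<open>integral_convergence_weighted\<close> applies.\<close>

lemma expectation_tendsto:
  assumes i: "1 \<le> i" and \<eta>: "\<And>m. \<eta> m \<in> B \<inter> \<Theta>" "\<eta>' \<in> B \<inter> \<Theta>" "\<eta> \<longlonglongrightarrow> \<eta>'"
    and X[measurable]: "\<And>m. X m \<in> borel_measurable (\<gamma> i)" "X' \<in> borel_measurable (\<gamma> i)"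
    and lim: "AE y in P i \<theta>0. (\<lambda>m. X m y) \<longlonglongrightarrow> X' y"
    and q: "1 < q" and bound: "\<And>m. (\<integral>\<^sup>+y. ennreal (\<bar>X m y\<bar> powr q) \<partial>P i (\<eta> m)) \<le> ennreal K'"
  shows "\<And>m. integrable (P i (\<eta> m)) (X m)" "integrable (P i \<eta>') X'"
    "(\<lambda>m. \<integral>y. X m y \<partial>P i (\<eta> m)) \<longlonglongrightarrow> (\<integral>y. X' y \<partial>P i \<eta>')"
proof -
  have \<eta>T: "\<eta> m \<in> \<Theta>" "\<eta>' \<in> \<Theta>" for m using \<eta> by auto
  note [measurable] = f_measurable[OF i \<eta>T(1)] f_measurable[OF i \<eta>T(2)] f_measurable[OF i \<theta>0] S_sets[OF i]
  define w where "w m y = indicator (S i) y * f i (\<eta> m) y" for m y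
  define w0 where "w0 y = indicator (S i) y * f i \<eta>' y" for y
  have wl: "AE y in \<gamma> i. (\<lambda>m. w m y) \<longlonglongrightarrow> w0 y"
  proof (rule AE_I2)
    fix y show "(\<lambda>m. w m y) \<longlonglongrightarrow> w0 y"
    proof (cases "y \<in> S i")
      case True
      have "(\<lambda>m. f i (\<eta> m) y) \<longlonglongrightarrow> f i \<eta>' y"
        using f_continuous[OF i True] \<eta> unfolding continuous_on_sequentially o_def by blast
      with True show ?thesis by (simp add: w_def w0_def)
    qed (simp add: w_def w0_def)
  qed
  have w0: "0 \<le> w m y" for m y
    using S_pos[OF i, of y "\<eta> m"] \<eta>(1)[of m] by (auto simp: w_def indicator_def less_imp_le)
  \<comment> \<open>On \<open>S i\<close> the density at \<theta>0 is positive, so almost sure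
    convergence under \<open>P i \<theta>0\<close> is convergence \<gamma>-almost everywhere on
    \<open>S i\<close>.\<close>
  have "AE y in \<gamma> i. 0 < ennreal (f i \<theta>0 y) \<longrightarrow> (\<lambda>m. X m y) \<longlonglongrightarrow> X' y"
    using lim unfolding law_def by (subst (asm) AE_density) auto
  then have Xl: "AE y in \<gamma> i. (\<lambda>m. indicator (S i) y * X m y) \<longlonglongrightarrow> indicator (S i) y * X' y"
  proof eventually_elim
    case (elim y)
    then show ?case using S_pos[OF i, of y \<theta>0] \<theta>0_B by (cases "y \<in> S i") auto
  qed
  have rl: "AE y in \<gamma> i. (\<lambda>m. indicator (S i) y * (X m y * f i (\<eta> m) y)) \<longlonglongrightarrow> indicator (S i) y * (X' y * f i \<eta>' y)"
    using Xl wl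
  proof eventually_elim
    case (elim y)
    show ?case using tendsto_mult[OF elim] by (cases "y \<in> S i") (auto simp: w_def w0_def)
  qed
  have mom: "(\<integral>\<^sup>+y. ennreal (\<bar>indicator (S i) y * X m y\<bar> powr q * w m y) \<partial>\<gamma> i) \<le> ennreal K'" for m
  proof -
    have "(\<integral>\<^sup>+y. ennreal (\<bar>indicator (S i) y * X m y\<bar> powr q * w m y) \<partial>\<gamma> i)
        = (\<integral>\<^sup>+y. ennreal (\<bar>X m y\<bar> powr q * (indicator (S i) y * f i (\<eta> m) y)) \<partial>\<gamma> i)"
      by (intro nn_integral_cong) (auto simp: w_def indicator_def)
    also have "\<dots> = (\<integral>\<^sup>+y. ennreal (\<bar>X m y\<bar> powr q) \<partial>P i (\<eta> m))"
      by (rule law_S(5)[OF i \<eta>T(1), symmetric]) auto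
    finally show ?thesis using bound[of m] by simp
  qed
  note V = integral_convergence_weighted[where M="\<gamma> i" and p=q and K=K'
      and r="\<lambda>m y. indicator (S i) y * (X m y * f i (\<eta> m) y)" and ?r0.0="\<lambda>y. indicator (S i) y * (X' y * f i \<eta>' y)"
      and q="\<lambda>m y. indicator (S i) y * X m y" and ?q0.0="\<lambda>y. indicator (S i) y * X' y" and w=w and ?w0.0=w0, OF _ _ _ _ _ _ rl Xl wl _ _ _ _ _ q mom]
  have meas: "(\<lambda>y. indicator (S i) y * (X m y * f i (\<eta> m) y)) \<in> borel_measurable (\<gamma> i)"
    "(\<lambda>y. indicator (S i) y * X m y) \<in> borel_measurable (\<gamma> i)" "w m \<in> borel_measurable (\<gamma> i)"
    "(\<lambda>y. indicator (S i) y * (X' y * f i \<eta>' y)) \<in> borel_measurable (\<gamma> i)"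
    "(\<lambda>y. indicator (S i) y * X' y) \<in> borel_measurable (\<gamma> i)" "w0 \<in> borel_measurable (\<gamma> i)" for m
    unfolding w_def w0_def by measurable
  have dom: "AE y in \<gamma> i. \<bar>indicator (S i) y * (X m y * f i (\<eta> m) y)\<bar> \<le> \<bar>indicator (S i) y * X m y\<bar> * w m y" for m
    using S_pos[OF i, of _ "\<eta> m"] \<eta>(1)[of m] by (intro AE_I2) (auto simp: w_def indicator_def abs_mult less_imp_le)
  have wi: "integrable (\<gamma> i) (w m)" "integrable (\<gamma> i) w0" "(\<lambda>m. \<integral>y. w m y \<partial>\<gamma> i) \<longlonglongrightarrow> (\<integral>y. w0 y \<partial>\<gamma> i)" for m
    unfolding w_def w0_def using law_S(1,2)[OF i \<eta>T(1)] law_S(1,2)[OF i \<eta>T(2)] by simp_all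
  note V' = V[OF meas dom AE_I2[OF w0] wi]
  show "integrable (P i (\<eta> m)) (X m)" for m using V'(1) law_S(3)[OF i \<eta>T(1) X(1)] by simp
  show "integrable (P i \<eta>') X'" using V'(2) law_S(3)[OF i \<eta>T(2) X(2)] by simp
  show "(\<lambda>m. \<integral>y. X m y \<partial>P i (\<eta> m)) \<longlonglongrightarrow> (\<integral>y. X' y \<partial>P i \<eta>')"
    using V'(3) law_S(4)[OF i \<eta>T(1) X(1)] law_S(4)[OF i \<eta>T(2) X(2)] by simp
qed

end

section \<open>Taylor expansion of the partial derivatives along the axes\<close>

text \<open>The segment parallel to the $j$th axis that ends in \<open>\<eta>\<close> and starts in the point whose $j$th
  coordinate is that of \<open>\<theta>\<close>; it is constant outside $[0,1]$.\<close>

definition axis_path :: "'d \<Rightarrow> real ^ 'd \<Rightarrow> real ^ 'd \<Rightarrow> real \<Rightarrow> real ^ 'd" where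
  "axis_path j \<theta> \<eta> t = \<eta> + (- (1 - clamp01 t) * (\<eta> $ j - \<theta> $ j)) *\<^sub>R axis j 1"

lemma axis_path_1 [simp]: "axis_path j \<theta> \<eta> 1 = \<eta>"
  by (simp add: axis_path_def)

lemma axis_path_eq [simp]: "\<eta> $ j = \<theta> $ j \<Longrightarrow> axis_path j \<theta> \<eta> t = \<eta>"
  by (simp add: axis_path_def)

lemma axis_path_0_coord: "axis_path j \<theta> \<eta> 0 $ j = \<theta> $ j"
  by (simp add: axis_path_def axis_def)

lemma axis_path_clamp [simp]: "axis_path j \<theta> \<eta> (clamp01 t) = axis_path j \<theta> \<eta> t"
  by (simp add: axis_path_def)

lemma continuous_on_axis_path [continuous_intros]: "continuous_on S (axis_path j \<theta> \<eta>)"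
  unfolding axis_path_def by (intro continuous_intros)

lemma dist_axis_path: "dist \<theta> (axis_path j \<theta> \<eta> t) \<le> dist \<theta> \<eta>"
proof -
  have "\<bar>(axis_path j \<theta> \<eta> t - \<theta>) $ a\<bar> \<le> \<bar>(\<eta> - \<theta>) $ a\<bar>" for a
  proof (cases "a = j")
    case True
    have "(axis_path j \<theta> \<eta> t - \<theta>) $ j = clamp01 t * (\<eta> $ j - \<theta> $ j)"
      by (simp add: axis_path_def axis_def algebra_simps)
    then show ?thesis using True by (simp add: abs_mult mult_left_le_one_le)
  qed (simp add: axis_path_def axis_def)
  then have "norm (axis_path j \<theta> \<eta> t - \<theta>) \<le> norm (\<eta> - \<theta>)"
    by (intro norm_le_componentwise_cart) simp
  then show ?thesis by (simp add: dist_norm norm_minus_commute)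
qed

lemma axis_path_line: "axis_path j \<theta> (\<theta> + t *\<^sub>R axis j 1) s = \<theta> + (clamp01 s * t) *\<^sub>R axis j 1"
  by (simp add: axis_path_def vec_eq_iff axis_def algebra_simps)

lemma sum_powr_le:
  fixes x :: "'i \<Rightarrow> real"
  assumes "finite I" "0 \<le> p" "\<And>i. i \<in> I \<Longrightarrow> 0 \<le> x i"
  shows "(\<Sum>i\<in>I. x i) powr p \<le> real (card I) powr p * (\<Sum>i\<in>I. x i powr p)"
proof (cases "I = {}")
  case False
  define m where "m = Max (x ` I)"
  have mI: "m \<in> x ` I" unfolding m_def using assms False by (intro Max_in) auto
  then have m0: "0 \<le> m" using assms by auto
  have "(\<Sum>i\<in>I. x i) \<le> real (card I) * m"
    using assms by (intro sum_bounded_above) (auto simp: m_def)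
  then have "(\<Sum>i\<in>I. x i) powr p \<le> (real (card I) * m) powr p"
    using assms by (intro powr_mono2 sum_nonneg) auto
  also have "\<dots> = real (card I) powr p * m powr p" using m0 by (simp add: powr_mult)
  also have "m powr p \<le> (\<Sum>i\<in>I. x i powr p)"
    using mI assms by (auto intro!: member_le_sum)
  finally show ?thesis by (simp add: mult_left_mono)
qed simp

context parameter_center
begin

lemma axis_path_B: "\<eta> \<in> B \<Longrightarrow> axis_path j \<theta>0 \<eta> t \<in> B"
  using dist_axis_path[of \<theta>0 j \<eta> t] by simp

text \<open>A divided Taylor remainder of order m along the j-th axis: the ordinary difference
  quotient for m = 1, and the derivative itself where the path is constant. It thereby extends the
  quotient continuously to points with equal j-th coordinates.\<close>

definition avg :: "nat \<Rightarrow> 'd list \<Rightarrow> nat \<Rightarrow> 'd \<Rightarrow> real ^ 'd \<Rightarrow> real ^ 'd \<Rightarrow> obs \<Rightarrow> real" where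
  "avg i js m j \<theta> \<eta> y = (\<integral>t. D i js (axis_path j \<theta> \<eta> t) y \<partial>remainder_measure m)"

lemma D_path_continuous:
  assumes "1 \<le> i" "1 \<le> length js" "length js \<le> k0" "\<And>t. axis_path j \<theta> \<eta> t \<in> B"
  shows "continuous_on T (\<lambda>t. D i js (axis_path j \<theta> \<eta> t) y)"
  using assms(4) by (intro continuous_on_compose2[OF D_continuous[OF assms(1-3)]] continuous_intros) auto

lemma D_path_bounded:
  assumes "1 \<le> i" "1 \<le> length js" "length js \<le> k0" "\<And>t. axis_path j \<theta> \<eta> t \<in> B"
  shows "\<exists>b. \<forall>t. \<bar>D i js (axis_path j \<theta> \<eta> t) y\<bar> \<le> b"
proof -
  have "compact ((\<lambda>t. D i js (axis_path j \<theta> \<eta> t) y) ` {0..1})"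
    by (intro compact_continuous_image D_path_continuous assms) auto
  then obtain b where b: "\<forall>t\<in>{0..1}. \<bar>D i js (axis_path j \<theta> \<eta> t) y\<bar> \<le> b"
    by (auto dest!: compact_imp_bounded simp: bounded_iff)
  have "\<bar>D i js (axis_path j \<theta> \<eta> t) y\<bar> \<le> b" for t
    using b[rule_format, of "clamp01 t"] by simp
  then show ?thesis by blast
qed

lemma avg_moment:
  assumes i: "1 \<le> i" and js: "1 \<le> length js" "length js \<le> k0" and path: "\<And>t. axis_path j \<theta> \<eta> t \<in> B"
  shows "avg i js m j \<theta> \<eta> \<in> borel_measurable (\<gamma> i)"
    and "\<zeta> \<in> B \<inter> \<Theta> \<Longrightarrow> (\<integral>\<^sup>+y. ennreal (\<bar>avg i js m j \<theta> \<eta> y\<bar> powr p) \<partial>P i \<zeta>) \<le> ennreal (2 powr p * (1 + K))"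
proof -
  have pm: "axis_path j \<theta> \<eta> \<in> borel_measurable borel"
    by (intro borel_measurable_continuous_onI continuous_on_axis_path)
  have jm: "(\<lambda>(t, y). D i js (axis_path j \<theta> \<eta> t) y) \<in> borel_measurable (borel \<Otimes>\<^sub>M P i \<zeta>)" for \<zeta>
    using D_joint_measurable[OF i js pm path] by (simp cong: measurable_cong_sets sets_pair_measure_cong)
  have p1: "1 \<le> p" using p by simp
  note A = average_moment_bound[OF prob_space_remainder_measure sets_remainder_measure prob_law[OF i] jm
    D_path_bounded[OF i js path] p1 K D_moment[OF i _ path js(2)]]
  show "avg i js m j \<theta> \<eta> \<in> borel_measurable (\<gamma> i)"
  proof -
    have "(\<lambda>y. \<integral>t. D i js (axis_path j \<theta> \<eta> t) y \<partial>remainder_measure m) \<in> borel_measurable (P i \<theta>0)"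
      by (rule A(2)[OF \<theta>0 \<theta>0_B])
    then show ?thesis unfolding avg_def[abs_def] by (simp cong: measurable_cong_sets)
  qed
  show "(\<integral>\<^sup>+y. ennreal (\<bar>avg i js m j \<theta> \<eta> y\<bar> powr p) \<partial>P i \<zeta>) \<le> ennreal (2 powr p * (1 + K))"
    if "\<zeta> \<in> B \<inter> \<Theta>"
    unfolding avg_def by (rule A(1)) (use that in auto)
qed

lemma avg_tendsto:
  assumes i: "1 \<le> i" and js: "1 \<le> length js" "length js \<le> k0"
    and \<eta>: "\<And>a. \<eta> a \<in> B" "\<eta>' \<in> B" "\<eta> \<longlonglongrightarrow> \<eta>'"
  shows "(\<lambda>a. avg i js m j \<theta>0 (\<eta> a) y) \<longlonglongrightarrow> avg i js m j \<theta>0 \<eta>' y"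
proof -
  interpret \<tau>: prob_space "remainder_measure m" by (rule prob_space_remainder_measure)
  have "compact (insert \<eta>' (range \<eta>))" using \<eta>(3) by (rule compact_sequence_with_limit)
  moreover have "continuous_on (insert \<eta>' (range \<eta>)) (dist \<theta>0)" by (intro continuous_intros)
  \<comment> \<open>The point of the sequence and its limit that is farthest from \<theta>0. All
    paths stay in the closed ball through \<open>z\<close>, a compact part of the open ball, on
    which the derivative is bounded.\<close>
  ultimately obtain z where z: "z \<in> insert \<eta>' (range \<eta>)" "\<And>x. x \<in> insert \<eta>' (range \<eta>) \<Longrightarrow> dist \<theta>0 x \<le> dist \<theta>0 z"
    using continuous_attains_sup[of "insert \<eta>' (range \<eta>)" "dist \<theta>0"] by blast
  have zB: "z \<in> B" using z(1) \<eta> by auto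
  have "compact ((\<lambda>\<eta>. D i js \<eta> y) ` cball \<theta>0 (dist \<theta>0 z))"
    using zB by (intro compact_continuous_image continuous_on_subset[OF D_continuous[OF i js]]) auto
  then obtain b where b: "\<forall>x\<in>cball \<theta>0 (dist \<theta>0 z). \<bar>D i js x y\<bar> \<le> b"
    by (auto dest!: compact_imp_bounded simp: bounded_iff)
  have bb: "\<bar>D i js (axis_path j \<theta>0 (\<eta> a) t) y\<bar> \<le> b" for a t
    using order_trans[OF dist_axis_path z(2)[of "\<eta> a"]] by (intro b[rule_format]) auto
  have m: "(\<lambda>t. D i js (axis_path j \<theta>0 x t) y) \<in> borel_measurable (remainder_measure m)" if "x \<in> B" for x
    using D_path_continuous[OF i js axis_path_B[OF that]]
    by (simp cong: measurable_cong_sets add: borel_measurable_continuous_onI)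
  show ?thesis unfolding avg_def
  proof (rule integral_dominated_convergence[where w="\<lambda>_. b"])
    show "AE t in remainder_measure m. (\<lambda>a. D i js (axis_path j \<theta>0 (\<eta> a) t) y) \<longlonglongrightarrow> D i js (axis_path j \<theta>0 \<eta>' t) y"
    proof (rule AE_I2)
      fix t
      have "(\<lambda>a. axis_path j \<theta>0 (\<eta> a) t) \<longlonglongrightarrow> axis_path j \<theta>0 \<eta>' t"
        unfolding axis_path_def by (intro tendsto_intros \<eta>)
      then show "(\<lambda>a. D i js (axis_path j \<theta>0 (\<eta> a) t) y) \<longlonglongrightarrow> D i js (axis_path j \<theta>0 \<eta>' t) y"
        by (rule continuous_on_tendsto_compose[OF D_continuous[OF i js]])
          (use axis_path_B[OF \<eta>(1)] axis_path_B[OF \<eta>(2)] in auto)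
    qed
    show "(\<lambda>t. D i js (axis_path j \<theta>0 \<eta>' t) y) \<in> borel_measurable (remainder_measure m)"
      "(\<lambda>t. D i js (axis_path j \<theta>0 (\<eta> a) t) y) \<in> borel_measurable (remainder_measure m)" for a
      by (rule m[OF \<eta>(2)], rule m[OF \<eta>(1)])
    show "AE t in remainder_measure m. norm (D i js (axis_path j \<theta>0 (\<eta> a) t) y) \<le> b" for a
      using bb by simp
  qed simp
qed

lemma taylor_D:
  assumes i: "1 \<le> i" and js: "1 \<le> m + length js" "m + length js \<le> k0" and path: "\<And>t. axis_path j \<theta> \<eta> t \<in> B"
  shows "D i js \<eta> y = (\<Sum>l<m. (\<eta> $ j - \<theta> $ j) ^ l * D i (replicate l j @ js) (axis_path j \<theta> \<eta> 0) y / fact l)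
    + (\<eta> $ j - \<theta> $ j) ^ m * avg i (replicate m j @ js) m j \<theta> \<eta> y / fact m"
proof -
  define h where "h = \<eta> $ j - \<theta> $ j"
  \<comment> \<open>The l-th derivative along the path; each differentiation contributes the speed
    \<open>h\<close>.\<close>
  define \<phi> where "\<phi> l t = h ^ l * D i (replicate l j @ js) (axis_path j \<theta> \<eta> t) y" for l t
  have "\<phi> 0 1 = (\<Sum>l<m. \<phi> l 0 / fact l) + (\<integral>t. \<phi> m (clamp01 t) \<partial>remainder_measure m) / fact m"
  proof (rule taylor_remainder)
    fix l t assume l: "l < m" and t: "0 \<le> t" "t \<le> (1::real)"
    have pt: "axis_path j \<theta> \<eta> s = \<eta> + (- (1 - s) * h) *\<^sub>R axis j 1" if "s \<in> {0..1}" for s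
      using that by (simp add: axis_path_def h_def)
    have "((\<lambda>s. D i (replicate l j @ js) (\<eta> + s *\<^sub>R axis j 1) y) has_real_derivative
        D i (j # replicate l j @ js) (\<eta> + (- (1 - t) * h) *\<^sub>R axis j 1) y) (at (- (1 - t) * h))"
      using path[of t] t l js by (intro D_derivative i) (auto simp: pt)
    moreover have "((\<lambda>s. - (1 - s) * h) has_real_derivative h) (at t within {0..1})"
      by (auto intro!: derivative_eq_intros)
    ultimately have "((\<lambda>s. D i (replicate l j @ js) (\<eta> + (- (1 - s) * h) *\<^sub>R axis j 1) y) has_real_derivative
        D i (j # replicate l j @ js) (\<eta> + (- (1 - t) * h) *\<^sub>R axis j 1) y * h) (at t within {0..1})"
      by (rule DERIV_chain2)
    from DERIV_cmult[OF this, of "h ^ l"]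
    have "((\<lambda>s. h ^ l * D i (replicate l j @ js) (\<eta> + (- (1 - s) * h) *\<^sub>R axis j 1) y) has_real_derivative
        \<phi> (Suc l) t) (at t within {0..1})"
      using t by (simp add: \<phi>_def pt mult_ac)
    then show "(\<phi> l has_real_derivative \<phi> (Suc l) t) (at t within {0..1})"
      by (rule has_field_derivative_transform_within[OF _ zero_less_one]) (use t in \<open>auto simp: \<phi>_def pt\<close>)
  next
    show "continuous_on {0..1} (\<phi> m)"
      unfolding \<phi>_def using js by (intro continuous_intros D_path_continuous i path) auto
  qed
  then show ?thesis by (simp add: \<phi>_def avg_def h_def)
qed

text \<open>The difference quotients of the density along the axis, taken at parameters of \<Theta>,
  have integral 0, and the limit may be taken under the integral. They are dominated by the averaged
  partial derivative of the log-density times the sum of two densities.\<close>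

lemma expectation_difference_quotient:
  assumes i: "1 \<le> i" and \<eta>: "\<eta> \<in> B \<inter> \<Theta>"
    and lp: "\<eta> islimpt (\<Theta> \<inter> range (\<lambda>t. \<eta> + t *\<^sub>R axis j 1))"
  shows "(\<integral>y. D i [j] \<eta> y \<partial>P i \<eta>) = 0"
proof -
  obtain z where z: "\<And>a. z a \<in> \<Theta> \<inter> range (\<lambda>t. \<eta> + t *\<^sub>R axis j 1) - {\<eta>}" "z \<longlonglongrightarrow> \<eta>"
    using lp unfolding islimpt_sequential by blast
  have "\<forall>\<^sub>F a in sequentially. z a \<in> B" using z(2) \<eta> by (intro topological_tendstoD) auto
  then obtain a0 where a0: "\<And>a. a0 \<le> a \<Longrightarrow> z a \<in> B" by (auto simp: eventually_sequentially)
  define x where "x a = z (a + a0)" for a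
  have x: "x a \<in> B \<inter> \<Theta>" "x a \<noteq> \<eta>" "x a \<in> range (\<lambda>t. \<eta> + t *\<^sub>R axis j 1)" for a
    using z(1)[of "a + a0"] a0[of "a + a0"] by (auto simp: x_def)
  have xl: "x \<longlonglongrightarrow> \<eta>" unfolding x_def using z(2) by (rule LIMSEQ_ignore_initial_segment)
  define t where "t a = x a $ j - \<eta> $ j" for a
  have xt: "x a = \<eta> + t a *\<^sub>R axis j 1" for a
    using x(3)[of a] by (auto simp: t_def)
  have t0: "t a \<noteq> 0" for a using x(2)[of a] by (subst (asm) xt) auto
  have tl: "t \<longlonglongrightarrow> 0"
    unfolding t_def using tendsto_diff[OF tendsto_vec_nth[OF xl] tendsto_const, of j "\<eta> $ j"] by simp
  \<comment> \<open>The segment may leave \<Theta> but not the convex ball, to which the derivatives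
    of \<open>L\<close> extend.\<close>
  have path: "axis_path j \<eta> (x a) s \<in> B" for a s
  proof -
    have "axis_path j \<eta> (x a) s = (1 - clamp01 s) *\<^sub>R \<eta> + clamp01 s *\<^sub>R x a"
      unfolding xt axis_path_line by (simp add: algebra_simps)
    then show ?thesis using x(1)[of a] \<eta> convexD_alt[OF convex_ball, of \<eta> \<theta>0 \<rho>0 "x a" "clamp01 s"] by simp
  qed
  have \<eta>T: "\<eta> \<in> \<Theta>" "x a \<in> \<Theta>" for a using \<eta> x(1)[of a] by auto
  note [measurable] = f_measurable[OF i \<eta>T(1)] f_measurable[OF i \<eta>T(2)] S_sets[OF i]
  have js: "1 \<le> length [j]" "length [j] \<le> k0" using k0 by auto
  have Dm[measurable]: "D i [j] \<eta> \<in> borel_measurable (\<gamma> i)" using D_measurable[OF i js] \<eta> by auto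
  define A where "A a = avg i [j] 1 j \<eta> (x a)" for a
  have Am[measurable]: "A a \<in> borel_measurable (\<gamma> i)" for a
    unfolding A_def by (rule avg_moment(1)[OF i js path])
  have quot: "D i [] (x a) y - D i [] \<eta> y = t a * A a y" for a y
  proof -
    have "D i [] (x a) y = (\<Sum>l<1. (x a $ j - \<eta> $ j) ^ l * D i (replicate l j @ []) (axis_path j \<eta> (x a) 0) y / fact l)
        + (x a $ j - \<eta> $ j) ^ 1 * avg i (replicate 1 j @ []) 1 j \<eta> (x a) y / fact 1"
      by (rule taylor_D[OF i _ _ path]) (use k0 in auto)
    moreover have "axis_path j \<eta> (x a) 0 = \<eta>"
      by (subst xt) (simp add: axis_path_line)
    ultimately show ?thesis unfolding A_def t_def by simp
  qed
  have LD: "L i \<zeta> y = D i [] \<zeta> y" if "y \<in> S i" for y \<zeta> using that by (simp add: D_def partials_def)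
  have fe: "f i \<zeta> y = exp (D i [] \<zeta> y)" if "y \<in> S i" "\<zeta> \<in> B \<inter> \<Theta>" for y \<zeta>
  proof -
    have "0 < f i \<zeta> y" "D i [] \<zeta> y = ln (f i \<zeta> y)" using S_pos[OF i that] LD[OF that(1), of \<zeta>] by auto
    then show ?thesis by (simp only: exp_ln)
  qed
  define r where "r a y = indicator (S i) y * ((f i (x a) y - f i \<eta> y) / t a)" for a y
  define w where "w a y = indicator (S i) y * f i (x a) y + indicator (S i) y * f i \<eta> y" for a y
  define w0 where "w0 y = indicator (S i) y * f i \<eta> y + indicator (S i) y * f i \<eta> y" for y
  have Al: "(\<lambda>a. A a y) \<longlonglongrightarrow> D i [j] \<eta> y" for y
  proof -
    have "((\<lambda>s. D i [] (\<eta> + s *\<^sub>R axis j 1) y) has_real_derivative D i [j] (\<eta> + 0 *\<^sub>R axis j 1) y) (at 0)"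
      using \<eta> k0 by (intro D_derivative i) auto
    then have "((\<lambda>s. (D i [] (\<eta> + s *\<^sub>R axis j 1) y - D i [] \<eta> y) / s) \<longlongrightarrow> D i [j] \<eta> y) (at 0)"
      by (simp add: DERIV_def)
    then have "(\<lambda>a. (D i [] (\<eta> + t a *\<^sub>R axis j 1) y - D i [] \<eta> y) / t a) \<longlonglongrightarrow> D i [j] \<eta> y"
      by (rule filterlim_compose) (use tl t0 in \<open>auto simp: filterlim_at\<close>)
    then show ?thesis using quot t0 by (simp add: xt[symmetric])
  qed
  have rl: "(\<lambda>a. r a y) \<longlonglongrightarrow> indicator (S i) y * (D i [j] \<eta> y * f i \<eta> y)" for y
  proof (cases "y \<in> S i")
    case True
    have "((\<lambda>s. exp (D i [] (\<eta> + s *\<^sub>R axis j 1) y)) has_real_derivative exp (D i [] (\<eta> + 0 *\<^sub>R axis j 1) y) * D i [j] (\<eta> + 0 *\<^sub>R axis j 1) y) (at 0)"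
      using \<eta> k0 by (intro DERIV_fun_exp D_derivative i) auto
    then have "((\<lambda>s. (exp (D i [] (\<eta> + s *\<^sub>R axis j 1) y) - exp (D i [] \<eta> y)) / s) \<longlongrightarrow> exp (D i [] \<eta> y) * D i [j] \<eta> y) (at 0)"
      by (simp add: DERIV_def)
    then have "(\<lambda>a. (exp (D i [] (\<eta> + t a *\<^sub>R axis j 1) y) - exp (D i [] \<eta> y)) / t a) \<longlonglongrightarrow> exp (D i [] \<eta> y) * D i [j] \<eta> y"
      by (rule filterlim_compose) (use tl t0 in \<open>auto simp: filterlim_at\<close>)
    then show ?thesis using fe[OF True \<eta>] fe[OF True x(1)] True by (simp add: xt[symmetric] r_def mult.commute)
  qed (simp add: r_def)
  have wl: "(\<lambda>a. w a y) \<longlonglongrightarrow> w0 y" for y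
  proof (cases "y \<in> S i")
    case True
    have "(\<lambda>a. f i (x a) y) \<longlonglongrightarrow> f i \<eta> y"
      using f_continuous[OF i True] \<eta> x(1) xl unfolding continuous_on_sequentially o_def by blast
    from tendsto_add[OF this tendsto_const, of "f i \<eta> y"] True show ?thesis by (simp add: w_def w0_def)
  qed (simp add: w_def w0_def)
  have dom: "\<bar>r a y\<bar> \<le> \<bar>A a y\<bar> * w a y" for a y
  proof (cases "y \<in> S i")
    case True
    \<comment> \<open>Densities are exponentials of \<open>L\<close>; this turns a difference
      quotient of \<open>L\<close> into a domination of that of the density by the weight
      \<open>w\<close>.\<close>
    have exp_diff: "\<bar>exp u - exp v\<bar> \<le> \<bar>u - v\<bar> * (exp u + exp v)" for u v :: real
    proof -
      have *: "exp u - exp v \<le> (u - v) * (exp u + exp v)" if "v \<le> u" for u v :: real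
      proof -
        have "exp u * (1 + (v - u)) \<le> exp u * exp (v - u)" by (intro mult_left_mono exp_ge_add_one_self) auto
        then have "exp u - exp v \<le> (u - v) * exp u" by (simp add: exp_diff algebra_simps)
        also have "\<dots> \<le> (u - v) * (exp u + exp v)" using that by (intro mult_left_mono) auto
        finally show ?thesis .
      qed
      show ?thesis using *[of u v] *[of v u] by (cases "v \<le> u") (auto simp: abs_if algebra_simps)
    qed
    have "\<bar>f i (x a) y - f i \<eta> y\<bar> \<le> \<bar>t a * A a y\<bar> * (f i (x a) y + f i \<eta> y)"
      using exp_diff[of "D i [] (x a) y" "D i [] \<eta> y"] by (simp only: fe[OF True x(1)] fe[OF True \<eta>] quot)
    then have "\<bar>f i (x a) y - f i \<eta> y\<bar> / \<bar>t a\<bar> \<le> \<bar>A a y\<bar> * (f i (x a) y + f i \<eta> y)"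
      using t0[of a] by (simp add: field_simps abs_mult)
    then show ?thesis using True by (simp add: r_def w_def)
  qed (simp add: r_def w_def)
  have ind0: "0 \<le> indicator (S i) y * f i \<zeta> y" if "\<zeta> \<in> B \<inter> \<Theta>" for y \<zeta>
    using S_pos[OF i _ that, of y] by (auto simp: indicator_def less_imp_le)
  have w_nonneg: "0 \<le> w a y" for a y using ind0[OF \<eta>] ind0[OF x(1)] by (simp add: w_def)
  have meas[measurable]: "r a \<in> borel_measurable (\<gamma> i)" "w a \<in> borel_measurable (\<gamma> i)" "w0 \<in> borel_measurable (\<gamma> i)" for a
    unfolding r_def w_def w0_def by measurable
  have wi: "integrable (\<gamma> i) (w a)" "integrable (\<gamma> i) w0" "(\<integral>y. w a y \<partial>\<gamma> i) = 2" "(\<integral>y. w0 y \<partial>\<gamma> i) = 2" for a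
    unfolding w_def w0_def using law_S(1,2)[OF i \<eta>T(1)] law_S(1,2)[OF i \<eta>T(2)[of a]] by simp_all
  define C where "C = 2 powr p * (1 + K)"
  have C0: "0 \<le> C" using K by (simp add: C_def)
  \<comment> \<open>The weight mixes the laws at \<open>x a\<close> and at \<eta>, while the
    derivative is evaluated on the segment between them. The moment condition covers this because it
    lets the law and the point of evaluation vary separately.\<close>
  have mom: "(\<integral>\<^sup>+y. ennreal (\<bar>A a y\<bar> powr p * w a y) \<partial>\<gamma> i) \<le> ennreal (C + C)" for a
  proof -
    have 1: "(\<integral>\<^sup>+y. ennreal (\<bar>A a y\<bar> powr p * (indicator (S i) y * f i \<zeta> y)) \<partial>\<gamma> i) \<le> ennreal C" if "\<zeta> \<in> B \<inter> \<Theta>" for \<zeta>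
    proof -
      have "(\<integral>\<^sup>+y. ennreal (\<bar>A a y\<bar> powr p) \<partial>P i \<zeta>) \<le> ennreal C"
        unfolding A_def C_def by (rule avg_moment(2)[OF i js path that])
      moreover have "(\<integral>\<^sup>+y. ennreal (\<bar>A a y\<bar> powr p) \<partial>P i \<zeta>)
          = (\<integral>\<^sup>+y. ennreal (\<bar>A a y\<bar> powr p * (indicator (S i) y * f i \<zeta> y)) \<partial>\<gamma> i)"
        using that by (intro law_S(5)[OF i]) auto
      ultimately show ?thesis by (simp only:)
    qed
    have "(\<integral>\<^sup>+y. ennreal (\<bar>A a y\<bar> powr p * w a y) \<partial>\<gamma> i)
      = (\<integral>\<^sup>+y. ennreal (\<bar>A a y\<bar> powr p * (indicator (S i) y * f i (x a) y))
          + ennreal (\<bar>A a y\<bar> powr p * (indicator (S i) y * f i \<eta> y)) \<partial>\<gamma> i)"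
      using ind0[OF \<eta>] ind0[OF x(1)]
      by (intro nn_integral_cong) (simp add: w_def distrib_left ennreal_plus)
    also have "\<dots> \<le> ennreal C + ennreal C"
      using 1[OF x(1)[of a]] 1[OF \<eta>] by (subst nn_integral_add) (auto intro!: add_mono)
    finally show ?thesis unfolding ennreal_plus[OF C0 C0] .
  qed
  have p1: "1 < p" using p by simp
  have w2: "(\<lambda>a. \<integral>y. w a y \<partial>\<gamma> i) \<longlonglongrightarrow> (\<integral>y. w0 y \<partial>\<gamma> i)" by (simp add: wi(3,4))
  have r0m: "(\<lambda>y. indicator (S i) y * (D i [j] \<eta> y * f i \<eta> y)) \<in> borel_measurable (\<gamma> i)" by measurable
  note V = integral_convergence_weighted[OF meas(1) Am meas(2) r0m Dm meas(3) AE_I2[OF rl] AE_I2[OF Al] AE_I2[OF wl]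
      AE_I2[OF dom] AE_I2[OF w_nonneg] wi(1,2) w2 p1 mom]
  have r_int: "(\<integral>y. r a y \<partial>\<gamma> i) = 0" for a
  proof -
    have "(\<integral>y. r a y \<partial>\<gamma> i) = (\<integral>y. (indicator (S i) y * f i (x a) y - indicator (S i) y * f i \<eta> y) / t a \<partial>\<gamma> i)"
      by (intro Bochner_Integration.integral_cong) (auto simp: r_def algebra_simps diff_divide_distrib)
    also have "\<dots> = 0" using law_S(1,2)[OF i \<eta>T(1)] law_S(1,2)[OF i \<eta>T(2)[of a]] by simp
    finally show ?thesis .
  qed
  have "(\<lambda>a::nat. 0) \<longlonglongrightarrow> (\<integral>y. indicator (S i) y * (D i [j] \<eta> y * f i \<eta> y) \<partial>\<gamma> i)"
    using V(3) by (simp add: r_int)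
  then have "(\<integral>y. indicator (S i) y * (D i [j] \<eta> y * f i \<eta> y) \<partial>\<gamma> i) = 0"
    by (rule LIMSEQ_unique[OF _ tendsto_const])
  then show ?thesis using law_S(4)[OF i \<eta>T(1) Dm] by simp
qed

text \<open>Bartlett's first identity. At the points where \<open>\<Theta>\<close> has limit points along all axes it comes from
  differentiating $\int f_\theta\,d\gamma = 1$; these points are dense.\<close>

lemma score_mean_zero:
  assumes i: "1 \<le> i" and \<eta>: "\<eta> \<in> B \<inter> \<Theta>"
  shows "(\<integral>y. D i [j] \<eta> y \<partial>P i \<eta>) = 0"
proof -
  have js: "1 \<le> length [j]" "length [j] \<le> k0" using k0 by auto
  have "\<eta> \<in> closure {\<theta> \<in> \<Theta>. \<forall>j. \<theta> islimpt (\<Theta> \<inter> range (\<lambda>t. \<theta> + t *\<^sub>R axis j 1))}"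
    using determined \<eta> by (auto simp: partials_determined_def)
  then obtain z where z: "\<And>a. z a \<in> \<Theta>" "\<And>a j. z a islimpt (\<Theta> \<inter> range (\<lambda>t. z a + t *\<^sub>R axis j 1))" "z \<longlonglongrightarrow> \<eta>"
    unfolding closure_sequential by auto
  have "\<forall>\<^sub>F a in sequentially. z a \<in> B" using z(3) \<eta> by (intro topological_tendstoD) auto
  then obtain a0 where a0: "\<And>a. a0 \<le> a \<Longrightarrow> z a \<in> B" by (auto simp: eventually_sequentially)
  define x where "x a = z (a + a0)" for a
  have x: "x a \<in> B \<inter> \<Theta>" for a using z(1)[of "a + a0"] a0[of "a + a0"] by (auto simp: x_def)
  have xl: "x \<longlonglongrightarrow> \<eta>" unfolding x_def using z(3) by (rule LIMSEQ_ignore_initial_segment)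
  have 0: "(\<integral>y. D i [j] (x a) y \<partial>P i (x a)) = 0" for a
    using expectation_difference_quotient[OF i x z(2)[of "a + a0", folded x_def]] .
  have lim: "(\<lambda>a. D i [j] (x a) y) \<longlonglongrightarrow> D i [j] \<eta> y" for y
    using D_continuous[OF i js, of y] x xl \<eta> unfolding continuous_on_sequentially o_def by blast
  have "(\<lambda>a. \<integral>y. D i [j] (x a) y \<partial>P i (x a)) \<longlonglongrightarrow> (\<integral>y. D i [j] \<eta> y \<partial>P i \<eta>)"
  proof (rule expectation_tendsto(3)[OF i x \<eta> xl])
    show "D i [j] (x a) \<in> borel_measurable (\<gamma> i)" "D i [j] \<eta> \<in> borel_measurable (\<gamma> i)" for a
      using D_measurable[OF i js] x[of a] \<eta> by auto
    show "(\<integral>\<^sup>+y. ennreal (\<bar>D i [j] (x a) y\<bar> powr p) \<partial>P i (x a)) \<le> ennreal K" for a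
      using x[of a] js by (intro D_moment i) auto
  qed (use lim p in auto)
  then show ?thesis unfolding 0 by (rule LIMSEQ_unique[OF _ tendsto_const])
qed

end

section \<open>Covariance matrices\<close>

text \<open>The scores and the statistic involve \<open>deriv\<close> and \<open>Lim\<close>, whose
  values on exceptional data are arbitrary. They agree almost surely with measurable functions, and
  subsets of null sets are measurable in the completion.\<close>

lemma borel_measurable_completion_AE_eq:
  fixes g :: "'a \<Rightarrow> 'b :: topological_space"
  assumes g0: "g0 \<in> borel_measurable N" and eq: "AE x in N. g x = g0 x"
  shows "g \<in> borel_measurable (completion N)"
proof (rule measurableI)
  fix A :: "'b set" assume A: "A \<in> sets borel"
  obtain Z where Z: "{x \<in> space N. \<not> g x = g0 x} \<subseteq> Z" "emeasure N Z = 0" "Z \<in> sets N"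
    using eq by (rule AE_E)
  have ZN: "Z \<in> null_sets (completion N)" using Z by (auto intro: null_sets_completionI)
  have "g0 -` A \<inter> space N - Z \<in> sets (completion N)"
    using measurable_sets[OF g0 A] Z(3) by (intro sets_completionI_sets) auto
  moreover have "g -` A \<inter> space N \<inter> Z \<in> sets (completion N)"
    by (rule null_setsD2[OF null_sets_completion_subset[OF _ ZN]]) auto
  ultimately have "(g0 -` A \<inter> space N - Z) \<union> (g -` A \<inter> space N \<inter> Z) \<in> sets (completion N)"
    by (rule sets.Un)
  also have "(g0 -` A \<inter> space N - Z) \<union> (g -` A \<inter> space N \<inter> Z) = g -` A \<inter> space (completion N)"
    using Z(1) by auto
  finally show "g -` A \<inter> space (completion N) \<in> sets (completion N)" .
qed simp

lemma expect_AE_eq: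
  assumes g0: "g0 \<in> borel_measurable N" and eq: "AE x in N. g x = g0 x"
  shows "expect N g = (\<integral>x. g0 x \<partial>N)"
proof -
  have "expect N g = (\<integral>x. g0 x \<partial>completion N)"
    unfolding expect_def
    by (intro integral_cong_AE borel_measurable_completion_AE_eq[OF assms] measurable_completion g0 AE_completion eq)
  also have "\<dots> = (\<integral>x. g0 x \<partial>N)" using g0 by (rule integral_completion)
  finally show ?thesis .
qed

lemma measure_completion_AE_eq:
  assumes "prob_space N" and g0[measurable]: "g0 \<in> borel_measurable N" and eq: "AE x in N. g x = (g0 x :: real)"
  shows "measure (completion N) {x \<in> space N. g x \<le> q} = measure N {x \<in> space N. g0 x \<le> q}"
proof -
  interpret prob_space N by fact
  interpret C: prob_space "completion N"
    by (intro prob_spaceI) (simp add: emeasure_space_1)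
  have g: "g \<in> borel_measurable (completion N)" using g0 eq by (rule borel_measurable_completion_AE_eq)
  have 1: "{x \<in> space N. g x \<le> q} \<in> sets (completion N)"
    using borel_measurable_le[OF g borel_measurable_const, of q] by simp
  have 2: "{x \<in> space N. g0 x \<le> q} \<in> sets N" by measurable
  have "measure (completion N) {x \<in> space N. g x \<le> q} = measure (completion N) {x \<in> space N. g0 x \<le> q}"
    using AE_completion[OF eq] 1 2 by (intro C.finite_measure_eq_AE) (auto elim!: AE_mp)
  also have "\<dots> = measure N {x \<in> space N. g0 x \<le> q}" using 2 by (rule measure_completion)
  finally show ?thesis .
qed

text \<open>In contrast to \<open>cov_matrix\<close> this uses the uncompleted measure and the
  uncentred formula, so that continuity in the parameter reduces to that of first and second
  moments.\<close>

definition cov :: "'a measure \<Rightarrow> ('a \<Rightarrow> real ^ 'd) \<Rightarrow> real ^ 'd ^ 'd" where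
  "cov N X = (\<chi> a b. (\<integral>w. X w $ a * X w $ b \<partial>N) - (\<integral>w. X w $ a \<partial>N) * (\<integral>w. X w $ b \<partial>N))"

definition square_integrable :: "'a measure \<Rightarrow> ('a \<Rightarrow> real ^ 'd) \<Rightarrow> bool" where
  "square_integrable N X \<longleftrightarrow> prob_space N \<and> X \<in> borel_measurable N \<and> integrable N (\<lambda>w. (norm (X w))\<^sup>2)"

lemma square_integrable_inner:
  fixes X :: "'a \<Rightarrow> real ^ 'd"
  assumes "square_integrable N X"
  shows "integrable N (\<lambda>w. u \<bullet> X w)" "integrable N (\<lambda>w. (u \<bullet> X w) * (v \<bullet> X w))"
    "integrable N (\<lambda>w. X w $ a)" "integrable N (\<lambda>w. X w $ a * X w $ b)"
proof -
  interpret prob_space N using assms by (simp add: square_integrable_def)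
  have [measurable]: "X \<in> borel_measurable N" and i: "integrable N (\<lambda>w. (norm (X w))\<^sup>2)"
    using assms by (simp_all add: square_integrable_def)
  have *: "integrable N (\<lambda>w. (u \<bullet> X w) * (v \<bullet> X w))" for u v
  proof (rule Bochner_Integration.integrable_bound[where f="\<lambda>w. (norm u * norm v) * (norm (X w))\<^sup>2"])
    have "\<bar>(u \<bullet> x) * (v \<bullet> x)\<bar> \<le> norm u * norm v * (norm x)\<^sup>2" for x
      using mult_mono[OF Cauchy_Schwarz_ineq2[of u x] Cauchy_Schwarz_ineq2[of v x]]
      by (simp add: abs_mult power2_eq_square mult_ac)
    then show "AE w in N. norm ((u \<bullet> X w) * (v \<bullet> X w)) \<le> norm (norm u * norm v * (norm (X w))\<^sup>2)"
      by (intro AE_I2) (simp add: abs_mult)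
  qed (use i in auto)
  have **: "integrable N (\<lambda>w. u \<bullet> X w)" for u
    by (rule square_integrable_imp_integrable) (use *[of u u] in \<open>simp_all add: power2_eq_square\<close>)
  show "integrable N (\<lambda>w. u \<bullet> X w)" "integrable N (\<lambda>w. (u \<bullet> X w) * (v \<bullet> X w))" by (rule ** *)+
  show "integrable N (\<lambda>w. X w $ a)" "integrable N (\<lambda>w. X w $ a * X w $ b)"
    using **[of "axis a 1"] *[of "axis a 1" "axis b 1"] by (simp_all only: inner_axis' inner_real_def mult_1_left)
qed

lemma cov_inner:
  fixes X :: "'a \<Rightarrow> real ^ 'd"
  assumes X: "square_integrable N X"
  shows "u \<bullet> (cov N X *v v) = (\<integral>w. (u \<bullet> X w) * (v \<bullet> X w) \<partial>N) - (\<integral>w. u \<bullet> X w \<partial>N) * (\<integral>w. v \<bullet> X w \<partial>N)"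
proof -
  note i = square_integrable_inner(3,4)[OF X]
  have e1: "(u \<bullet> X w) * (v \<bullet> X w) = (\<Sum>a\<in>UNIV. \<Sum>b\<in>UNIV. u $ a * v $ b * (X w $ a * X w $ b))" for w
    by (simp add: inner_vec_def sum_product mult_ac)
  have e2: "(\<integral>w. u \<bullet> X w \<partial>N) = (\<Sum>a\<in>UNIV. u $ a * (\<integral>w. X w $ a \<partial>N))" for u
    using i by (simp add: inner_vec_def)
  have "u \<bullet> (cov N X *v v) = (\<Sum>a\<in>UNIV. \<Sum>b\<in>UNIV. u $ a * v $ b * (\<integral>w. X w $ a * X w $ b \<partial>N))
      - (\<Sum>a\<in>UNIV. \<Sum>b\<in>UNIV. (u $ a * (\<integral>w. X w $ a \<partial>N)) * (v $ b * (\<integral>w. X w $ b \<partial>N)))"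
    unfolding sum_subtractf[symmetric]
    by (auto simp: inner_vec_def matrix_vector_mult_def cov_def sum_distrib_left algebra_simps intro!: sum.cong)
  also have "(\<Sum>a\<in>UNIV. \<Sum>b\<in>UNIV. u $ a * v $ b * (\<integral>w. X w $ a * X w $ b \<partial>N)) = (\<integral>w. (u \<bullet> X w) * (v \<bullet> X w) \<partial>N)"
    unfolding e1 using i by simp
  also have "(\<Sum>a\<in>UNIV. \<Sum>b\<in>UNIV. (u $ a * (\<integral>w. X w $ a \<partial>N)) * (v $ b * (\<integral>w. X w $ b \<partial>N)))
      = (\<integral>w. u \<bullet> X w \<partial>N) * (\<integral>w. v \<bullet> X w \<partial>N)"
    unfolding e2 by (simp add: sum_product)
  finally show ?thesis .
qed

lemma cov_sym:
  fixes X :: "'a \<Rightarrow> real ^ 'd"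
  assumes "square_integrable N X"
  shows "u \<bullet> (cov N X *v v) = v \<bullet> (cov N X *v u)"
  unfolding cov_inner[OF assms] by (simp add: mult.commute)

lemma cov_inner_centered:
  fixes X :: "'a \<Rightarrow> real ^ 'd"
  assumes X: "square_integrable N X"
  shows "u \<bullet> (cov N X *v v) = (\<integral>w. (u \<bullet> X w - (\<integral>w. u \<bullet> X w \<partial>N)) * (v \<bullet> X w - (\<integral>w. v \<bullet> X w \<partial>N)) \<partial>N)"
proof -
  interpret prob_space N using X by (simp add: square_integrable_def)
  note i = square_integrable_inner(1,2)[OF X]
  define a b where "a = (\<integral>w. u \<bullet> X w \<partial>N)" and "b = (\<integral>w. v \<bullet> X w \<partial>N)"
  have "(\<integral>w. (u \<bullet> X w - a) * (v \<bullet> X w - b) \<partial>N)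
      = (\<integral>w. (u \<bullet> X w) * (v \<bullet> X w) - b * (u \<bullet> X w) - a * (v \<bullet> X w) + a * b \<partial>N)"
    by (intro Bochner_Integration.integral_cong) (auto simp: algebra_simps)
  also have "\<dots> = (\<integral>w. (u \<bullet> X w) * (v \<bullet> X w) \<partial>N) - b * a - a * b + a * b"
    using i by (simp add: prob_space a_def[symmetric] b_def[symmetric])
  finally show ?thesis unfolding cov_inner[OF X] a_def b_def by simp
qed

lemma cov_nonneg:
  fixes X :: "'a \<Rightarrow> real ^ 'd"
  assumes "square_integrable N X"
  shows "0 \<le> u \<bullet> (cov N X *v u)"
  unfolding cov_inner_centered[OF assms] by (intro integral_nonneg_AE) auto

lemma cov_zero_imp_const:
  fixes X :: "'a \<Rightarrow> real ^ 'd"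
  assumes X: "square_integrable N X" and 0: "u \<bullet> (cov N X *v u) = 0"
  shows "AE w in N. u \<bullet> X w = (\<integral>w. u \<bullet> X w \<partial>N)"
proof -
  interpret prob_space N using X by (simp add: square_integrable_def)
  define a where "a = (\<integral>w. u \<bullet> X w \<partial>N)"
  have "(\<lambda>w. (u \<bullet> X w - a) * (u \<bullet> X w - a)) = (\<lambda>w. (u \<bullet> X w) * (u \<bullet> X w) - a * (u \<bullet> X w) - a * (u \<bullet> X w) + a * a)"
    by (auto simp: algebra_simps)
  then have "integrable N (\<lambda>w. (u \<bullet> X w - a) * (u \<bullet> X w - a))"
    using square_integrable_inner(1,2)[OF X] by simp
  then have "AE w in N. (u \<bullet> X w - a) * (u \<bullet> X w - a) = 0"
    using 0 unfolding cov_inner_centered[OF X] a_def[symmetric]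
    by (subst (asm) integral_nonneg_eq_0_iff_AE) auto
  then show ?thesis unfolding a_def by eventually_elim simp
qed

text \<open>A deterministic shift leaves covariances unchanged. Applied to the scores, this removes
  the constants of the score decomposition and yields the factorization of the information.\<close>

lemma cov_affine:
  fixes X :: "'a \<Rightarrow> real ^ 'd" and G :: "'a \<Rightarrow> real ^ 'e"
  assumes X: "square_integrable N X" and G: "square_integrable N G"
    and eq: "\<And>u. AE w in N. u \<bullet> X w = c u + T u \<bullet> G w"
  shows "u \<bullet> (cov N X *v v) = T u \<bullet> (cov N G *v T v)"
proof -
  interpret prob_space N using X by (simp add: square_integrable_def)
  have [measurable]: "X \<in> borel_measurable N" "G \<in> borel_measurable N"
    using X G by (simp_all add: square_integrable_def)
  have E: "(\<integral>w. u \<bullet> X w \<partial>N) = c u + (\<integral>w. T u \<bullet> G w \<partial>N)" for u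
  proof -
    have "(\<integral>w. u \<bullet> X w \<partial>N) = (\<integral>w. c u + T u \<bullet> G w \<partial>N)" using eq by (intro integral_cong_AE) auto
    also have "\<dots> = c u + (\<integral>w. T u \<bullet> G w \<partial>N)"
      using square_integrable_inner(1)[OF G] by (simp add: prob_space)
    finally show ?thesis .
  qed
  show ?thesis
    unfolding cov_inner_centered[OF X] cov_inner_centered[OF G]
  proof (rule integral_cong_AE)
    show "AE w in N. (u \<bullet> X w - (\<integral>w. u \<bullet> X w \<partial>N)) * (v \<bullet> X w - (\<integral>w. v \<bullet> X w \<partial>N))
        = (T u \<bullet> G w - (\<integral>w. T u \<bullet> G w \<partial>N)) * (T v \<bullet> G w - (\<integral>w. T v \<bullet> G w \<partial>N))"
      using eq[of u] eq[of v] by eventually_elim (simp add: E)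
  qed auto
qed

lemma cov_matrix_eq_cov:
  fixes X :: "'a \<Rightarrow> real ^ 'd"
  assumes X: "square_integrable N X" and eq: "AE w in N. X' w = X w"
  shows "cov_matrix N X' = cov N X"
proof -
  interpret prob_space N using X by (simp add: square_integrable_def)
  have [measurable]: "X \<in> borel_measurable N" using X by (simp add: square_integrable_def)
  note i = square_integrable_inner(3,4)[OF X]
  note [measurable] = borel_measurable_integrable[OF i(1)]
  have E: "expect N (\<lambda>w. X' w $ a) = (\<integral>w. X w $ a \<partial>N)" for a
    by (rule expect_AE_eq) (use eq in \<open>auto elim!: AE_mp\<close>)
  have "expect N (\<lambda>w. (X' w $ a - expect N (\<lambda>w. X' w $ a)) * (X' w $ b - expect N (\<lambda>w. X' w $ b)))
     = (\<integral>w. X w $ a * X w $ b \<partial>N) - (\<integral>w. X w $ a \<partial>N) * (\<integral>w. X w $ b \<partial>N)" for a b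
  proof -
    define s t where "s = (\<integral>w. X w $ a \<partial>N)" and "t = (\<integral>w. X w $ b \<partial>N)"
    have "expect N (\<lambda>w. (X' w $ a - s) * (X' w $ b - t)) = (\<integral>w. (X w $ a - s) * (X w $ b - t) \<partial>N)"
      by (rule expect_AE_eq) (use eq in \<open>auto elim!: AE_mp\<close>)
    also have "\<dots> = (\<integral>w. X w $ a * X w $ b - t * X w $ a - s * X w $ b + s * t \<partial>N)"
      by (intro Bochner_Integration.integral_cong) (auto simp: algebra_simps)
    also have "\<dots> = (\<integral>w. X w $ a * X w $ b \<partial>N) - t * s - s * t + s * t"
      using i by (simp add: prob_space s_def[symmetric] t_def[symmetric])
    finally show ?thesis unfolding E s_def t_def by simp
  qed
  then show ?thesis by (simp add: cov_matrix_def cov_def)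
qed

lemma square_integrable_distr:
  fixes X :: "'b \<Rightarrow> real ^ 'd"
  assumes "prob_space N" and T: "T \<in> measurable N N'"
    and X: "square_integrable (distr N N' T) X"
  shows "square_integrable N (\<lambda>w. X (T w))" "cov N (\<lambda>w. X (T w)) = cov (distr N N' T) X"
proof -
  have Xm[measurable]: "X \<in> borel_measurable N'" using X by (simp add: square_integrable_def)
  note T[measurable]
  show "square_integrable N (\<lambda>w. X (T w))"
    using X \<open>prob_space N\<close> by (simp add: square_integrable_def integrable_distr_eq)
  have [measurable]: "(\<lambda>x. X x $ a) \<in> borel_measurable N'" for a
    using borel_measurable_integrable[OF square_integrable_inner(3)[OF X]] by simp
  show "cov N (\<lambda>w. X (T w)) = cov (distr N N' T) X"
    by (simp add: cov_def integral_distr)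
qed

lemma indep_cov_sum:
  fixes X :: "'i \<Rightarrow> 'a \<Rightarrow> real ^ 'd"
  assumes "prob_space N" and ind: "prob_space.indep_vars N (\<lambda>_. borel) X I" and fin: "finite I"
    and X: "\<And>i. i \<in> I \<Longrightarrow> square_integrable N (X i)"
  shows "square_integrable N (\<lambda>w. \<Sum>i\<in>I. X i w)" "cov N (\<lambda>w. \<Sum>i\<in>I. X i w) = (\<Sum>i\<in>I. cov N (X i))"
proof -
  interpret prob_space N by fact
  have Xm[measurable]: "X i \<in> borel_measurable N" if "i \<in> I" for i
    using X[OF that] by (simp add: square_integrable_def)
  have i1: "integrable N (\<lambda>w. X i w $ a)" "integrable N (\<lambda>w. X i w $ a * X i w $ b)" if "i \<in> I" for i a b
    using square_integrable_inner(3,4)[OF X[OF that]] by auto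
  have i2: "integrable N (\<lambda>w. X i w $ a * X k w $ b) \<and>
      (\<integral>w. X i w $ a * X k w $ b \<partial>N) = (\<integral>w. X i w $ a \<partial>N) * (\<integral>w. X k w $ b \<partial>N)"
    if ik: "i \<in> I" "k \<in> I" "i \<noteq> k" for i k a b
  proof -
    \<comment> \<open>Component a of \<open>X i\<close> and component b of \<open>X k\<close> as a
      single family of independent real variables indexed by {i, k}.\<close>
    define Z where "Z l w = (if l = i then X l w $ a else X l w $ b)" for l w
    have indZ: "indep_vars (\<lambda>_. borel) Z {i, k}"
      unfolding Z_def
      by (rule indep_vars_compose2[where Y="\<lambda>l x. if l = i then x $ a else x $ b", OF indep_vars_subset[OF ind]])
        (use ik in auto)
    have iZ: "l \<in> {i, k} \<Longrightarrow> integrable N (Z l)" for l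
      using i1(1)[OF ik(1)] i1(1)[OF ik(2)] ik(3) by (auto simp: Z_def[abs_def])
    show ?thesis
      using indep_vars_lebesgue_integral[OF _ indZ iZ] indep_vars_integrable[OF _ indZ iZ] ik
      by (simp add: Z_def)
  qed
  have i3: "integrable N (\<lambda>w. X i w $ a * X k w $ b)" if "i \<in> I" "k \<in> I" for i k a b
    using i1(2)[OF that(1)] i2[OF that] by (cases "i = k") auto
  have sq: "(norm (\<Sum>i\<in>I. X i w))\<^sup>2 = (\<Sum>a\<in>UNIV. \<Sum>i\<in>I. \<Sum>k\<in>I. X i w $ a * X k w $ a)" for w
    by (simp add: power2_norm_eq_inner inner_vec_def sum_product)
  show "square_integrable N (\<lambda>w. \<Sum>i\<in>I. X i w)"
    unfolding square_integrable_def sq using i3 prob_space_axioms by auto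
  have "(\<integral>w. (\<Sum>i\<in>I. X i w) $ a * (\<Sum>i\<in>I. X i w) $ b \<partial>N) - (\<integral>w. (\<Sum>i\<in>I. X i w) $ a \<partial>N) * (\<integral>w. (\<Sum>i\<in>I. X i w) $ b \<partial>N)
    = (\<Sum>i\<in>I. (\<integral>w. X i w $ a * X i w $ b \<partial>N) - (\<integral>w. X i w $ a \<partial>N) * (\<integral>w. X i w $ b \<partial>N))" for a b
  proof -
    have "(\<integral>w. (\<Sum>i\<in>I. X i w) $ a * (\<Sum>i\<in>I. X i w) $ b \<partial>N) = (\<Sum>i\<in>I. \<Sum>k\<in>I. \<integral>w. X i w $ a * X k w $ b \<partial>N)"
      using i3 by (simp add: sum_product)
    moreover have "(\<integral>w. (\<Sum>i\<in>I. X i w) $ a \<partial>N) * (\<integral>w. (\<Sum>i\<in>I. X i w) $ b \<partial>N)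
        = (\<Sum>i\<in>I. \<Sum>k\<in>I. (\<integral>w. X i w $ a \<partial>N) * (\<integral>w. X k w $ b \<partial>N))"
      using i1 by (simp add: sum_product)
    ultimately have "(\<integral>w. (\<Sum>i\<in>I. X i w) $ a * (\<Sum>i\<in>I. X i w) $ b \<partial>N) - (\<integral>w. (\<Sum>i\<in>I. X i w) $ a \<partial>N) * (\<integral>w. (\<Sum>i\<in>I. X i w) $ b \<partial>N)
      = (\<Sum>i\<in>I. \<Sum>k\<in>I. (\<integral>w. X i w $ a * X k w $ b \<partial>N) - (\<integral>w. X i w $ a \<partial>N) * (\<integral>w. X k w $ b \<partial>N))"
      by (simp add: sum_subtractf)
    also have "\<dots> = (\<Sum>i\<in>I. \<Sum>k\<in>I. if k = i then (\<integral>w. X i w $ a * X i w $ b \<partial>N) - (\<integral>w. X i w $ a \<partial>N) * (\<integral>w. X i w $ b \<partial>N) else 0)"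
      using i2 by (intro sum.cong refl) auto
    finally show ?thesis using fin by simp
  qed
  then show "cov N (\<lambda>w. \<Sum>i\<in>I. X i w) = (\<Sum>i\<in>I. cov N (X i))"
    by (simp add: cov_def vec_eq_iff)
qed

section \<open>Factorization of the score\<close>

lemma borel_measurable_vec_componentwise:
  fixes f :: "'a \<Rightarrow> real ^ 'd"
  assumes "\<And>a. (\<lambda>x. f x $ a) \<in> borel_measurable N"
  shows "f \<in> borel_measurable N"
proof (subst borel_measurable_euclidean_space, intro ballI)
  fix b :: "real ^ 'd" assume "b \<in> Basis"
  then obtain a where "b = axis a 1" by (auto simp: Basis_vec_def)
  then show "(\<lambda>x. f x \<bullet> b) \<in> borel_measurable N" using assms by (simp add: inner_axis)
qed

lemma sum_matrix_vector:
  fixes A :: "'i \<Rightarrow> real ^ 'd ^ 'd"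
  shows "(\<Sum>i\<in>I. A i) *v u = (\<Sum>i\<in>I. A i *v u)"
  by (induction I rule: infinite_finite_induct) (simp_all add: matrix_vector_mult_add_rdistrib)

context parameter_center
begin

lemma law_distr: "1 \<le> i \<Longrightarrow> \<eta> \<in> \<Theta> \<Longrightarrow> P i \<eta> = distr (M \<eta>) (\<gamma> i) (Y i)"
  by (rule Y_distr[symmetric])

lemma indep_transformed:
  assumes \<eta>: "\<eta> \<in> \<Theta>" and g: "\<And>i. i \<in> {1..n} \<Longrightarrow> g i \<in> measurable (\<gamma> i) N"
  shows "prob_space.indep_vars (M \<eta>) (\<lambda>_. N) (\<lambda>i w. g i (Y i w)) {1..n}"
  by (rule prob_space.indep_vars_compose2[OF prob_M[OF \<eta>] prob_space.indep_vars_subset[OF prob_M[OF \<eta>] Y_indep[OF \<eta>]]])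
    (use g in auto)

lemma square_integrable_Y:
  assumes "1 \<le> i" "\<eta> \<in> \<Theta>" and g: "square_integrable (P i \<eta>) g"
  shows "square_integrable (M \<eta>) (\<lambda>w. g (Y i w))" "cov (M \<eta>) (\<lambda>w. g (Y i w)) = cov (P i \<eta>) g"
  using square_integrable_distr[OF prob_M[OF assms(2)] Y_measurable[OF assms(1,2)], of g] g
  unfolding law_distr[OF assms(1,2)] by auto

lemma sum_cov:
  assumes \<eta>: "\<eta> \<in> \<Theta>" and g: "\<And>i. i \<in> {1..n} \<Longrightarrow> square_integrable (P i \<eta>) (g i)"
  shows "square_integrable (M \<eta>) (\<lambda>w. \<Sum>i=1..n. g i (Y i w))"
    "cov (M \<eta>) (\<lambda>w. \<Sum>i=1..n. g i (Y i w)) = (\<Sum>i=1..n. cov (P i \<eta>) (g i))"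
proof -
  have gm: "g i \<in> borel_measurable (\<gamma> i)" if "i \<in> {1..n}" for i
    using g[OF that] by (simp add: square_integrable_def cong: measurable_cong_sets)
  have sq: "square_integrable (M \<eta>) (\<lambda>w. g i (Y i w))" "cov (M \<eta>) (\<lambda>w. g i (Y i w)) = cov (P i \<eta>) (g i)"
    if "i \<in> {1..n}" for i
    using square_integrable_Y[OF _ \<eta> g[OF that]] that by auto
  note A = indep_cov_sum[OF prob_M[OF \<eta>] indep_transformed[OF \<eta> gm] finite_atLeastAtMost sq(1)]
  show "square_integrable (M \<eta>) (\<lambda>w. \<Sum>i=1..n. g i (Y i w))" by (rule A(1))
  show "cov (M \<eta>) (\<lambda>w. \<Sum>i=1..n. g i (Y i w)) = (\<Sum>i=1..n. cov (P i \<eta>) (g i))"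
    by (rule trans[OF A(2)]) (auto intro!: sum.cong sq(2))
qed

lemma square_integrable_moment:
  assumes "1 \<le> i" "\<eta> \<in> \<Theta>" and X: "X \<in> borel_measurable (\<gamma> i)"
    and b: "(\<integral>\<^sup>+y. ennreal (norm (X y :: real ^ 'd) powr p) \<partial>P i \<eta>) \<le> ennreal C"
  shows "square_integrable (P i \<eta>) X" "integrable (P i \<eta>) (\<lambda>y. norm (X y) powr p)"
    "0 \<le> C \<Longrightarrow> (\<integral>y. norm (X y) powr p \<partial>P i \<eta>) \<le> C"
proof -
  interpret prob_space "P i \<eta>" by (rule prob_law[OF assms(1,2)])
  have [measurable]: "X \<in> borel_measurable (P i \<eta>)" using X by (simp cong: measurable_cong_sets)
  show i: "integrable (P i \<eta>) (\<lambda>y. norm (X y) powr p)"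
    using b by (intro integrableI_nonneg) (auto simp: le_less_trans)
  then have "integrable (P i \<eta>) (\<lambda>y. (norm (X y))\<^sup>2)"
    using p by (intro integrable_powr_imp_square(1)[where p=p]) auto
  then show "square_integrable (P i \<eta>) X" by (simp add: square_integrable_def prob_space_axioms)
  show "(\<integral>y. norm (X y) powr p \<partial>P i \<eta>) \<le> C" if "0 \<le> C"
    using b nn_integral_eq_integral[OF i] that by (simp add: ennreal_le_iff)
qed

text \<open>In \<open>partials\<close> the last entry of the list acts first, so component a is the
  l-fold j-derivative of the a-th score component.\<close>

definition dvec :: "nat \<Rightarrow> nat \<Rightarrow> 'd \<Rightarrow> real ^ 'd \<Rightarrow> obs \<Rightarrow> real ^ 'd" where
  "dvec i l j \<eta> y = (\<chi> a. D i (replicate l j @ [a]) \<eta> y)"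

definition sc :: "nat \<Rightarrow> real ^ 'd \<Rightarrow> obs \<Rightarrow> real ^ 'd" where
  "sc i \<eta> y = (\<chi> a. D i [a] \<eta> y)"

lemma sum_abs_moment:
  fixes X :: "'i \<Rightarrow> obs \<Rightarrow> real" and Z :: "obs \<Rightarrow> real ^ 'd"
  assumes "1 \<le> i" "\<eta> \<in> \<Theta>" and fin: "finite I" and le: "\<And>y. norm (Z y) \<le> (\<Sum>a\<in>I. \<bar>X a y\<bar>)"
    and Xm: "\<And>a. a \<in> I \<Longrightarrow> X a \<in> borel_measurable (\<gamma> i)" and C: "0 \<le> C"
    and b: "\<And>a. a \<in> I \<Longrightarrow> (\<integral>\<^sup>+y. ennreal (\<bar>X a y\<bar> powr p) \<partial>P i \<eta>) \<le> ennreal C"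
  shows "(\<integral>\<^sup>+y. ennreal (norm (Z y) powr p) \<partial>P i \<eta>) \<le> ennreal (real (card I) powr p * (real (card I) * C))"
proof -
  have [measurable]: "X a \<in> borel_measurable (P i \<eta>)" if "a \<in> I" for a
    using Xm[OF that] by (simp cong: measurable_cong_sets)
  have pt: "ennreal (norm (Z y) powr p) \<le> ennreal (real (card I) powr p) * (\<Sum>a\<in>I. ennreal (\<bar>X a y\<bar> powr p))" for y
  proof -
    have "norm (Z y) powr p \<le> (\<Sum>a\<in>I. \<bar>X a y\<bar>) powr p" using le p by (intro powr_mono2) auto
    also have "\<dots> \<le> real (card I) powr p * (\<Sum>a\<in>I. \<bar>X a y\<bar> powr p)"
      using fin p by (intro sum_powr_le) auto
    finally have "ennreal (norm (Z y) powr p) \<le> ennreal (real (card I) powr p * (\<Sum>a\<in>I. \<bar>X a y\<bar> powr p))"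
      by (rule ennreal_leI)
    then show ?thesis by (simp add: ennreal_mult sum_nonneg)
  qed
  have "(\<integral>\<^sup>+y. ennreal (norm (Z y) powr p) \<partial>P i \<eta>)
      \<le> (\<integral>\<^sup>+y. ennreal (real (card I) powr p) * (\<Sum>a\<in>I. ennreal (\<bar>X a y\<bar> powr p)) \<partial>P i \<eta>)"
    using pt by (intro nn_integral_mono) auto
  also have "\<dots> = ennreal (real (card I) powr p) * (\<Sum>a\<in>I. \<integral>\<^sup>+y. ennreal (\<bar>X a y\<bar> powr p) \<partial>P i \<eta>)"
  proof -
    have "(\<integral>\<^sup>+y. (\<Sum>a\<in>I. ennreal (\<bar>X a y\<bar> powr p)) \<partial>P i \<eta>) = (\<Sum>a\<in>I. \<integral>\<^sup>+y. ennreal (\<bar>X a y\<bar> powr p) \<partial>P i \<eta>)"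
      by (rule nn_integral_sum) measurable
    moreover have m: "(\<lambda>y. \<Sum>a\<in>I. ennreal (\<bar>X a y\<bar> powr p)) \<in> borel_measurable (P i \<eta>)" by measurable
    ultimately show ?thesis by (simp only: nn_integral_cmult[OF m])
  qed
  also have "\<dots> \<le> ennreal (real (card I) powr p) * (\<Sum>a\<in>I. ennreal C)"
    using b by (intro mult_left_mono sum_mono) auto
  also have "(\<Sum>a\<in>I. ennreal C) = ennreal (real (card I) * C)"
    using C by (simp add: ennreal_mult ennreal_of_nat_eq_real_of_nat)
  finally show ?thesis using C by (simp add: ennreal_mult)
qed

lemma dvec_props:
  assumes i: "1 \<le> i" and l: "Suc l \<le> k0" and \<eta>: "\<eta> \<in> B"
  shows "dvec i l j \<eta> \<in> borel_measurable (\<gamma> i)"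
    "\<zeta> \<in> B \<inter> \<Theta> \<Longrightarrow> (\<integral>\<^sup>+y. ennreal (norm (dvec i l j \<eta> y) powr p) \<partial>P i \<zeta>) \<le> ennreal (real CARD('d) powr p * (real CARD('d) * K))"
    "\<zeta> \<in> B \<inter> \<Theta> \<Longrightarrow> square_integrable (P i \<zeta>) (dvec i l j \<eta>)"
proof -
  have js: "1 \<le> length (replicate l j @ [a])" "length (replicate l j @ [a]) \<le> k0" for a using l by auto
  have Dm: "D i (replicate l j @ [a]) \<eta> \<in> borel_measurable (\<gamma> i)" for a by (rule D_measurable[OF i js \<eta>])
  show m: "dvec i l j \<eta> \<in> borel_measurable (\<gamma> i)"
    by (rule borel_measurable_vec_componentwise) (simp only: dvec_def vec_lambda_beta Dm)
  have le: "norm (dvec i l j \<eta> y) \<le> (\<Sum>a\<in>UNIV. \<bar>D i (replicate l j @ [a]) \<eta> y\<bar>)" for y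
    using norm_le_l1_cart[of "dvec i l j \<eta> y"] by (simp add: dvec_def)
  show b: "(\<integral>\<^sup>+y. ennreal (norm (dvec i l j \<eta> y) powr p) \<partial>P i \<zeta>) \<le> ennreal (real CARD('d) powr p * (real CARD('d) * K))"
    if "\<zeta> \<in> B \<inter> \<Theta>" for \<zeta>
    using that js by (intro sum_abs_moment[OF i _ finite le Dm K D_moment[OF i that \<eta>]]) auto
  show "square_integrable (P i \<zeta>) (dvec i l j \<eta>)" if "\<zeta> \<in> B \<inter> \<Theta>" for \<zeta>
    using that by (intro square_integrable_moment(1)[OF i _ m b]) auto
qed

lemma sc_eq_dvec: "sc i = dvec i 0 j"
  by (simp add: sc_def dvec_def fun_eq_iff)

lemma square_integrable_sc: "1 \<le> i \<Longrightarrow> \<eta> \<in> B \<inter> \<Theta> \<Longrightarrow> square_integrable (P i \<eta>) (sc i \<eta>)"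
  using dvec_props(3)[of i 0 \<eta> \<eta>] k0 unfolding sc_eq_dvec[of i undefined] by auto

lemma dvec_tendsto:
  assumes "1 \<le> i" "Suc l \<le> k0" "\<And>a. \<eta> a \<in> B" "\<eta>' \<in> B" "\<eta> \<longlonglongrightarrow> \<eta>'"
  shows "(\<lambda>a. dvec i l j (\<eta> a) y) \<longlonglongrightarrow> dvec i l j \<eta>' y"
  unfolding dvec_def using assms(2-)
  by (intro tendsto_vec_lambda continuous_on_tendsto_compose[OF D_continuous[OF assms(1)]]) auto

lemma sc_mean_zero: "1 \<le> i \<Longrightarrow> \<eta> \<in> B \<inter> \<Theta> \<Longrightarrow> (\<integral>y. u \<bullet> sc i \<eta> y \<partial>P i \<eta>) = 0"
  using square_integrable_inner(3)[OF square_integrable_sc, of i \<eta>] score_mean_zero[of i \<eta>]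
  by (simp add: inner_vec_def sc_def)

text \<open>\<open>gh i m v \<eta>\<close> is the remainder in the Taylor expansion of the rotated score around the slabs
  $\eta_j = \theta_{0j}$, divided by $(\eta_j - \theta_{0j})^{m_j} / m_j!$ in coordinate $j$; here
  $m_j = k_j - 1$. At \<open>\<theta>0\<close> it is the modified score.\<close>

definition gh :: "nat \<Rightarrow> ('d \<Rightarrow> nat) \<Rightarrow> ('d \<Rightarrow> real ^ 'd) \<Rightarrow> real ^ 'd \<Rightarrow> obs \<Rightarrow> real ^ 'd" where
  "gh i m v \<eta> y = (\<chi> j. \<Sum>a\<in>UNIV. v j $ a * avg i (replicate (m j) j @ [a]) (m j) j \<theta>0 \<eta> y)"

definition dd :: "('d \<Rightarrow> nat) \<Rightarrow> 'd \<Rightarrow> real ^ 'd \<Rightarrow> real" where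
  "dd m j \<eta> = (\<eta> $ j - \<theta>0 $ j) ^ m j / fact (m j)"

text \<open>The bound of \<open>sum_abs_moment\<close> for the d * d averages, indexed by (j, a),
  that make up \<open>gh\<close>; each of them has p-th moment at most 2 powr p * (1 + K).\<close>

definition Kg :: real where
  "Kg = real (CARD('d) * CARD('d)) powr p * (real (CARD('d) * CARD('d)) * (2 powr p * (1 + K)))"

lemma Kg: "0 \<le> Kg" using K by (simp add: Kg_def)

lemma gh_props:
  assumes i: "1 \<le> i" and m: "\<And>j. Suc (m j) \<le> k0" and v: "\<And>j. norm (v j) \<le> 1" and \<eta>: "\<eta> \<in> B"
  shows "gh i m v \<eta> \<in> borel_measurable (\<gamma> i)"
    "\<zeta> \<in> B \<inter> \<Theta> \<Longrightarrow> (\<integral>\<^sup>+y. ennreal (norm (gh i m v \<eta> y) powr p) \<partial>P i \<zeta>) \<le> ennreal Kg"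
    "\<zeta> \<in> B \<inter> \<Theta> \<Longrightarrow> square_integrable (P i \<zeta>) (gh i m v \<eta>)"
proof -
  have js: "1 \<le> length (replicate (m j) j @ [a])" "length (replicate (m j) j @ [a]) \<le> k0" for a j using m by auto
  let ?A = "\<lambda>(j, a). avg i (replicate (m j) j @ [a]) (m j) j \<theta>0 \<eta>"
  have Am: "avg i (replicate (m j) j @ [a]) (m j) j \<theta>0 \<eta> \<in> borel_measurable (\<gamma> i)" for j a
    by (rule avg_moment(1)[OF i js axis_path_B[OF \<eta>]])
  have comp: "(\<lambda>y. gh i m v \<eta> y $ j) \<in> borel_measurable (\<gamma> i)" for j
    unfolding gh_def vec_lambda_beta using Am by (intro borel_measurable_sum borel_measurable_times borel_measurable_const) auto
  show gm: "gh i m v \<eta> \<in> borel_measurable (\<gamma> i)"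
    by (rule borel_measurable_vec_componentwise[OF comp])
  have le: "norm (gh i m v \<eta> y) \<le> (\<Sum>x\<in>UNIV \<times> UNIV. \<bar>?A x y\<bar>)" for y
  proof -
    have "norm (gh i m v \<eta> y) \<le> (\<Sum>j\<in>UNIV. \<bar>gh i m v \<eta> y $ j\<bar>)" by (rule norm_le_l1_cart)
    also have "\<dots> \<le> (\<Sum>j\<in>UNIV. \<Sum>a\<in>UNIV. \<bar>?A (j, a) y\<bar>)"
    proof (intro sum_mono)
      fix j
      have "\<bar>gh i m v \<eta> y $ j\<bar> \<le> (\<Sum>a\<in>UNIV. \<bar>v j $ a * ?A (j, a) y\<bar>)"
        unfolding gh_def by (simp add: sum_abs)
      also have "\<dots> \<le> (\<Sum>a\<in>UNIV. \<bar>?A (j, a) y\<bar>)"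
      proof (intro sum_mono)
        fix a
        have "\<bar>v j $ a\<bar> \<le> 1" using component_le_norm_cart[of "v j" a] v[of j] by linarith
        then show "\<bar>v j $ a * ?A (j, a) y\<bar> \<le> \<bar>?A (j, a) y\<bar>" by (simp add: abs_mult mult_left_le_one_le)
      qed
      finally show "\<bar>gh i m v \<eta> y $ j\<bar> \<le> (\<Sum>a\<in>UNIV. \<bar>?A (j, a) y\<bar>)" .
    qed
    finally show ?thesis by (simp add: sum.cartesian_product split_def)
  qed
  have C0: "0 \<le> 2 powr p * (1 + K)" using K by simp
  show b: "(\<integral>\<^sup>+y. ennreal (norm (gh i m v \<eta> y) powr p) \<partial>P i \<zeta>) \<le> ennreal Kg"
    if \<zeta>: "\<zeta> \<in> B \<inter> \<Theta>" for \<zeta>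
  proof -
    have "(\<integral>\<^sup>+y. ennreal (norm (gh i m v \<eta> y) powr p) \<partial>P i \<zeta>)
      \<le> ennreal (real (card (UNIV \<times> UNIV :: ('d \<times> 'd) set)) powr p * (real (card (UNIV \<times> UNIV :: ('d \<times> 'd) set)) * (2 powr p * (1 + K))))"
    proof (rule sum_abs_moment[OF i _ _ le _ C0])
      show "\<zeta> \<in> \<Theta>" using \<zeta> by simp
      show "?A x \<in> borel_measurable (\<gamma> i)" for x using Am by (cases x) simp
      show "(\<integral>\<^sup>+y. ennreal (\<bar>?A x y\<bar> powr p) \<partial>P i \<zeta>) \<le> ennreal (2 powr p * (1 + K))" for x
        using avg_moment(2)[OF i js axis_path_B[OF \<eta>] \<zeta>] by (cases x) simp
    qed simp
    then show ?thesis by (simp add: Kg_def card_cartesian_product del: UNIV_Times_UNIV)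
  qed
  show "square_integrable (P i \<zeta>) (gh i m v \<eta>)" if "\<zeta> \<in> B \<inter> \<Theta>" for \<zeta>
    using that by (intro square_integrable_moment(1)[OF i _ gm b]) auto
qed

lemma gh_tendsto:
  assumes "1 \<le> i" "\<And>j. Suc (m j) \<le> k0" "\<And>a. \<eta> a \<in> B" "\<eta>' \<in> B" "\<eta> \<longlonglongrightarrow> \<eta>'"
  shows "(\<lambda>a. gh i m v (\<eta> a) y) \<longlonglongrightarrow> gh i m v \<eta>' y"
  unfolding gh_def using assms(2)
  by (intro tendsto_vec_lambda tendsto_sum tendsto_mult tendsto_const avg_tendsto[OF assms(1)] assms(3-)) auto

text \<open>At \<theta>0 every path is constant and the Taylor weights have mass 1, so each average
  is the derivative itself.\<close>

lemma gh_center: "gh i m v \<theta>0 y $ j = v j \<bullet> dvec i (m j) j \<theta>0 y"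
proof -
  interpret \<tau>: prob_space "remainder_measure (m j)" by (rule prob_space_remainder_measure)
  show ?thesis using \<tau>.prob_space by (simp add: gh_def dvec_def inner_vec_def avg_def)
qed

lemma taylor_sc:
  assumes i: "1 \<le> i" and m: "Suc (m j) \<le> k0" and \<eta>: "\<eta> \<in> B"
  shows "v j \<bullet> sc i \<eta> y = (\<Sum>l<m j. (\<eta> $ j - \<theta>0 $ j) ^ l / fact l * (v j \<bullet> dvec i l j (axis_path j \<theta>0 \<eta> 0) y))
    + dd m j \<eta> * gh i m v \<eta> y $ j"
proof -
  have "D i [a] \<eta> y = (\<Sum>l<m j. (\<eta> $ j - \<theta>0 $ j) ^ l * D i (replicate l j @ [a]) (axis_path j \<theta>0 \<eta> 0) y / fact l)
    + (\<eta> $ j - \<theta>0 $ j) ^ m j * avg i (replicate (m j) j @ [a]) (m j) j \<theta>0 \<eta> y / fact (m j)" for a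
    using m axis_path_B[OF \<eta>] by (intro taylor_D i) auto
  then have "v j \<bullet> sc i \<eta> y = (\<Sum>a\<in>UNIV. v j $ a * (\<Sum>l<m j. (\<eta> $ j - \<theta>0 $ j) ^ l * D i (replicate l j @ [a]) (axis_path j \<theta>0 \<eta> 0) y / fact l))
    + (\<Sum>a\<in>UNIV. v j $ a * ((\<eta> $ j - \<theta>0 $ j) ^ m j * avg i (replicate (m j) j @ [a]) (m j) j \<theta>0 \<eta> y / fact (m j)))"
    by (simp add: inner_vec_def sc_def distrib_left sum.distrib)
  also have "(\<Sum>a\<in>UNIV. v j $ a * (\<Sum>l<m j. (\<eta> $ j - \<theta>0 $ j) ^ l * D i (replicate l j @ [a]) (axis_path j \<theta>0 \<eta> 0) y / fact l))
    = (\<Sum>l<m j. (\<eta> $ j - \<theta>0 $ j) ^ l / fact l * (v j \<bullet> dvec i l j (axis_path j \<theta>0 \<eta> 0) y))"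
    unfolding sum_distrib_left by (subst sum.swap) (simp add: inner_vec_def dvec_def sum_distrib_left mult_ac)
  also have "(\<Sum>a\<in>UNIV. v j $ a * ((\<eta> $ j - \<theta>0 $ j) ^ m j * avg i (replicate (m j) j @ [a]) (m j) j \<theta>0 \<eta> y / fact (m j)))
    = dd m j \<eta> * gh i m v \<eta> y $ j"
    by (simp add: gh_def dd_def sum_distrib_left mult_ac)
  finally show ?thesis .
qed

text \<open>A sum of independent variables vanishes almost surely only if each of them is almost surely
  constant. This turns the vanishing condition on the score of the sample into a statement about the
  individual scores, which only involves the null sets of the marginal laws.\<close>

lemma vanishing_individual:
  assumes n: "1 \<le> n" and l: "Suc l \<le> k0" and \<theta>t: "\<theta>t \<in> B"
    and AE0: "AE w in M \<theta>0. (\<Sum>i=1..n. dvec i l j \<theta>t (Y i w)) \<bullet> u = 0"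
  shows "i \<in> {1..n} \<Longrightarrow> AE y in P i \<theta>0. u \<bullet> dvec i l j \<theta>t y = (\<integral>y. u \<bullet> dvec i l j \<theta>t y \<partial>P i \<theta>0)"
    "(\<Sum>i=1..n. \<integral>y. u \<bullet> dvec i l j \<theta>t y \<partial>P i \<theta>0) = 0"
proof -
  interpret prob_space "M \<theta>0" by (rule prob_M[OF \<theta>0])
  have sq: "square_integrable (P i \<theta>0) (dvec i l j \<theta>t)" if "i \<in> {1..n}" for i
    using dvec_props(3)[OF _ l \<theta>t \<theta>0_B] that by auto
  define X where "X w = (\<Sum>i=1..n. dvec i l j \<theta>t (Y i w))" for w
  note sX = sum_cov[where n=n, OF \<theta>0 sq, folded X_def]
  have cX: "cov (M \<theta>0) X = (\<Sum>i=1..n. cov (P i \<theta>0) (dvec i l j \<theta>t))"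
    unfolding X_def[abs_def] by (rule sum_cov(2)[where n=n, OF \<theta>0 sq])
  have uX: "AE w in M \<theta>0. u \<bullet> X w = 0" using AE0 by (simp add: X_def inner_commute)
  have Xm: "(\<lambda>w. u \<bullet> X w) \<in> borel_measurable (M \<theta>0)"
    using square_integrable_inner(1)[OF sX(1)] by (rule borel_measurable_integrable)
  have EX: "(\<integral>w. u \<bullet> X w \<partial>M \<theta>0) = 0"
    using integral_cong_AE[OF Xm _ uX] by simp
  have "AE w in M \<theta>0. (u \<bullet> X w - (\<integral>w. u \<bullet> X w \<partial>M \<theta>0)) * (u \<bullet> X w - (\<integral>w. u \<bullet> X w \<partial>M \<theta>0)) = 0"
    using uX by eventually_elim (simp add: EX)
  then have "(\<integral>w. (u \<bullet> X w - (\<integral>w. u \<bullet> X w \<partial>M \<theta>0)) * (u \<bullet> X w - (\<integral>w. u \<bullet> X w \<partial>M \<theta>0)) \<partial>M \<theta>0) = 0"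
    by (rule integral_eq_zero_AE)
  then have "u \<bullet> (cov (M \<theta>0) X *v u) = 0"
    using cov_inner_centered[OF sX(1), of u u] by simp
  then have "(\<Sum>i=1..n. u \<bullet> (cov (P i \<theta>0) (dvec i l j \<theta>t) *v u)) = 0"
    unfolding cX sum_matrix_vector inner_sum_right .
  then have z: "u \<bullet> (cov (P i \<theta>0) (dvec i l j \<theta>t) *v u) = 0" if "i \<in> {1..n}" for i
    using sum_nonneg_eq_0_iff[of "{1..n}" "\<lambda>i. u \<bullet> (cov (P i \<theta>0) (dvec i l j \<theta>t) *v u)"] cov_nonneg[OF sq] that by auto
  show "AE y in P i \<theta>0. u \<bullet> dvec i l j \<theta>t y = (\<integral>y. u \<bullet> dvec i l j \<theta>t y \<partial>P i \<theta>0)" if "i \<in> {1..n}"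
    by (rule cov_zero_imp_const[OF sq[OF that] z[OF that]])
  have "(\<integral>w. u \<bullet> X w \<partial>M \<theta>0) = (\<Sum>i=1..n. \<integral>w. u \<bullet> dvec i l j \<theta>t (Y i w) \<partial>M \<theta>0)"
    unfolding X_def inner_sum_right
    using square_integrable_inner(1)[OF square_integrable_Y(1)[OF _ \<theta>0 sq]]
    by (intro Bochner_Integration.integral_sum) auto
  also have "\<dots> = (\<Sum>i=1..n. \<integral>y. u \<bullet> dvec i l j \<theta>t y \<partial>P i \<theta>0)"
  proof (rule sum.cong[OF refl])
    fix i assume i: "i \<in> {1..n}"
    then have i1: "1 \<le> i" by simp
    have "(\<lambda>y. u \<bullet> dvec i l j \<theta>t y) \<in> borel_measurable (\<gamma> i)"
      using dvec_props(1)[OF i1 l \<theta>t] by (intro borel_measurable_inner borel_measurable_const)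
    then show "(\<integral>w. u \<bullet> dvec i l j \<theta>t (Y i w) \<partial>M \<theta>0) = (\<integral>y. u \<bullet> dvec i l j \<theta>t y \<partial>P i \<theta>0)"
      unfolding law_distr[OF i1 \<theta>0] by (rule integral_distr[OF Y_measurable[OF i1 \<theta>0], symmetric])
  qed
  finally show "(\<Sum>i=1..n. \<integral>y. u \<bullet> dvec i l j \<theta>t y \<partial>P i \<theta>0) = 0" using EX by simp
qed

text \<open>On the slab the derivatives of the individual rotated scores below the critical order
  are almost surely equal to their expectations, so the Taylor polynomial in
  \<open>taylor_sc\<close> is deterministic. Its coefficients sum to 0 over the sample by
  \<open>vanishing_individual\<close>.\<close>

lemma score_decomposition:
  assumes n: "1 \<le> n" and m: "\<And>j. Suc (m j) \<le> k0"
    and van: "\<And>j l \<theta>t. l < m j \<Longrightarrow> \<theta>t \<in> B \<Longrightarrow> \<theta>t $ j = \<theta>0 $ j \<Longrightarrow>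
      AE w in M \<theta>0. (\<Sum>i=1..n. dvec i l j \<theta>t (Y i w)) \<bullet> v j = 0"
  shows "\<exists>c. (\<forall>i\<in>{1..n}. AE y in P i \<theta>0. \<forall>\<eta>\<in>B. \<forall>j. v j \<bullet> sc i \<eta> y = c i \<eta> j + dd m j \<eta> * gh i m v \<eta> y $ j)
    \<and> (\<forall>\<eta>\<in>B. \<forall>j. (\<Sum>i=1..n. c i \<eta> j) = 0)"
proof -
  define e where "e i j l \<theta>t = (\<integral>y. v j \<bullet> dvec i l j \<theta>t y \<partial>P i \<theta>0)" for i j l \<theta>t
  have l: "Suc l \<le> k0" if "l < m j" for l j using m[of j] that by simp
  have vi1: "AE y in P i \<theta>0. v j \<bullet> dvec i l j \<theta>t y = e i j l \<theta>t"
    if "l < m j" "\<theta>t \<in> B" "\<theta>t $ j = \<theta>0 $ j" "i \<in> {1..n}" for i j l \<theta>t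
    unfolding e_def by (rule vanishing_individual(1)[OF n l[OF that(1)] that(2) van[OF that(1-3)] that(4)])
  have vi2: "(\<Sum>i=1..n. e i j l \<theta>t) = 0" if "l < m j" "\<theta>t \<in> B" "\<theta>t $ j = \<theta>0 $ j" for j l \<theta>t
    unfolding e_def by (rule vanishing_individual(2)[OF n l[OF that(1)] that(2) van[OF that(1-3)]])
  \<comment> \<open>The exceptional null set depends on the point of the slab, and the slab is
    uncountable in general. A countable dense subset yields one null set; continuity of the
    derivatives and of their expectations extends the identity to the whole slab.\<close>
  have "\<forall>j. \<exists>T. countable T \<and> T \<subseteq> {\<theta>t \<in> B. \<theta>t $ j = \<theta>0 $ j} \<and> {\<theta>t \<in> B. \<theta>t $ j = \<theta>0 $ j} \<subseteq> closure T"
  proof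
    fix j
    obtain T where "countable T" "T \<subseteq> {\<theta>t \<in> B. \<theta>t $ j = \<theta>0 $ j}" "{\<theta>t \<in> B. \<theta>t $ j = \<theta>0 $ j} \<subseteq> closure T"
      by (rule separable)
    then show "\<exists>T. countable T \<and> T \<subseteq> {\<theta>t \<in> B. \<theta>t $ j = \<theta>0 $ j} \<and> {\<theta>t \<in> B. \<theta>t $ j = \<theta>0 $ j} \<subseteq> closure T"
      by blast
  qed
  from choice[OF this] obtain T where T0: "\<forall>j. countable (T j) \<and> T j \<subseteq> {\<theta>t \<in> B. \<theta>t $ j = \<theta>0 $ j} \<and>
      {\<theta>t \<in> B. \<theta>t $ j = \<theta>0 $ j} \<subseteq> closure (T j)" by blast
  have T: "countable (T j)" "T j \<subseteq> {\<theta>t \<in> B. \<theta>t $ j = \<theta>0 $ j}"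
      "{\<theta>t \<in> B. \<theta>t $ j = \<theta>0 $ j} \<subseteq> closure (T j)" for j
    using T0 by simp_all
  have good: "AE y in P i \<theta>0. \<forall>j. \<forall>l\<in>{..<m j}. \<forall>\<theta>t\<in>T j. v j \<bullet> dvec i l j \<theta>t y = e i j l \<theta>t"
    if i: "i \<in> {1..n}" for i
  proof (rule AE_all_countable[THEN iffD2, rule_format])
    show "AE y in P i \<theta>0. \<forall>l\<in>{..<m j}. \<forall>\<theta>t\<in>T j. v j \<bullet> dvec i l j \<theta>t y = e i j l \<theta>t" for j
    proof (rule AE_ball_countable[THEN iffD2, OF countable_finite[OF finite_lessThan], rule_format],
        rule AE_ball_countable[THEN iffD2, OF T(1), rule_format])
      fix l \<theta>t assume "l \<in> {..<m j}" "\<theta>t \<in> T j"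
      with T(2)[of j] show "AE y in P i \<theta>0. v j \<bullet> dvec i l j \<theta>t y = e i j l \<theta>t"
        by (intro vi1 i) auto
    qed
  qed
  have all: "v j \<bullet> dvec i l j \<theta>t y = e i j l \<theta>t"
    if i: "i \<in> {1..n}" and y: "\<forall>j. \<forall>l\<in>{..<m j}. \<forall>\<theta>t\<in>T j. v j \<bullet> dvec i l j \<theta>t y = e i j l \<theta>t"
      and lj: "l < m j" and \<theta>t: "\<theta>t \<in> B" "\<theta>t $ j = \<theta>0 $ j" for i y j l \<theta>t
  proof -
    have i1: "1 \<le> i" using i by simp
    have "\<theta>t \<in> closure (T j)" using T(3)[of j] \<theta>t by blast
    then obtain x where x0: "\<forall>a. x a \<in> T j" and x1: "x \<longlonglongrightarrow> \<theta>t"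
      unfolding closure_sequential by blast
    note x = x0[rule_format] x1
    have xB: "x a \<in> B" for a using x(1) T(2)[of j] by blast
    have 1: "(\<lambda>a. v j \<bullet> dvec i l j (x a) z) \<longlonglongrightarrow> v j \<bullet> dvec i l j \<theta>t z" for z
      by (intro tendsto_inner tendsto_const dvec_tendsto[OF i1 l[OF lj] xB \<theta>t(1) x(2)])
    have "(\<lambda>a. \<integral>z. v j \<bullet> dvec i l j (x a) z \<partial>P i \<theta>0) \<longlonglongrightarrow> (\<integral>z. v j \<bullet> dvec i l j \<theta>t z \<partial>P i \<theta>0)"
    proof (rule expectation_tendsto(3)[OF i1 \<theta>0_B \<theta>0_B tendsto_const])
      show "(\<lambda>z. v j \<bullet> dvec i l j (x a) z) \<in> borel_measurable (\<gamma> i)" "(\<lambda>z. v j \<bullet> dvec i l j \<theta>t z) \<in> borel_measurable (\<gamma> i)" for a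
        using dvec_props(1)[OF i1 l[OF lj]] xB \<theta>t(1) by (auto intro!: borel_measurable_inner)
      show "(\<integral>\<^sup>+z. ennreal (\<bar>v j \<bullet> dvec i l j (x a) z\<bar> powr p) \<partial>P i \<theta>0)
          \<le> ennreal (norm (v j) powr p * (real CARD('d) powr p * (real CARD('d) * K)))" for a
      proof -
        have "\<bar>v j \<bullet> dvec i l j (x a) z\<bar> powr p \<le> norm (v j) powr p * norm (dvec i l j (x a) z) powr p" for z
          using powr_mono2[OF _ _ Cauchy_Schwarz_ineq2[of "v j" "dvec i l j (x a) z"], of p] p by (simp add: powr_mult)
        then have "(\<integral>\<^sup>+z. ennreal (\<bar>v j \<bullet> dvec i l j (x a) z\<bar> powr p) \<partial>P i \<theta>0)
          \<le> (\<integral>\<^sup>+z. ennreal (norm (v j) powr p) * ennreal (norm (dvec i l j (x a) z) powr p) \<partial>P i \<theta>0)"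
          by (intro nn_integral_mono) (simp add: ennreal_mult[symmetric])
        also have "\<dots> = ennreal (norm (v j) powr p) * (\<integral>\<^sup>+z. ennreal (norm (dvec i l j (x a) z) powr p) \<partial>P i \<theta>0)"
          using dvec_props(1)[OF i1 l[OF lj] xB[of a]] by (intro nn_integral_cmult) (simp cong: measurable_cong_sets)
        also have "\<dots> \<le> ennreal (norm (v j) powr p) * ennreal (real CARD('d) powr p * (real CARD('d) * K))"
          using dvec_props(2)[OF i1 l[OF lj] xB[of a] \<theta>0_B] by (intro mult_left_mono) auto
        finally show ?thesis using K by (simp add: ennreal_mult)
      qed
      show "1 < p" using p by simp
    qed (use 1 in auto)
    then have 2: "(\<lambda>a. e i j l (x a)) \<longlonglongrightarrow> e i j l \<theta>t" by (simp add: e_def)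
    have "(\<lambda>a. v j \<bullet> dvec i l j (x a) y) = (\<lambda>a. e i j l (x a))" using y lj x(1) by auto
    with 1[of y] 2 show ?thesis by (auto intro: LIMSEQ_unique)
  qed
  \<comment> \<open>The Taylor polynomial with the derivatives at the foot of the axis path, a point
    of the slab, replaced by their expectations.\<close>
  define c where "c i \<eta> j = (\<Sum>l<m j. (\<eta> $ j - \<theta>0 $ j) ^ l / fact l * e i j l (axis_path j \<theta>0 \<eta> 0))" for i \<eta> j
  show ?thesis
  proof (intro exI[of _ c] conjI ballI allI)
    fix i assume i: "i \<in> {1..n}"
    show "AE y in P i \<theta>0. \<forall>\<eta>\<in>B. \<forall>j. v j \<bullet> sc i \<eta> y = c i \<eta> j + dd m j \<eta> * gh i m v \<eta> y $ j"
      using good[OF i]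
    proof eventually_elim
      case (elim y)
      show ?case
      proof (intro ballI allI)
        fix \<eta> j assume \<eta>: "\<eta> \<in> B"
        have "v j \<bullet> dvec i l j (axis_path j \<theta>0 \<eta> 0) y = e i j l (axis_path j \<theta>0 \<eta> 0)" if "l < m j" for l
          using all[OF i elim that axis_path_B[OF \<eta>]] by (simp add: axis_path_0_coord)
        moreover have "v j \<bullet> sc i \<eta> y = (\<Sum>l<m j. (\<eta> $ j - \<theta>0 $ j) ^ l / fact l * (v j \<bullet> dvec i l j (axis_path j \<theta>0 \<eta> 0) y))
            + dd m j \<eta> * gh i m v \<eta> y $ j"
          using i by (intro taylor_sc m \<eta>) auto
        ultimately show "v j \<bullet> sc i \<eta> y = c i \<eta> j + dd m j \<eta> * gh i m v \<eta> y $ j"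
          by (simp add: c_def)
      qed
    qed
  next
    fix \<eta> j assume \<eta>: "\<eta> \<in> B"
    have "(\<Sum>i=1..n. c i \<eta> j) = (\<Sum>l<m j. (\<eta> $ j - \<theta>0 $ j) ^ l / fact l * (\<Sum>i=1..n. e i j l (axis_path j \<theta>0 \<eta> 0)))"
      unfolding c_def sum_distrib_left by (rule sum.swap)
    also have "\<dots> = 0"
      using vi2[OF _ axis_path_B[OF \<eta>]] by (intro sum.neutral ballI) (simp add: axis_path_0_coord)
    finally show "(\<Sum>i=1..n. c i \<eta> j) = 0" .
  qed
qed

end

section \<open>Coercivity of the normalized information\<close>

text \<open>The residual is orthogonal to all \<open>v j\<close>, so its squared norm vanishes by
  \<open>pos_definite_basis_quadratic\<close> for the identity matrix.\<close>

lemma orthonormal_expansion: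
  fixes v :: "'d \<Rightarrow> real ^ 'd"
  assumes v: "\<And>j j'. v j \<bullet> v j' = (if j = j' then 1 else 0)"
  shows "x = (\<Sum>j\<in>UNIV. (v j \<bullet> x) *\<^sub>R v j)"
proof -
  have c: "v j \<bullet> (\<Sum>j\<in>UNIV. t j *\<^sub>R v j) = t j" for t j
    by (simp add: inner_sum_right v if_distrib cong: if_cong)
  define r where "r = x - (\<Sum>j\<in>UNIV. (v j \<bullet> x) *\<^sub>R v j)"
  have "v i \<bullet> (mat 1 *v v j) = (if i = j then 1 else 0)" for i j by (simp add: v)
  then have "r \<bullet> r = (\<Sum>j\<in>UNIV. (v j \<bullet> r)\<^sup>2)"
    by (rule pos_definite_basis_quadratic(1)) (simp_all add: inner_commute)
  also have "\<dots> = 0" by (simp add: r_def inner_diff_right c)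
  finally show ?thesis by (simp add: r_def)
qed

lemma quadratic_form_bound:
  fixes E :: "real ^ 'd ^ 'd"
  shows "\<bar>x \<bullet> (E *v x)\<bar> \<le> real CARD('d) * norm E * (norm x)\<^sup>2"
proof -
  have "norm (E *v x) \<le> (\<Sum>a\<in>UNIV. \<bar>(E *v x) $ a\<bar>)" by (rule norm_le_l1_cart)
  also have "\<dots> \<le> (\<Sum>a\<in>(UNIV::'d set). norm E * norm x)"
  proof (intro sum_mono)
    fix a :: 'd
    have "\<bar>(E *v x) $ a\<bar> = \<bar>E $ a \<bullet> x\<bar>"
      by (simp add: matrix_vector_mult_def inner_vec_def)
    also have "\<dots> \<le> norm (E $ a) * norm x" by (rule Cauchy_Schwarz_ineq2)
    also have "\<dots> \<le> norm E * norm x" by (intro mult_right_mono Finite_Cartesian_Product.norm_nth_le) auto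
    finally show "\<bar>(E *v x) $ a\<bar> \<le> norm E * norm x" .
  qed
  finally have "norm (E *v x) \<le> real CARD('d) * norm E * norm x" by simp
  then have "norm x * norm (E *v x) \<le> norm x * (real CARD('d) * norm E * norm x)"
    by (intro mult_left_mono) auto
  with Cauchy_Schwarz_ineq2[of x "E *v x"] show ?thesis by (simp add: power2_eq_square mult_ac)
qed

lemma pos_definite_coercive:
  fixes A :: "real ^ 'd ^ 'd"
  assumes "pos_definite A"
  obtains c where "0 < c" "\<And>x. c * (norm x)\<^sup>2 \<le> x \<bullet> (A *v x)"
proof -
  have cont: "continuous_on (sphere 0 1) (\<lambda>x. x \<bullet> (A *v x))"
    by (intro continuous_intros matrix_vector_mult_linear_continuous_on)
  have ne: "sphere 0 1 \<noteq> ({} :: (real ^ 'd) set)" by simp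
  obtain z where z: "z \<in> sphere 0 1" "\<forall>x\<in>sphere 0 1. z \<bullet> (A *v z) \<le> x \<bullet> (A *v x)"
    using continuous_attains_inf[OF compact_sphere ne cont] by blast
  have pos: "0 < z \<bullet> (A *v z)" 
  proof -
    have "z \<noteq> 0" using z(1) by auto
    then show ?thesis using assms by (simp add: pos_definite_def)
  qed
  have "z \<bullet> (A *v z) * (norm x)\<^sup>2 \<le> x \<bullet> (A *v x)" for x
  proof (cases "x = 0")
    case False
    define y where "y = (1 / norm x) *\<^sub>R x"
    have "y \<in> sphere 0 1" using False by (simp add: y_def)
    then have "z \<bullet> (A *v z) \<le> y \<bullet> (A *v y)" using z(2) by blast
    also have "y \<bullet> (A *v y) = (x \<bullet> (A *v x)) / (norm x)\<^sup>2"
      by (simp add: y_def matrix_vector_mult_scaleR power2_eq_square)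
    finally show ?thesis using False by (simp add: field_simps)
  qed simp
  with pos show ?thesis using that by blast
qed

text \<open>\<open>mm n j\<close> is k_j(\<theta>0, n) - 1. Exponents and vectors stay those of
  \<theta>0 while the parameter \<eta> moves in the ball. All matrices are written as sums of
  covariances under the marginal laws, where the limit theorems for expectations apply.\<close>

locale modified_center = parameter_center \<Theta> M Y \<gamma> f L \<theta>0 \<rho>0 k0 p K S
  for \<Theta> :: "(real ^ 'd) set" and M :: "real ^ 'd \<Rightarrow> 'w measure" and Y \<gamma> f L \<theta>0 \<rho>0 k0 p K S +
  fixes mm :: "nat \<Rightarrow> 'd \<Rightarrow> nat" and vv :: "nat \<Rightarrow> 'd \<Rightarrow> real ^ 'd"
    and c1 c2 :: "real ^ 'd \<Rightarrow> real"
  assumes mm: "1 \<le> n \<Longrightarrow> Suc (mm n j) \<le> k0"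
    and vv: "1 \<le> n \<Longrightarrow> vv n j \<bullet> vv n j' = (if j = j' then 1 else 0)"
    and vanish: "1 \<le> n \<Longrightarrow> l < mm n j \<Longrightarrow> \<theta>t \<in> ball \<theta>0 \<rho>0 \<Longrightarrow> \<theta>t $ j = \<theta>0 $ j \<Longrightarrow>
        AE w in M \<theta>0. (\<Sum>i=1..n. dvec i l j \<theta>t (Y i w)) \<bullet> vv n j = 0"
    and posdef: "1 \<le> n \<Longrightarrow> pos_definite (\<Sum>i=1..n. cov (law \<gamma> f i \<theta>0) (gh i (mm n) (vv n) \<theta>0))"
    and c_cont: "continuous_on \<Theta> c1" "continuous_on \<Theta> c2"
    and c_pos: "\<theta> \<in> \<Theta> \<Longrightarrow> 0 < c1 \<theta>" "\<theta> \<in> \<Theta> \<Longrightarrow> 0 < c2 \<theta>"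
    and comparable: "1 \<le> i \<Longrightarrow> \<theta> \<in> ball \<theta>0 \<rho>0 \<inter> \<Theta> \<Longrightarrow>
        c1 \<theta> * (x \<bullet> (cov (law \<gamma> f 1 \<theta>) (sc 1 \<theta>) *v x)) \<le> x \<bullet> (cov (law \<gamma> f i \<theta>) (sc i \<theta>) *v x) \<and>
        x \<bullet> (cov (law \<gamma> f i \<theta>) (sc i \<theta>) *v x) \<le> c2 \<theta> * (x \<bullet> (cov (law \<gamma> f 1 \<theta>) (sc 1 \<theta>) *v x))"
    and dense: "1 \<le> n \<Longrightarrow> \<theta> \<in> ball \<theta>0 \<rho>0 \<inter> \<Theta> \<Longrightarrow>
        \<exists>\<phi>. (\<forall>a. \<phi> a \<in> ball \<theta>0 \<rho>0 \<inter> \<Theta> \<and> invertible (\<Sum>i=1..n. cov (law \<gamma> f i (\<phi> a)) (sc i (\<phi> a)))) \<and> \<phi> \<longlonglongrightarrow> \<theta>"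
begin

definition I where "I n \<eta> = (\<Sum>i=1..n. cov (P i \<eta>) (sc i \<eta>))"

abbreviation g where "g n i \<eta> y \<equiv> gh i (mm n) (vv n) \<eta> y"

definition J where "J n \<eta> = (\<Sum>i=1..n. cov (P i \<eta>) (g n i \<eta>))"

abbreviation d where "d n j \<eta> \<equiv> dd (mm n) j \<eta>"

text \<open>The linear map D_n(\<eta>) V_n^T, through which the information
  \<open>I n \<eta>\<close> is the pull-back of the quadratic form of
  \<open>J n \<eta>\<close>.\<close>

definition Z where "Z n \<eta> x = (\<chi> j. d n j \<eta> * (vv n j \<bullet> x))"

lemma norm_vv: "1 \<le> n \<Longrightarrow> norm (vv n j) = 1"
  using vv[of n j j] by (simp add: norm_eq_1)

lemma norm_vv_le: "1 \<le> n \<Longrightarrow> norm (vv n j) \<le> 1"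
  using norm_vv by simp

lemma g_sq: "1 \<le> n \<Longrightarrow> 1 \<le> i \<Longrightarrow> \<eta> \<in> B \<inter> \<Theta> \<Longrightarrow> square_integrable (P i \<eta>) (g n i \<eta>)"
  using gh_props(3)[of i "mm n" "vv n" \<eta> \<eta>] mm norm_vv_le by auto

lemma decomposition:
  assumes n: "1 \<le> n"
  shows "\<exists>c. (\<forall>i\<in>{1..n}. AE y in P i \<theta>0. \<forall>\<eta>\<in>B. \<forall>j. vv n j \<bullet> sc i \<eta> y = c i \<eta> j + d n j \<eta> * g n i \<eta> y $ j)
    \<and> (\<forall>\<eta>\<in>B. \<forall>j. (\<Sum>i=1..n. c i \<eta> j) = 0)"
  by (rule score_decomposition[OF n mm[OF n] vanish[OF n]])

lemma inner_Z:
  assumes n: "1 \<le> n"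
    and eq: "\<And>j. vv n j \<bullet> s = c j + d n j \<eta> * t $ j"
  shows "x \<bullet> s = (\<Sum>j\<in>UNIV. (vv n j \<bullet> x) * c j) + Z n \<eta> x \<bullet> t"
proof -
  have "x \<bullet> s = (\<Sum>j\<in>UNIV. (vv n j \<bullet> x) * (vv n j \<bullet> s))"
    by (subst orthonormal_expansion[OF vv[OF n], of x]) (simp add: inner_sum_left)
  also have "\<dots> = (\<Sum>j\<in>UNIV. (vv n j \<bullet> x) * c j) + Z n \<eta> x \<bullet> t"
  proof -
    have "Z n \<eta> x \<bullet> t = (\<Sum>j\<in>UNIV. (d n j \<eta> * (vv n j \<bullet> x)) * t $ j)"
      by (subst inner_vec_def) (simp add: Z_def)
    then show ?thesis by (simp add: eq distrib_left sum.distrib mult_ac)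
  qed
  finally show ?thesis .
qed

lemma cov_sc_g:
  assumes n: "1 \<le> n" and i: "i \<in> {1..n}" and \<eta>: "\<eta> \<in> B \<inter> \<Theta>"
  shows "x \<bullet> (cov (P i \<eta>) (sc i \<eta>) *v y) = Z n \<eta> x \<bullet> (cov (P i \<eta>) (g n i \<eta>) *v Z n \<eta> y)"
proof -
  have i1: "1 \<le> i" using i by simp
  obtain c where c: "\<forall>i\<in>{1..n}. AE y in P i \<theta>0. \<forall>\<eta>\<in>B. \<forall>j. vv n j \<bullet> sc i \<eta> y = c i \<eta> j + d n j \<eta> * g n i \<eta> y $ j"
    using decomposition[OF n] by blast
  have "AE y in P i \<eta>. \<forall>\<eta>\<in>B. \<forall>j. vv n j \<bullet> sc i \<eta> y = c i \<eta> j + d n j \<eta> * g n i \<eta> y $ j"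
    using \<eta> by (intro AE_transfer[OF i1 \<theta>0 _ c[rule_format, OF i]]) auto
  then have "AE y in P i \<eta>. x \<bullet> sc i \<eta> y = (\<Sum>j\<in>UNIV. (vv n j \<bullet> x) * c i \<eta> j) + Z n \<eta> x \<bullet> g n i \<eta> y" for x
    by eventually_elim (use \<eta> in \<open>auto intro!: inner_Z[OF n]\<close>)
  then show ?thesis
    by (intro cov_affine square_integrable_sc[OF i1 \<eta>] g_sq[OF n i1 \<eta>])
qed

lemma I_inner: "x \<bullet> (I n \<eta> *v y) = (\<Sum>i=1..n. x \<bullet> (cov (P i \<eta>) (sc i \<eta>) *v y))"
  by (simp add: I_def sum_matrix_vector inner_sum_right)

lemma J_inner: "x \<bullet> (J n \<eta> *v y) = (\<Sum>i=1..n. x \<bullet> (cov (P i \<eta>) (g n i \<eta>) *v y))"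
  by (simp add: J_def sum_matrix_vector inner_sum_right)

lemma I_J: "1 \<le> n \<Longrightarrow> \<eta> \<in> B \<inter> \<Theta> \<Longrightarrow> x \<bullet> (I n \<eta> *v y) = Z n \<eta> x \<bullet> (J n \<eta> *v Z n \<eta> y)"
  unfolding I_inner J_inner by (intro sum.cong refl cov_sc_g) auto

lemma J_sym: "1 \<le> n \<Longrightarrow> \<eta> \<in> B \<inter> \<Theta> \<Longrightarrow> x \<bullet> (J n \<eta> *v y) = y \<bullet> (J n \<eta> *v x)"
  unfolding J_inner by (intro sum.cong refl cov_sym g_sq) auto

lemma I_comparable:
  assumes "1 \<le> n" and \<eta>: "\<eta> \<in> B \<inter> \<Theta>"
  shows "real n * c1 \<eta> * (x \<bullet> (I 1 \<eta> *v x)) \<le> x \<bullet> (I n \<eta> *v x)"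
    "x \<bullet> (I n \<eta> *v x) \<le> real n * c2 \<eta> * (x \<bullet> (I 1 \<eta> *v x))"
proof -
  have I1: "I 1 \<eta> = cov (P 1 \<eta>) (sc 1 \<eta>)" by (simp add: I_def)
  have "(\<Sum>i=1..n. c1 \<eta> * (x \<bullet> (I 1 \<eta> *v x))) \<le> x \<bullet> (I n \<eta> *v x)"
    unfolding I_inner[of _ n] I1 using comparable[OF _ \<eta>] by (intro sum_mono) auto
  then show "real n * c1 \<eta> * (x \<bullet> (I 1 \<eta> *v x)) \<le> x \<bullet> (I n \<eta> *v x)" by simp
  have "x \<bullet> (I n \<eta> *v x) \<le> (\<Sum>i=1..n. c2 \<eta> * (x \<bullet> (I 1 \<eta> *v x)))"
    unfolding I_inner[of _ n] I1 using comparable[OF _ \<eta>] by (intro sum_mono) auto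
  then show "x \<bullet> (I n \<eta> *v x) \<le> real n * c2 \<eta> * (x \<bullet> (I 1 \<eta> *v x))" by simp
qed

text \<open>Products of two components have bounded moments of order p / 2, and p > 2 makes this
  order exceed 1; so the covariances converge as well as the means.\<close>

lemma g_expectation_tendsto:
  assumes n: "1 \<le> n" and i: "1 \<le> i" and \<eta>: "\<And>a. \<eta> a \<in> B \<inter> \<Theta>" "\<eta>' \<in> B \<inter> \<Theta>" "\<eta> \<longlonglongrightarrow> \<eta>'"
  shows "(\<lambda>a. \<integral>y. g n i (\<eta> a) y $ j \<partial>P i (\<eta> a)) \<longlonglongrightarrow> (\<integral>y. g n i \<eta>' y $ j \<partial>P i \<eta>')"
    "(\<lambda>a. \<integral>y. g n i (\<eta> a) y $ j * g n i (\<eta> a) y $ j' \<partial>P i (\<eta> a)) \<longlonglongrightarrow> (\<integral>y. g n i \<eta>' y $ j * g n i \<eta>' y $ j' \<partial>P i \<eta>')"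
proof -
  have \<eta>B: "\<eta> a \<in> B" "\<eta>' \<in> B" for a using \<eta> by auto
  note gp = gh_props[OF i mm[OF n] norm_vv_le[OF n]]
  have gm: "(\<lambda>y. g n i (\<eta> a) y $ j) \<in> borel_measurable (\<gamma> i)" "(\<lambda>y. g n i \<eta>' y $ j) \<in> borel_measurable (\<gamma> i)" for a j
    using borel_measurable_integrable[OF square_integrable_inner(3)[OF gp(3)[OF \<eta>B(1) \<eta>(1)]]]
      borel_measurable_integrable[OF square_integrable_inner(3)[OF gp(3)[OF \<eta>B(2) \<eta>(2)]]]
    by (simp_all cong: measurable_cong_sets)
  have lim: "(\<lambda>a. g n i (\<eta> a) y $ j) \<longlonglongrightarrow> g n i \<eta>' y $ j" for y j
    by (intro tendsto_vec_nth gh_tendsto i mm n \<eta>B \<eta>(3))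
  have mom: "(\<integral>\<^sup>+y. ennreal (norm (g n i (\<eta> a) y) powr p) \<partial>P i (\<eta> a)) \<le> ennreal Kg" for a
    by (rule gp(2)[OF \<eta>B(1) \<eta>(1)])
  show "(\<lambda>a. \<integral>y. g n i (\<eta> a) y $ j \<partial>P i (\<eta> a)) \<longlonglongrightarrow> (\<integral>y. g n i \<eta>' y $ j \<partial>P i \<eta>')"
  proof (rule expectation_tendsto(3)[OF i \<eta> gm(1) gm(2)])
    show "(\<integral>\<^sup>+y. ennreal (\<bar>g n i (\<eta> a) y $ j\<bar> powr p) \<partial>P i (\<eta> a)) \<le> ennreal Kg" for a
      using p by (intro order_trans[OF nn_integral_mono mom] ennreal_leI powr_mono2 component_le_norm_cart) auto
    show "1 < p" using p by simp
  qed (use lim in simp)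
  show "(\<lambda>a. \<integral>y. g n i (\<eta> a) y $ j * g n i (\<eta> a) y $ j' \<partial>P i (\<eta> a)) \<longlonglongrightarrow> (\<integral>y. g n i \<eta>' y $ j * g n i \<eta>' y $ j' \<partial>P i \<eta>')"
  proof (rule expectation_tendsto(3)[OF i \<eta> borel_measurable_times[OF gm(1) gm(1)] borel_measurable_times[OF gm(2) gm(2)]])
    have "\<bar>x $ j * x $ j'\<bar> powr (p / 2) \<le> norm x powr p" for x :: "real ^ 'd"
    proof -
      have "\<bar>x $ j * x $ j'\<bar> \<le> norm x * norm x"
        unfolding abs_mult by (intro mult_mono component_le_norm_cart) auto
      then have "\<bar>x $ j * x $ j'\<bar> powr (p / 2) \<le> (norm x * norm x) powr (p / 2)"
        using p by (intro powr_mono2) auto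
      also have "\<dots> = norm x powr p" by (simp add: powr_mult flip: powr_add)
      finally show ?thesis .
    qed
    then show "(\<integral>\<^sup>+y. ennreal (\<bar>g n i (\<eta> a) y $ j * g n i (\<eta> a) y $ j'\<bar> powr (p / 2)) \<partial>P i (\<eta> a)) \<le> ennreal Kg" for a
      by (intro order_trans[OF nn_integral_mono mom] ennreal_leI)
    show "1 < p / 2" using p by simp
    show "AE y in P i \<theta>0. (\<lambda>a. g n i (\<eta> a) y $ j * g n i (\<eta> a) y $ j') \<longlonglongrightarrow> g n i \<eta>' y $ j * g n i \<eta>' y $ j'"
      by (intro AE_I2 tendsto_mult lim)
  qed
qed

lemma J_continuous:
  assumes n: "1 \<le> n" shows "continuous_on (B \<inter> \<Theta>) (J n)"
  unfolding continuous_on_sequentially o_def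
proof (intro allI ballI impI)
  fix x and a
  assume "a \<in> B \<inter> \<Theta>" "(\<forall>k. x k \<in> B \<inter> \<Theta>) \<and> x \<longlonglongrightarrow> a"
  then show "(\<lambda>k. J n (x k)) \<longlonglongrightarrow> J n a"
    unfolding J_def cov_def
    by (intro tendsto_sum tendsto_vec_lambda tendsto_diff tendsto_mult g_expectation_tendsto n) auto
qed

lemma Z_vv: "1 \<le> n \<Longrightarrow> Z n \<eta> (vv n j) = axis j (d n j \<eta>)"
  by (simp add: Z_def vec_eq_iff axis_def vv)

text \<open>A vanishing diagonal entry makes \<open>Z n \<eta>\<close> kill \<open>vv n j\<close>,
  which puts that vector into the kernel of the information.\<close>

lemma d_nonzero:
  assumes n: "1 \<le> n" and \<eta>: "\<eta> \<in> B \<inter> \<Theta>" and inv: "invertible (I n \<eta>)"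
  shows "d n j \<eta> \<noteq> 0"
proof
  assume 0: "d n j \<eta> = 0"
  have "(I n \<eta> *v vv n j) \<bullet> (I n \<eta> *v vv n j) = 0"
    unfolding I_J[OF n \<eta>] Z_vv[OF n] 0 by (simp add: axis_eq_0_iff[THEN iffD2])
  then have "vv n j = 0" using inv by (simp add: invertible_iff_ker)
  then show False using norm_vv[OF n, of j] by simp
qed

text \<open>The scores are centred and the constants c sum to 0, so the factor \<open>d n j\<close>
  times the sum of the means is 0. At non-critical points the factor can be cancelled; density and
  continuity give the remaining points.\<close>

lemma g_mean_zero:
  assumes n: "1 \<le> n" and \<eta>: "\<eta> \<in> B \<inter> \<Theta>"
  shows "(\<Sum>i=1..n. \<integral>y. g n i \<eta> y $ j \<partial>P i \<eta>) = 0"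
proof -
  obtain c where c: "\<forall>i\<in>{1..n}. AE y in P i \<theta>0. \<forall>\<eta>\<in>B. \<forall>j. vv n j \<bullet> sc i \<eta> y = c i \<eta> j + d n j \<eta> * g n i \<eta> y $ j"
    "\<forall>\<eta>\<in>B. \<forall>j. (\<Sum>i=1..n. c i \<eta> j) = 0"
    using decomposition[OF n] by blast
  have inv0: "(\<Sum>i=1..n. \<integral>y. g n i \<zeta> y $ j \<partial>P i \<zeta>) = 0" if \<zeta>: "\<zeta> \<in> B \<inter> \<Theta>" and inv: "invertible (I n \<zeta>)" for \<zeta>
  proof -
    have "0 = c i \<zeta> j + d n j \<zeta> * (\<integral>y. g n i \<zeta> y $ j \<partial>P i \<zeta>)" if i: "i \<in> {1..n}" for i
    proof -
      have i1: "1 \<le> i" using i by simp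
      interpret prob_space "P i \<zeta>" using prob_law[OF i1] \<zeta> by auto
      have ps: "prob (space (\<gamma> i)) = 1" using prob_space by simp
      have gi: "integrable (P i \<zeta>) (\<lambda>y. g n i \<zeta> y $ j)" by (rule square_integrable_inner(3)[OF g_sq[OF n i1 \<zeta>]])
      have si: "integrable (P i \<zeta>) (\<lambda>y. vv n j \<bullet> sc i \<zeta> y)" by (rule square_integrable_inner(1)[OF square_integrable_sc[OF i1 \<zeta>]])
      have "AE y in P i \<zeta>. \<forall>\<eta>\<in>B. \<forall>j. vv n j \<bullet> sc i \<eta> y = c i \<eta> j + d n j \<eta> * g n i \<eta> y $ j"
        using \<zeta> by (intro AE_transfer[OF i1 \<theta>0 _ c(1)[rule_format, OF i]]) auto
      then have "AE y in P i \<zeta>. vv n j \<bullet> sc i \<zeta> y = c i \<zeta> j + d n j \<zeta> * g n i \<zeta> y $ j"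
        by eventually_elim (use \<zeta> in auto)
      then have "(\<integral>y. vv n j \<bullet> sc i \<zeta> y \<partial>P i \<zeta>) = (\<integral>y. c i \<zeta> j + d n j \<zeta> * g n i \<zeta> y $ j \<partial>P i \<zeta>)"
        using si gi by (intro integral_cong_AE) auto
      then show ?thesis using gi sc_mean_zero[OF i1 \<zeta>] by (simp add: ps)
    qed
    then have "(\<Sum>i=1..n. 0) = (\<Sum>i=1..n. c i \<zeta> j + d n j \<zeta> * (\<integral>y. g n i \<zeta> y $ j \<partial>P i \<zeta>))"
      by (intro sum.cong refl) blast
    then have "0 = d n j \<zeta> * (\<Sum>i=1..n. \<integral>y. g n i \<zeta> y $ j \<partial>P i \<zeta>)"
      using c(2) \<zeta> by (simp add: sum.distrib sum_distrib_left)
    then show ?thesis using d_nonzero[OF n \<zeta> inv, of j] by simp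
  qed
  obtain \<phi> where \<phi>: "\<forall>a. \<phi> a \<in> B \<inter> \<Theta> \<and> invertible (I n (\<phi> a))" "\<phi> \<longlonglongrightarrow> \<eta>"
    using dense[OF n \<eta>] unfolding I_def by blast
  have "(\<lambda>a. \<Sum>i=1..n. \<integral>y. g n i (\<phi> a) y $ j \<partial>P i (\<phi> a)) \<longlonglongrightarrow> (\<Sum>i=1..n. \<integral>y. g n i \<eta> y $ j \<partial>P i \<eta>)"
    using \<phi> \<eta> n by (intro tendsto_sum g_expectation_tendsto) auto
  moreover have "(\<lambda>a. \<Sum>i=1..n. \<integral>y. g n i (\<phi> a) y $ j \<partial>P i (\<phi> a)) = (\<lambda>a. 0)"
    using inv0 \<phi>(1) by blast
  ultimately show ?thesis by (auto intro: LIMSEQ_unique)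
qed

lemma J_near_center:
  assumes n: "1 \<le> n" and e: "0 < e"
  obtains r where "0 < r" "\<And>\<eta>. \<eta> \<in> \<Theta> \<Longrightarrow> dist \<eta> \<theta>0 < r \<Longrightarrow> \<eta> \<in> B"
    "\<And>\<eta> x. \<eta> \<in> \<Theta> \<Longrightarrow> dist \<eta> \<theta>0 < r \<Longrightarrow> \<bar>x \<bullet> (J n \<eta> *v x) - x \<bullet> (J n \<theta>0 *v x)\<bar> \<le> e * (norm x)\<^sup>2"
proof -
  have e': "0 < e / real CARD('d)" using e by simp
  obtain r where r: "0 < r" "\<forall>\<eta>\<in>B \<inter> \<Theta>. dist \<eta> \<theta>0 < r \<longrightarrow> dist (J n \<eta>) (J n \<theta>0) < e / real CARD('d)"
    using J_continuous[OF n] \<theta>0_B e' unfolding continuous_on_iff by metis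
  show ?thesis
  proof (rule that[of "min r \<rho>0"])
    show "0 < min r \<rho>0" using r \<rho>0 by simp
    show inB: "\<eta> \<in> B" if "\<eta> \<in> \<Theta>" "dist \<eta> \<theta>0 < min r \<rho>0" for \<eta>
      using that by (simp add: dist_commute)
    fix \<eta> and x :: "real ^ 'd" assume \<eta>: "\<eta> \<in> \<Theta>" "dist \<eta> \<theta>0 < min r \<rho>0"
    then have "norm (J n \<eta> - J n \<theta>0) \<le> e / real CARD('d)"
      using r(2) inB[OF \<eta>] by (auto simp: dist_norm less_imp_le)
    then have "real CARD('d) * norm (J n \<eta> - J n \<theta>0) \<le> e" by (simp add: field_simps)
    then have "real CARD('d) * norm (J n \<eta> - J n \<theta>0) * (norm x)\<^sup>2 \<le> e * (norm x)\<^sup>2"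
      by (rule mult_right_mono) simp
    with quadratic_form_bound[of x "J n \<eta> - J n \<theta>0"]
    show "\<bar>x \<bullet> (J n \<eta> *v x) - x \<bullet> (J n \<theta>0 *v x)\<bar> \<le> e * (norm x)\<^sup>2"
      by (simp add: matrix_vector_mult_diff_rdistrib inner_diff_right)
  qed
qed

section \<open>Lower bounds for the normalized information, finally uniform in n\<close>

lemma J_coercive_near:
  assumes n: "1 \<le> n"
  shows "\<exists>l r. 0 < l \<and> 0 < r \<and> r \<le> \<rho>0 \<and> (\<forall>\<eta>\<in>\<Theta>. dist \<eta> \<theta>0 < r \<longrightarrow> (\<forall>x. l * (norm x)\<^sup>2 \<le> x \<bullet> (J n \<eta> *v x)))"
proof -
  have "pos_definite (J n \<theta>0)" unfolding J_def by (rule posdef[OF n])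
  then obtain c where c: "0 < c" "\<And>x. c * (norm x)\<^sup>2 \<le> x \<bullet> (J n \<theta>0 *v x)"
    by (rule pos_definite_coercive) blast
  have c2: "0 < c / 2" using c by simp
  obtain r where r: "0 < r"
    "\<And>\<eta> x. \<eta> \<in> \<Theta> \<Longrightarrow> dist \<eta> \<theta>0 < r \<Longrightarrow> \<bar>x \<bullet> (J n \<eta> *v x) - x \<bullet> (J n \<theta>0 *v x)\<bar> \<le> c / 2 * (norm x)\<^sup>2"
    by (rule J_near_center[OF n c2]) blast
  have "c / 2 * (norm x)\<^sup>2 \<le> x \<bullet> (J n \<eta> *v x)" if "\<eta> \<in> \<Theta>" "dist \<eta> \<theta>0 < r" for \<eta> x
    using r(2)[OF that, of x] c(2)[of x] by linarith
  then show ?thesis using c2 r(1) \<rho>0 by (intro exI[of _ "c / 2"] exI[of _ "min r \<rho>0"]) auto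
qed

lemma J_bounded_near:
  "\<exists>u r. 0 < u \<and> 0 < r \<and> (\<forall>\<eta>\<in>\<Theta>. dist \<eta> \<theta>0 < r \<longrightarrow> (\<forall>x. x \<bullet> (J 1 \<eta> *v x) \<le> u * (norm x)\<^sup>2))"
proof -
  define u where "u = real CARD('d) * norm (J 1 \<theta>0) + 1"
  obtain r where r: "0 < r"
    "\<And>\<eta> x. \<eta> \<in> \<Theta> \<Longrightarrow> dist \<eta> \<theta>0 < r \<Longrightarrow> \<bar>x \<bullet> (J 1 \<eta> *v x) - x \<bullet> (J 1 \<theta>0 *v x)\<bar> \<le> 1 * (norm x)\<^sup>2"
    by (rule J_near_center[OF order_refl zero_less_one]) blast
  have "x \<bullet> (J 1 \<eta> *v x) \<le> u * (norm x)\<^sup>2" if "\<eta> \<in> \<Theta>" "dist \<eta> \<theta>0 < r" for \<eta> x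
    using r(2)[OF that, of x] quadratic_form_bound[of x "J 1 \<theta>0"] by (simp add: u_def distrib_right)
  moreover have "0 < u" unfolding u_def by (simp add: add_nonneg_pos)
  ultimately show ?thesis using r(1) by blast
qed

lemma c_near:
  "\<exists>l u r. 0 < l \<and> 0 < u \<and> 0 < r \<and> (\<forall>\<eta>\<in>\<Theta>. dist \<eta> \<theta>0 < r \<longrightarrow> l \<le> c1 \<eta> \<and> c2 \<eta> \<le> u)"
proof -
  have h: "0 < c1 \<theta>0 / 2" using c_pos(1)[OF \<theta>0] by simp
  obtain r1 where r1: "0 < r1" "\<forall>\<eta>\<in>\<Theta>. dist \<eta> \<theta>0 < r1 \<longrightarrow> dist (c1 \<eta>) (c1 \<theta>0) < c1 \<theta>0 / 2"
    using c_cont(1) \<theta>0 h unfolding continuous_on_iff by metis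
  obtain r2 where r2: "0 < r2" "\<forall>\<eta>\<in>\<Theta>. dist \<eta> \<theta>0 < r2 \<longrightarrow> dist (c2 \<eta>) (c2 \<theta>0) < 1"
    using c_cont(2) \<theta>0 zero_less_one unfolding continuous_on_iff by metis
  have b: "c1 \<theta>0 / 2 \<le> c1 \<eta> \<and> c2 \<eta> \<le> c2 \<theta>0 + 1" if "\<eta> \<in> \<Theta>" "dist \<eta> \<theta>0 < min r1 r2" for \<eta>
  proof -
    have "dist (c1 \<eta>) (c1 \<theta>0) < c1 \<theta>0 / 2" "dist (c2 \<eta>) (c2 \<theta>0) < 1" using r1(2) r2(2) that by auto
    then show ?thesis unfolding dist_real_def by linarith
  qed
  have "0 < c2 \<theta>0 + 1" using c_pos(2)[OF \<theta>0] by simp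
  with h b show ?thesis using r1(1) r2(1)
    by (intro exI[of _ "c1 \<theta>0 / 2"] exI[of _ "c2 \<theta>0 + 1"] exI[of _ "min r1 r2"]) auto
qed

text \<open>Comparability of the informations and the two factorizations $I_n = V_n D_n J_n D_n V_n^T$ for
  $n$ and for 1 force the entries of $D_n$ to be dominated by those entries of $D_1$ to which they are
  linked by $V_n^T V_1$.\<close>

lemma d_ratio:
  assumes n: "1 \<le> n" and nz: "vv n j \<bullet> vv 1 j' \<noteq> 0"
  shows "\<exists>C r. 0 < r \<and> (\<forall>\<eta>\<in>\<Theta>. dist \<eta> \<theta>0 < r \<longrightarrow> \<bar>d n j \<eta>\<bar> \<le> C * \<bar>d 1 j' \<eta>\<bar>)"
proof -
  obtain l r1 where l: "0 < l" "0 < r1" "r1 \<le> \<rho>0" "\<forall>\<eta>\<in>\<Theta>. dist \<eta> \<theta>0 < r1 \<longrightarrow> (\<forall>x. l * (norm x)\<^sup>2 \<le> x \<bullet> (J n \<eta> *v x))"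
    using J_coercive_near[OF n] by blast
  obtain u r2 where u: "0 < u" "0 < r2" "\<forall>\<eta>\<in>\<Theta>. dist \<eta> \<theta>0 < r2 \<longrightarrow> (\<forall>x. x \<bullet> (J 1 \<eta> *v x) \<le> u * (norm x)\<^sup>2)"
    using J_bounded_near by blast
  obtain cl cu r3 where c: "0 < cl" "0 < cu" "0 < r3" "\<forall>\<eta>\<in>\<Theta>. dist \<eta> \<theta>0 < r3 \<longrightarrow> cl \<le> c1 \<eta> \<and> c2 \<eta> \<le> cu"
    using c_near by blast
  define w where "w = vv n j \<bullet> vv 1 j'"
  have w0: "w \<noteq> 0" unfolding w_def by (rule nz)
  \<comment> \<open>Testing with x = \<open>vv 1 j'\<close>: l (w d n j)^2 \<le> x \<bullet> I_n x
    \<le> n cu (x \<bullet> I_1 x) \<le> n cu u (d 1 j')^2.\<close>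
  define C where "C = sqrt (real n * cu * u / (l * w\<^sup>2))"
  have "\<bar>d n j \<eta>\<bar> \<le> C * \<bar>d 1 j' \<eta>\<bar>" if \<eta>: "\<eta> \<in> \<Theta>" "dist \<eta> \<theta>0 < min r1 (min r2 r3)" for \<eta>
  proof -
    have \<eta>B: "\<eta> \<in> B \<inter> \<Theta>" using \<eta> l(3) by (auto simp: dist_commute)
    let ?x = "vv 1 j'"
    have Zj: "Z n \<eta> ?x $ j = d n j \<eta> * w" by (simp add: Z_def w_def)
    have "(d n j \<eta> * w)\<^sup>2 \<le> (norm (Z n \<eta> ?x))\<^sup>2"
      using component_le_norm_cart[of "Z n \<eta> ?x" j] unfolding Zj by (metis abs_ge_zero power2_abs power_mono)
    then have "l * (d n j \<eta> * w)\<^sup>2 \<le> l * (norm (Z n \<eta> ?x))\<^sup>2" using l(1) by simp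
    also have "\<dots> \<le> Z n \<eta> ?x \<bullet> (J n \<eta> *v Z n \<eta> ?x)" using l(4) \<eta> by simp
    also have "\<dots> = ?x \<bullet> (I n \<eta> *v ?x)" by (rule I_J[OF n \<eta>B, symmetric])
    also have "\<dots> \<le> real n * c2 \<eta> * (?x \<bullet> (I 1 \<eta> *v ?x))" by (rule I_comparable(2)[OF n \<eta>B])
    also have "\<dots> = real n * c2 \<eta> * (Z 1 \<eta> ?x \<bullet> (J 1 \<eta> *v Z 1 \<eta> ?x))" using I_J[OF order_refl \<eta>B] by simp
    also have "\<dots> \<le> real n * c2 \<eta> * (u * (norm (Z 1 \<eta> ?x))\<^sup>2)"
      using u(3) \<eta> c_pos(2)[of \<eta>] by (intro mult_left_mono) auto
    also have "\<dots> \<le> real n * cu * (u * (norm (Z 1 \<eta> ?x))\<^sup>2)"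
      using c(4) \<eta> u(1) by (intro mult_right_mono mult_left_mono) auto
    also have "norm (Z 1 \<eta> ?x) = \<bar>d 1 j' \<eta>\<bar>" unfolding Z_vv[OF order_refl] by (simp add: norm_eq_sqrt_inner inner_axis_axis)
    finally have "(d n j \<eta>)\<^sup>2 \<le> real n * cu * u / (l * w\<^sup>2) * (d 1 j' \<eta>)\<^sup>2"
      using l(1) w0 by (simp add: field_simps power_mult_distrib)
    then have "sqrt ((d n j \<eta>)\<^sup>2) \<le> sqrt (real n * cu * u / (l * w\<^sup>2) * (d 1 j' \<eta>)\<^sup>2)"
      by (rule real_sqrt_le_mono)
    then show ?thesis unfolding real_sqrt_mult[of _ "(d 1 j' \<eta>)\<^sup>2"] real_sqrt_abs C_def .
  qed
  then show ?thesis using l(2) u(2) c(3) by (intro exI[of _ C] exI[of _ "min r1 (min r2 r3)"]) auto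
qed

text \<open>The bound does not depend on $n$, because only finitely many triples
  $(j, j', k_j(\theta_0, n))$ occur.\<close>

lemma d_ratio_uniform:
  "\<exists>C r. 0 < r \<and> 0 \<le> C \<and> (\<forall>n\<ge>1. \<forall>j j'. vv n j \<bullet> vv 1 j' \<noteq> 0 \<longrightarrow>
      (\<forall>\<eta>\<in>\<Theta>. dist \<eta> \<theta>0 < r \<longrightarrow> \<bar>d n j \<eta>\<bar> \<le> C * \<bar>d 1 j' \<eta>\<bar>))"
proof -
  define e where "e a j \<eta> = (\<eta> $ j - \<theta>0 $ j) ^ a / fact a" for a j and \<eta> :: "real ^ 'd"
  have de: "d n j \<eta> = e (mm n j) j \<eta>" for n j \<eta> by (simp add: dd_def e_def)
  \<comment> \<open>The function \<open>d n j\<close> depends on n only through its exponent. A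
    bound obtained for one n therefore holds for every n that shows the same triple.\<close>
  define Pat where "Pat = {(j, j', a). \<exists>n\<ge>1. mm n j = a \<and> vv n j \<bullet> vv 1 j' \<noteq> 0}"
  have "Pat \<subseteq> UNIV \<times> UNIV \<times> {..<k0}"
    unfolding Pat_def using mm by (auto simp: less_eq_Suc_le)
  then have fin: "finite Pat" by (rule finite_subset) simp
  have "\<forall>x\<in>Pat. \<exists>Cr. 0 < snd Cr \<and> (\<forall>\<eta>\<in>\<Theta>. dist \<eta> \<theta>0 < snd Cr \<longrightarrow>
      \<bar>e (snd (snd x)) (fst x) \<eta>\<bar> \<le> fst Cr * \<bar>d 1 (fst (snd x)) \<eta>\<bar>)"
  proof
    fix x assume "x \<in> Pat"
    then obtain j j' a n where x: "x = (j, j', a)" "1 \<le> n" "mm n j = a" "vv n j \<bullet> vv 1 j' \<noteq> 0"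
      by (auto simp: Pat_def)
    obtain C r where "0 < r" "\<forall>\<eta>\<in>\<Theta>. dist \<eta> \<theta>0 < r \<longrightarrow> \<bar>d n j \<eta>\<bar> \<le> C * \<bar>d 1 j' \<eta>\<bar>"
      using d_ratio[OF x(2,4)] by blast
    then show "\<exists>Cr. 0 < snd Cr \<and> (\<forall>\<eta>\<in>\<Theta>. dist \<eta> \<theta>0 < snd Cr \<longrightarrow>
      \<bar>e (snd (snd x)) (fst x) \<eta>\<bar> \<le> fst Cr * \<bar>d 1 (fst (snd x)) \<eta>\<bar>)"
      by (intro exI[of _ "(C, r)"]) (simp add: x(1) de x(3))
  qed
  from bchoice[OF this] obtain Cr where Cr: "\<forall>x\<in>Pat. 0 < snd (Cr x) \<and> (\<forall>\<eta>\<in>\<Theta>. dist \<eta> \<theta>0 < snd (Cr x) \<longrightarrow>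
      \<bar>e (snd (snd x)) (fst x) \<eta>\<bar> \<le> fst (Cr x) * \<bar>d 1 (fst (snd x)) \<eta>\<bar>)" by blast
  define r where "r = Min (insert 1 ((snd \<circ> Cr) ` Pat))"
  define C where "C = Max (insert 0 ((fst \<circ> Cr) ` Pat))"
  have r0: "0 < r" unfolding r_def using fin Cr by (subst Min_gr_iff) auto
  have C0: "0 \<le> C" unfolding C_def using fin by (intro Max_ge) auto
  have "\<bar>d n j \<eta>\<bar> \<le> C * \<bar>d 1 j' \<eta>\<bar>"
    if n: "1 \<le> n" and nz: "vv n j \<bullet> vv 1 j' \<noteq> 0" and \<eta>: "\<eta> \<in> \<Theta>" "dist \<eta> \<theta>0 < r" for n j j' \<eta>
  proof -
    let ?x = "(j, j', mm n j)"
    have x: "?x \<in> Pat" using n nz by (auto simp: Pat_def)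
    have "r \<le> snd (Cr ?x)" unfolding r_def using fin x by (intro Min_le) auto
    then have "\<bar>d n j \<eta>\<bar> \<le> fst (Cr ?x) * \<bar>d 1 j' \<eta>\<bar>" using Cr[rule_format, OF x] \<eta> by (simp add: de)
    also have "fst (Cr ?x) \<le> C" unfolding C_def using fin x by (intro Max_ge) auto
    finally show ?thesis by (simp add: mult_right_mono)
  qed
  then show ?thesis using r0 C0 by blast
qed

text \<open>Expanding \<open>u\<close> in the basis \<open>vv 1\<close> writes V_n^T u as (V_n^T
  V_1) V_1^T u. Each nonzero entry of V_n^T V_1 links an entry of D_n to one of D_1 that dominates
  it.\<close>

lemma Z_dominated:
  assumes n: "1 \<le> n" and C: "0 \<le> C"
    and r: "\<And>j j'. vv n j \<bullet> vv 1 j' \<noteq> 0 \<Longrightarrow> \<bar>d n j \<eta>\<bar> \<le> C * \<bar>d 1 j' \<eta>\<bar>"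
  shows "norm (Z n \<eta> u) \<le> real CARD('d) * (C * (real CARD('d) * norm (Z 1 \<eta> u)))"
proof -
  have comp: "\<bar>Z n \<eta> u $ j\<bar> \<le> C * (real CARD('d) * norm (Z 1 \<eta> u))" for j
  proof -
    have "vv n j \<bullet> u = (\<Sum>j'\<in>UNIV. (vv 1 j' \<bullet> u) * (vv n j \<bullet> vv 1 j'))"
      by (subst orthonormal_expansion[OF vv[OF order_refl], of u]) (simp add: inner_sum_right)
    then have "\<bar>Z n \<eta> u $ j\<bar> = \<bar>\<Sum>j'\<in>UNIV. d n j \<eta> * ((vv 1 j' \<bullet> u) * (vv n j \<bullet> vv 1 j'))\<bar>"
      by (simp add: Z_def sum_distrib_left)
    also have "\<dots> \<le> (\<Sum>j'\<in>UNIV. \<bar>d n j \<eta> * ((vv 1 j' \<bullet> u) * (vv n j \<bullet> vv 1 j'))\<bar>)" by (rule sum_abs)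
    also have "\<dots> \<le> (\<Sum>j'\<in>(UNIV::'d set). C * norm (Z 1 \<eta> u))"
    proof (intro sum_mono)
      fix j' :: 'd
      show "\<bar>d n j \<eta> * ((vv 1 j' \<bullet> u) * (vv n j \<bullet> vv 1 j'))\<bar> \<le> C * norm (Z 1 \<eta> u)"
      proof (cases "vv n j \<bullet> vv 1 j' = 0")
        case False
        have "\<bar>vv n j \<bullet> vv 1 j'\<bar> \<le> 1"
          using Cauchy_Schwarz_ineq2[of "vv n j" "vv 1 j'"] norm_vv[OF n] norm_vv[OF order_refl] by simp
        then have "\<bar>d n j \<eta> * ((vv 1 j' \<bullet> u) * (vv n j \<bullet> vv 1 j'))\<bar> \<le> \<bar>d n j \<eta>\<bar> * (\<bar>vv 1 j' \<bullet> u\<bar> * 1)"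
          unfolding abs_mult by (intro mult_left_mono) auto
        also have "\<dots> \<le> C * \<bar>d 1 j' \<eta>\<bar> * (\<bar>vv 1 j' \<bullet> u\<bar> * 1)" by (intro mult_right_mono r False) auto
        also have "\<dots> = C * \<bar>Z 1 \<eta> u $ j'\<bar>" by (simp add: Z_def abs_mult)
        also have "\<dots> \<le> C * norm (Z 1 \<eta> u)" using C by (intro mult_left_mono component_le_norm_cart) auto
        finally show ?thesis .
      qed (use C in simp)
    qed
    finally show ?thesis by (simp add: mult_ac)
  qed
  have "norm (Z n \<eta> u) \<le> (\<Sum>j\<in>UNIV. \<bar>Z n \<eta> u $ j\<bar>)" by (rule norm_le_l1_cart)
  also have "\<dots> \<le> (\<Sum>j\<in>(UNIV::'d set). C * (real CARD('d) * norm (Z 1 \<eta> u)))" using comp by (intro sum_mono)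
  finally show ?thesis by simp
qed

text \<open>At a non-critical point D_n is invertible, so any x is Z_n u for some u, and norm x is
  at most a constant times norm (Z_1 u). Hence n (norm x)^2 is bounded, up to constants, by n times
  the form of J_1 at Z_1 u, which is n (u \<bullet> I_1 u), then by u \<bullet> I_n u, which equals
  x \<bullet> J_n x. Critical points follow by density, within the same radius.\<close>

lemma J_uniformly_coercive:
  "\<exists>c r. 0 < c \<and> 0 < r \<and> r \<le> \<rho>0 \<and> (\<forall>n\<ge>1. \<forall>\<eta>\<in>\<Theta>. dist \<eta> \<theta>0 < r \<longrightarrow> (\<forall>x. c * real n * (norm x)\<^sup>2 \<le> x \<bullet> (J n \<eta> *v x)))"
proof -
  obtain l r1 where l: "0 < l" "0 < r1" "r1 \<le> \<rho>0" "\<forall>\<eta>\<in>\<Theta>. dist \<eta> \<theta>0 < r1 \<longrightarrow> (\<forall>x. l * (norm x)\<^sup>2 \<le> x \<bullet> (J 1 \<eta> *v x))"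
    using J_coercive_near[OF order_refl] by blast
  obtain cl cu r2 where c: "0 < cl" "0 < cu" "0 < r2" "\<forall>\<eta>\<in>\<Theta>. dist \<eta> \<theta>0 < r2 \<longrightarrow> cl \<le> c1 \<eta> \<and> c2 \<eta> \<le> cu"
    using c_near by blast
  obtain C r3 where C: "0 < r3" "0 \<le> C" "\<forall>n\<ge>1. \<forall>j j'. vv n j \<bullet> vv 1 j' \<noteq> 0 \<longrightarrow>
      (\<forall>\<eta>\<in>\<Theta>. dist \<eta> \<theta>0 < r3 \<longrightarrow> \<bar>d n j \<eta>\<bar> \<le> C * \<bar>d 1 j' \<eta>\<bar>)"
    using d_ratio_uniform by blast
  define Q where "Q = real CARD('d) * (C * real CARD('d)) + 1"
  have Q: "0 < Q" unfolding Q_def using C(2) by (intro add_nonneg_pos) auto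
  define r where "r = min r1 (min r2 r3)"
  \<comment> \<open>\<open>Q\<close> is the loss in replacing Z_n u by Z_1 u, \<open>l\<close> the
    coercivity constant for n = 1, \<open>cl\<close> the lower bound for c1.\<close>
  define c0 where "c0 = cl * l / Q\<^sup>2"
  have c0: "0 < c0" using c(1) l(1) Q by (simp add: c0_def)
  have noncrit: "c0 * real n * (norm x)\<^sup>2 \<le> x \<bullet> (J n \<eta> *v x)"
    if n: "1 \<le> n" and \<eta>: "\<eta> \<in> \<Theta>" "dist \<eta> \<theta>0 < r" and inv: "invertible (I n \<eta>)" for n \<eta> x
  proof -
    have \<eta>B: "\<eta> \<in> B \<inter> \<Theta>" using \<eta> l(3) by (auto simp: dist_commute r_def)
    define u where "u = (\<Sum>j\<in>UNIV. (x $ j / d n j \<eta>) *\<^sub>R vv n j)"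
    have "vv n j \<bullet> u = x $ j / d n j \<eta>" for j
      by (simp add: u_def inner_sum_right vv[OF n] if_distrib cong: if_cong)
    then have Zu: "Z n \<eta> u = x" using d_nonzero[OF n \<eta>B inv] by (simp add: Z_def vec_eq_iff)
    have "norm (Z n \<eta> u) \<le> real CARD('d) * (C * (real CARD('d) * norm (Z 1 \<eta> u)))"
      using C(3) n \<eta> by (intro Z_dominated C(2)) (auto simp: r_def)
    also have "\<dots> \<le> Q * norm (Z 1 \<eta> u)" by (simp add: Q_def algebra_simps)
    finally have "(norm x)\<^sup>2 \<le> Q\<^sup>2 * (norm (Z 1 \<eta> u))\<^sup>2"
      unfolding Zu power_mult_distrib[symmetric] by (intro power_mono) auto
    then have "c0 * real n * (norm x)\<^sup>2 \<le> c0 * real n * (Q\<^sup>2 * (norm (Z 1 \<eta> u))\<^sup>2)"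
      using c0 by (intro mult_left_mono) auto
    also have "\<dots> = real n * cl * (l * (norm (Z 1 \<eta> u))\<^sup>2)" using Q by (simp add: c0_def)
    also have "\<dots> \<le> real n * cl * (Z 1 \<eta> u \<bullet> (J 1 \<eta> *v Z 1 \<eta> u))"
      using l(4) \<eta> c(1) by (intro mult_left_mono) (auto simp: r_def)
    also have "\<dots> \<le> real n * c1 \<eta> * (Z 1 \<eta> u \<bullet> (J 1 \<eta> *v Z 1 \<eta> u))"
    proof (intro mult_right_mono mult_left_mono)
      show "cl \<le> c1 \<eta>" using c(4) \<eta> by (simp add: r_def)
      have "0 \<le> l * (norm (Z 1 \<eta> u))\<^sup>2" using l(1) by simp
      also have "\<dots> \<le> Z 1 \<eta> u \<bullet> (J 1 \<eta> *v Z 1 \<eta> u)" using l(4) \<eta> by (simp add: r_def)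
      finally show "0 \<le> Z 1 \<eta> u \<bullet> (J 1 \<eta> *v Z 1 \<eta> u)" .
    qed simp
    also have "\<dots> = real n * c1 \<eta> * (u \<bullet> (I 1 \<eta> *v u))" using I_J[OF order_refl \<eta>B] by simp
    also have "\<dots> \<le> u \<bullet> (I n \<eta> *v u)" by (rule I_comparable(1)[OF n \<eta>B])
    also have "\<dots> = x \<bullet> (J n \<eta> *v x)" unfolding I_J[OF n \<eta>B] Zu ..
    finally show ?thesis .
  qed
  have "c0 * real n * (norm x)\<^sup>2 \<le> x \<bullet> (J n \<eta> *v x)"
    if n: "1 \<le> n" and \<eta>: "\<eta> \<in> \<Theta>" "dist \<eta> \<theta>0 < r" for n \<eta> x
  proof -
    have \<eta>B: "\<eta> \<in> B \<inter> \<Theta>" using \<eta> l(3) by (auto simp: dist_commute r_def)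
    obtain \<phi> where \<phi>: "\<forall>a. \<phi> a \<in> B \<inter> \<Theta> \<and> invertible (I n (\<phi> a))" "\<phi> \<longlonglongrightarrow> \<eta>"
      using dense[OF n \<eta>B] unfolding I_def by blast
    have "(\<lambda>a. J n (\<phi> a)) \<longlonglongrightarrow> J n \<eta>"
      by (rule continuous_on_tendsto_compose[OF J_continuous[OF n] \<phi>(2) \<eta>B]) (use \<phi>(1) in auto)
    then have lim: "(\<lambda>a. x \<bullet> (J n (\<phi> a) *v x)) \<longlonglongrightarrow> x \<bullet> (J n \<eta> *v x)"
      unfolding matrix_vector_mult_def
      by (intro tendsto_inner tendsto_const tendsto_vec_lambda tendsto_sum tendsto_mult tendsto_vec_nth)
    have "(\<lambda>a. dist (\<phi> a) \<theta>0) \<longlonglongrightarrow> dist \<eta> \<theta>0" by (intro tendsto_dist \<phi>(2) tendsto_const)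
    then have "\<forall>\<^sub>F a in sequentially. dist (\<phi> a) \<theta>0 < r" using \<eta>(2) by (rule order_tendstoD(2))
    then have "\<forall>\<^sub>F a in sequentially. c0 * real n * (norm x)\<^sup>2 \<le> x \<bullet> (J n (\<phi> a) *v x)"
      by eventually_elim (use \<phi>(1) noncrit[OF n] in auto)
    then show ?thesis by (intro tendsto_lowerbound[OF lim]) auto
  qed
  then show ?thesis using c0 l(2,3) c(3) C(1) by (intro exI[of _ c0] exI[of _ r]) (auto simp: r_def)
qed

end

section \<open>Extension of the test statistic\<close>

context parameter_center
begin

lemma partial_power: "(partial j ^^ l) (partials js h) = partials (replicate l j @ js) h"
  by (induction l) (simp_all add: partials_def)

lemma partial_as_partials: "partial a h = partials [a] h"
  by (simp add: partials_def)

lemma score_eq_sc: "y \<in> S i \<Longrightarrow> score L i \<eta> y = sc i \<eta> y"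
  by (simp add: score_def grad_def sc_def D_def partial_as_partials)

lemma vpartial_score:
  assumes "y \<in> S i" shows "vpartial j l (\<lambda>\<eta>. score L i \<eta> y) \<theta>t = dvec i l j \<theta>t y"
proof -
  have "(\<lambda>\<eta>. score L i \<eta> y $ a) = partials [a] (\<lambda>\<eta>. L i \<eta> y)" for a
    by (simp add: score_def grad_def partial_as_partials)
  then show ?thesis using assms by (simp add: vpartial_def dvec_def D_def partial_power)
qed

lemma vpartial_score_n:
  assumes \<theta>t: "\<theta>t \<in> B" and l: "Suc l \<le> k0" and y: "\<And>i. i \<in> {1..n} \<Longrightarrow> y i \<in> S i"
  shows "vpartial j l (\<lambda>\<eta>. score_n L n \<eta> y) \<theta>t = (\<Sum>i=1..n. dvec i l j \<theta>t (y i))"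
proof -
  have "(\<lambda>\<eta>. score_n L n \<eta> y $ a) = partials [a] (\<lambda>\<eta>. \<Sum>i=1..n. L i \<eta> (y i))" for a
    by (simp add: score_n_def loglik_def grad_def partial_as_partials)
  moreover have "partials (replicate l j @ [a]) (\<lambda>\<eta>. \<Sum>i=1..n. L i \<eta> (y i)) \<theta>t
      = (\<Sum>i=1..n. partials (replicate l j @ [a]) (\<lambda>\<eta>. L i \<eta> (y i)) \<theta>t)" for a
    using S_partial y l \<theta>t by (intro partials_sum[where U=B and k=k0]) auto
  ultimately show ?thesis using y
    by (simp add: vpartial_def dvec_def D_def partial_power vec_eq_iff)
qed

lemma score_n_eq:
  assumes "\<eta> \<in> B" and "\<And>i. i \<in> {1..n} \<Longrightarrow> y i \<in> S i"
  shows "score_n L n \<eta> y = (\<Sum>i=1..n. sc i \<eta> (y i))"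
proof -
  have "vpartial undefined 0 (\<lambda>\<eta>. score_n L n \<eta> y) \<eta> = (\<Sum>i=1..n. dvec i 0 undefined \<eta> (y i))"
    using k0 by (intro vpartial_score_n assms) auto
  then show ?thesis by (simp add: vpartial_def sc_eq_dvec[of _ undefined])
qed

lemma AE_Y_S: "\<eta> \<in> \<Theta> \<Longrightarrow> AE w in M \<eta>. \<forall>i\<in>{1..n}. Y i w \<in> S i"
  by (intro AE_finite_allI AE_Y[OF _ _ AE_S]) auto

lemma info_eq:
  assumes i: "1 \<le> i" and \<eta>: "\<eta> \<in> B \<inter> \<Theta>"
  shows "info M Y L i \<eta> = cov (P i \<eta>) (sc i \<eta>)"
proof -
  have \<eta>T: "\<eta> \<in> \<Theta>" using \<eta> by simp
  note sq = square_integrable_Y[OF i \<eta>T square_integrable_sc[OF i \<eta>]]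
  have "AE w in M \<eta>. score L i \<eta> (Y i w) = sc i \<eta> (Y i w)"
    using AE_Y[OF i \<eta>T AE_S[OF i \<eta>T]] by eventually_elim (rule score_eq_sc)
  then show ?thesis unfolding info_def by (simp only: cov_matrix_eq_cov[OF sq(1)] sq(2))
qed

lemma info_n_eq:
  assumes \<eta>: "\<eta> \<in> B \<inter> \<Theta>"
  shows "info_n M Y L n \<eta> = (\<Sum>i=1..n. cov (P i \<eta>) (sc i \<eta>))"
proof -
  have \<eta>T: "\<eta> \<in> \<Theta>" using \<eta> by simp
  have sq: "square_integrable (P i \<eta>) (sc i \<eta>)" if "i \<in> {1..n}" for i
    using square_integrable_sc[OF _ \<eta>] that by simp
  have ae: "AE w in M \<eta>. score_n L n \<eta> (\<lambda>i. Y i w) = (\<Sum>i=1..n. sc i \<eta> (Y i w))"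
    using AE_Y_S[OF \<eta>T, of n]
  proof eventually_elim
    case (elim w)
    show ?case by (rule score_n_eq) (use elim \<eta> in blast)+
  qed
  have sqn: "square_integrable (M \<eta>) (\<lambda>w. \<Sum>i=1..n. sc i \<eta> (Y i w))" by (rule sum_cov(1)[OF \<eta>T sq])
  have "info_n M Y L n \<eta> = cov (M \<eta>) (\<lambda>w. \<Sum>i=1..n. sc i \<eta> (Y i w))"
    unfolding info_n_def by (rule cov_matrix_eq_cov[OF sqn ae])
  also have "\<dots> = (\<Sum>i=1..n. cov (P i \<eta>) (sc i \<eta>))" by (rule sum_cov(2)[OF \<eta>T sq])
  finally show ?thesis .
qed

lemma mod_info_n_eq:
  assumes m: "\<And>j. Suc (\<kappa> \<theta>0 n j - 1) \<le> k0" and v: "\<And>j. norm (v \<theta>0 n j) \<le> 1"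
  shows "mod_info_n M Y L \<kappa> v n \<theta>0 = (\<Sum>i=1..n. cov (P i \<theta>0) (gh i (\<lambda>j. \<kappa> \<theta>0 n j - 1) (v \<theta>0 n) \<theta>0))"
proof -
  let ?g = "\<lambda>i. gh i (\<lambda>j. \<kappa> \<theta>0 n j - 1) (v \<theta>0 n) \<theta>0"
  have \<theta>B: "\<theta>0 \<in> B" using \<theta>0_B by simp
  have sq: "square_integrable (P i \<theta>0) (?g i)" if "i \<in> {1..n}" for i
    using gh_props(3)[OF _ m v \<theta>B \<theta>0_B] that by simp
  have ms: "mod_score L \<kappa> v n i \<theta>0 y = ?g i y" if "y \<in> S i" for i y
    using that by (simp add: mod_score_def vec_eq_iff gh_center vpartial_score inner_commute)
  have ae: "AE w in M \<theta>0. mod_score_n L \<kappa> v n \<theta>0 (\<lambda>i. Y i w) = (\<Sum>i=1..n. ?g i (Y i w))"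
    using AE_Y_S[OF \<theta>0, of n] by eventually_elim (auto simp: mod_score_n_def ms intro!: sum.cong)
  have sqn: "square_integrable (M \<theta>0) (\<lambda>w. \<Sum>i=1..n. ?g i (Y i w))" by (rule sum_cov(1)[OF \<theta>0 sq])
  have "mod_info_n M Y L \<kappa> v n \<theta>0 = cov (M \<theta>0) (\<lambda>w. \<Sum>i=1..n. ?g i (Y i w))"
    unfolding mod_info_n_def by (rule cov_matrix_eq_cov[OF sqn ae])
  also have "\<dots> = (\<Sum>i=1..n. cov (P i \<theta>0) (?g i))" by (rule sum_cov(2)[OF \<theta>0 sq])
  finally show ?thesis .
qed

end

section \<open>The test statistic, its extension and its local coverage\<close>

context modified_center
begin

lemma noncritical_iff: "\<eta> \<in> B \<Longrightarrow> \<eta> \<in> noncritical M Y \<Theta> L n \<longleftrightarrow> \<eta> \<in> \<Theta> \<and> invertible (I n \<eta>)"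
  by (auto simp: noncritical_def info_n_eq I_def)

text \<open>The factorization is required for all \<eta> of the ball at once, because the extension
  of the statistic is a limit over \<eta> with the data held fixed.\<close>

definition good_data :: "nat \<Rightarrow> (nat \<Rightarrow> obs) \<Rightarrow> bool" where
  "good_data n y \<longleftrightarrow> (\<forall>i\<in>{1..n}. y i \<in> S i) \<and>
     (\<forall>\<eta>\<in>B. \<forall>j. vv n j \<bullet> (\<Sum>i=1..n. sc i \<eta> (y i)) = d n j \<eta> * (\<Sum>i=1..n. g n i \<eta> (y i)) $ j)"

lemma AE_good_data:
  assumes n: "1 \<le> n" and \<eta>: "\<eta> \<in> \<Theta>"
  shows "AE w in M \<eta>. good_data n (\<lambda>i. Y i w)"
proof -
  obtain c where c: "\<forall>i\<in>{1..n}. AE y in P i \<theta>0. \<forall>\<eta>\<in>B. \<forall>j. vv n j \<bullet> sc i \<eta> y = c i \<eta> j + d n j \<eta> * g n i \<eta> y $ j"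
    "\<forall>\<eta>\<in>B. \<forall>j. (\<Sum>i=1..n. c i \<eta> j) = 0"
    using decomposition[OF n] by blast
  have "AE w in M \<eta>. \<forall>i\<in>{1..n}. \<forall>\<eta>\<in>B. \<forall>j. vv n j \<bullet> sc i \<eta> (Y i w) = c i \<eta> j + d n j \<eta> * g n i \<eta> (Y i w) $ j"
  proof (rule AE_finite_allI[OF finite_atLeastAtMost])
    fix i assume i: "i \<in> {1..n}"
    then have i1: "1 \<le> i" by simp
    show "AE w in M \<eta>. \<forall>\<eta>\<in>B. \<forall>j. vv n j \<bullet> sc i \<eta> (Y i w) = c i \<eta> j + d n j \<eta> * g n i \<eta> (Y i w) $ j"
      by (rule AE_Y[OF i1 \<eta> AE_transfer[OF i1 \<theta>0 \<eta> c(1)[rule_format, OF i]]])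
  qed
  with AE_Y_S[OF \<eta>, of n] show ?thesis
  proof eventually_elim
    case (elim w)
    have "vv n j \<bullet> (\<Sum>i=1..n. sc i \<zeta> (Y i w)) = d n j \<zeta> * (\<Sum>i=1..n. g n i \<zeta> (Y i w)) $ j" if "\<zeta> \<in> B" for \<zeta> j
    proof -
      have "vv n j \<bullet> (\<Sum>i=1..n. sc i \<zeta> (Y i w)) = (\<Sum>i=1..n. c i \<zeta> j + d n j \<zeta> * g n i \<zeta> (Y i w) $ j)"
        unfolding inner_sum_right using elim(2) that by (intro sum.cong refl) blast
      also have "\<dots> = (\<Sum>i=1..n. c i \<zeta> j) + d n j \<zeta> * (\<Sum>i=1..n. g n i \<zeta> (Y i w)) $ j"
        by (simp add: sum.distrib sum_distrib_left)
      finally show ?thesis using c(2) that by simp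
    qed
    with elim(1) show ?case by (simp add: good_data_def)
  qed
qed

text \<open>At non-critical points the statistic is invariant under the linear change of coordinates
  $s_n = V_n D_n \hat g_n$.\<close>

lemma test_stat_eq:
  assumes n: "1 \<le> n" and \<eta>: "\<eta> \<in> B \<inter> \<Theta>" and inv: "invertible (I n \<eta>)" and y: "good_data n y"
  shows "\<exists>q. J n \<eta> *v q = (\<Sum>i=1..n. g n i \<eta> (y i)) \<and> test_stat M Y L n \<eta> y = (\<Sum>i=1..n. g n i \<eta> (y i)) \<bullet> q"
proof -
  define s where "s = (\<Sum>i=1..n. sc i \<eta> (y i))"
  define t where "t = (\<Sum>i=1..n. g n i \<eta> (y i))"
  define x where "x = matrix_inv (I n \<eta>) *v s"
  have s: "score_n L n \<eta> y = s"
    unfolding s_def using \<eta> y by (intro score_n_eq) (auto simp: good_data_def)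
  have i: "info_n M Y L n \<eta> = I n \<eta>" by (simp add: info_n_eq[OF \<eta>] I_def)
  have T: "test_stat M Y L n \<eta> y = s \<bullet> x" by (simp add: test_stat_def s i x_def)
  have Ix: "I n \<eta> *v x = s" unfolding x_def by (rule matrix_inv_vector[OF inv])
  have st: "u \<bullet> s = Z n \<eta> u \<bullet> t" for u
    using inner_Z[OF n, of s "\<lambda>_. 0" \<eta> t u] y \<eta> by (simp add: good_data_def s_def t_def)
  have "z \<bullet> (J n \<eta> *v Z n \<eta> x) = z \<bullet> t" for z
  proof -
    \<comment> \<open>Preimage of \<open>z\<close> under \<open>Z n \<eta>\<close>, which is
      bijective at non-critical points; so the equation may be tested against every
      \<open>z\<close>.\<close>
    define u where "u = (\<Sum>j\<in>UNIV. (z $ j / d n j \<eta>) *\<^sub>R vv n j)"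
    have "vv n j \<bullet> u = z $ j / d n j \<eta>" for j
      by (simp add: u_def inner_sum_right vv[OF n] if_distrib cong: if_cong)
    then have Zu: "Z n \<eta> u = z" using d_nonzero[OF n \<eta> inv] by (simp add: Z_def vec_eq_iff)
    show ?thesis using I_J[OF n \<eta>, of u x] st[of u] unfolding Ix Zu by simp
  qed
  then have "J n \<eta> *v Z n \<eta> x = t" by (metis vector_eq_rdot inner_commute)
  moreover have "s \<bullet> x = t \<bullet> Z n \<eta> x" using st[of x] by (simp add: inner_commute)
  ultimately show ?thesis unfolding T t_def by blast
qed

text \<open>At non-critical points coercivity makes the solution \<open>q\<close> unique, and
  \<open>test_stat_eq\<close> applies. At a critical point the filter is nontrivial because
  non-critical points accumulate there; matrices and right-hand sides are continuous, and coercivity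
  carries the convergence over to the solutions.\<close>

lemma test_stat_ext_eq:
  assumes n: "1 \<le> n" and c: "0 < c" and r: "r \<le> \<rho>0"
    and coer: "\<forall>\<eta>\<in>\<Theta>. dist \<eta> \<theta>0 < r \<longrightarrow> (\<forall>x. c * real n * (norm x)\<^sup>2 \<le> x \<bullet> (J n \<eta> *v x))"
    and \<zeta>: "\<zeta> \<in> \<Theta>" "dist \<zeta> \<theta>0 < r" and y: "good_data n y"
    and q: "J n \<zeta> *v q = (\<Sum>i=1..n. g n i \<zeta> (y i))"
  shows "test_stat_ext M Y \<Theta> L n \<zeta> y = (\<Sum>i=1..n. g n i \<zeta> (y i)) \<bullet> q"
proof -
  have inB: "\<eta> \<in> B" if "dist \<eta> \<theta>0 < r" for \<eta> using that r by (simp add: dist_commute)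
  have \<zeta>B: "\<zeta> \<in> B \<inter> \<Theta>" using inB \<zeta> by simp
  have cn: "0 < c * real n" using c n by simp
  have uniq: "q1 = q2" if "J n \<eta> *v q1 = J n \<eta> *v q2" "\<eta> \<in> \<Theta>" "dist \<eta> \<theta>0 < r" for q1 q2 \<eta>
  proof -
    have "c * real n * (norm (q1 - q2))\<^sup>2 \<le> (q1 - q2) \<bullet> (J n \<eta> *v (q1 - q2))" using coer that by blast
    also have "\<dots> = 0" using that(1) by (simp add: matrix_vector_mult_diff_distrib)
    finally have "(norm (q1 - q2))\<^sup>2 \<le> 0"
      using mult_le_cancel_left_pos[OF cn, of "(norm (q1 - q2))\<^sup>2" 0] by (simp only: mult_zero_right)
    then show ?thesis by simp
  qed
  define t where "t \<eta> = (\<Sum>i=1..n. g n i \<eta> (y i))" for \<eta>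
  define NC where "NC = noncritical M Y \<Theta> L n"
  show ?thesis
  proof (cases "\<zeta> \<in> NC")
    case True
    then have inv: "invertible (I n \<zeta>)" using noncritical_iff \<zeta>B by (simp add: NC_def)
    obtain q' where q': "J n \<zeta> *v q' = t \<zeta>" "test_stat M Y L n \<zeta> y = t \<zeta> \<bullet> q'"
      using test_stat_eq[OF n \<zeta>B inv y] by (auto simp: t_def)
    have "q' = q" using uniq[OF _ \<zeta>] q' q by (simp add: t_def)
    with q'(2) True show ?thesis by (simp add: test_stat_ext_def NC_def t_def)
  next
    case False
    let ?F = "at \<zeta> within NC"
    obtain \<phi> where \<phi>: "\<forall>a. \<phi> a \<in> B \<inter> \<Theta> \<and> invertible (I n (\<phi> a))" "\<phi> \<longlonglongrightarrow> \<zeta>"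
      using dense[OF n \<zeta>B] unfolding I_def by blast
    then have "\<forall>a. \<phi> a \<in> NC - {\<zeta>}" using noncritical_iff False by (auto simp: NC_def)
    then have nt: "\<not> trivial_limit ?F"
      unfolding trivial_limit_within islimpt_sequential using \<phi>(2) by blast
    have near: "\<forall>\<^sub>F \<eta> in ?F. \<eta> \<in> NC \<and> dist \<eta> \<theta>0 < r"
    proof -
      have "\<forall>\<^sub>F \<eta> in ?F. \<eta> \<in> ball \<theta>0 r"
        using \<zeta>(2) by (intro topological_tendstoD[OF tendsto_ident_at]) (auto simp: dist_commute)
      moreover have "\<forall>\<^sub>F \<eta> in ?F. \<eta> \<in> NC" by (simp add: eventually_at_filter)
      ultimately show ?thesis by eventually_elim (simp add: dist_commute)
    qed
    have sub: "NC \<subseteq> \<Theta>" by (auto simp: NC_def noncritical_def)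
    have F_eq: "?F = at \<zeta> within (NC \<inter> B)" using \<zeta>B by (intro at_within_nhd[of _ B]) auto
    have Jl: "(J n \<longlongrightarrow> J n \<zeta>) ?F"
    proof -
      have "(J n \<longlongrightarrow> J n \<zeta>) (at \<zeta> within (B \<inter> \<Theta>))"
        using J_continuous[OF n] \<zeta>B by (simp add: continuous_on_def)
      then show ?thesis unfolding F_eq by (rule tendsto_within_subset) (use sub in auto)
    qed
    have tl: "(t \<longlongrightarrow> t \<zeta>) ?F"
    proof -
      have "continuous_on B (\<lambda>\<eta>. g n i \<eta> (y i))" if "1 \<le> i" for i
        unfolding continuous_on_sequentially o_def
      proof (intro allI ballI impI)
        fix x and a :: "real ^ 'd" assume a: "a \<in> B" and x: "(\<forall>k. x k \<in> B) \<and> x \<longlonglongrightarrow> a"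
        show "(\<lambda>k. g n i (x k) (y i)) \<longlonglongrightarrow> g n i a (y i)"
          by (rule gh_tendsto[OF that mm[OF n] _ a]) (use x in blast)+
      qed
      then have "continuous_on B t" unfolding t_def by (intro continuous_on_sum) auto
      then have "(t \<longlongrightarrow> t \<zeta>) (at \<zeta> within B)" using \<zeta>B by (simp add: continuous_on_def)
      then show ?thesis unfolding F_eq by (rule tendsto_within_subset) auto
    qed
    have "\<forall>\<eta>. \<exists>q. \<eta> \<in> NC \<and> dist \<eta> \<theta>0 < r \<longrightarrow> J n \<eta> *v q = t \<eta> \<and> test_stat M Y L n \<eta> y = t \<eta> \<bullet> q"
    proof
      fix \<eta>
      show "\<exists>q. \<eta> \<in> NC \<and> dist \<eta> \<theta>0 < r \<longrightarrow> J n \<eta> *v q = t \<eta> \<and> test_stat M Y L n \<eta> y = t \<eta> \<bullet> q"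
      proof (cases "\<eta> \<in> NC \<and> dist \<eta> \<theta>0 < r")
        case True
        then have "\<eta> \<in> B \<inter> \<Theta>" "invertible (I n \<eta>)" using noncritical_iff inB sub by (auto simp: NC_def)
        from test_stat_eq[OF n this y] show ?thesis by (auto simp: t_def)
      qed blast
    qed
    from choice[OF this] obtain Q where Q: "\<forall>\<eta>. \<eta> \<in> NC \<and> dist \<eta> \<theta>0 < r \<longrightarrow> J n \<eta> *v Q \<eta> = t \<eta> \<and> test_stat M Y L n \<eta> y = t \<eta> \<bullet> Q \<eta>"
      by blast
    have "(Q \<longlongrightarrow> q) ?F"
    proof (rule coercive_solution_tendsto[OF cn _ Jl tl])
      show "\<forall>\<^sub>F \<eta> in ?F. \<forall>u. c * real n * (norm u)\<^sup>2 \<le> u \<bullet> (J n \<eta> *v u)"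
        using near by eventually_elim (use coer sub in auto)
      show "\<forall>\<^sub>F \<eta> in ?F. J n \<eta> *v Q \<eta> = t \<eta>" using near by eventually_elim (use Q in auto)
      show "J n \<zeta> *v q = t \<zeta>" using q by (simp add: t_def)
    qed
    then have lim: "((\<lambda>\<eta>. t \<eta> \<bullet> Q \<eta>) \<longlongrightarrow> t \<zeta> \<bullet> q) ?F" by (intro tendsto_inner tl)
    have ev: "\<forall>\<^sub>F \<eta> in ?F. t \<eta> \<bullet> Q \<eta> = test_stat M Y L n \<eta> y"
      using near by eventually_elim (use Q in auto)
    have "((\<lambda>\<eta>. test_stat M Y L n \<eta> y) \<longlongrightarrow> t \<zeta> \<bullet> q) ?F"
      by (rule Lim_transform_eventually[OF lim ev])
    then have "Lim ?F (\<lambda>\<eta>. test_stat M Y L n \<eta> y) = t \<zeta> \<bullet> q" by (rule tendsto_Lim[OF nt])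
    with False show ?thesis by (simp add: test_stat_ext_def NC_def t_def)
  qed
qed

text \<open>The mean of one summand can be nonzero, as the constants c vanish only in the sum.
  Centring restores the hypotheses of the limit theorem and leaves the total unchanged.\<close>

definition mean :: "nat \<Rightarrow> nat \<Rightarrow> real ^ 'd \<Rightarrow> real ^ 'd" where
  "mean n i \<eta> = (\<chi> j. \<integral>y. g n i \<eta> y $ j \<partial>P i \<eta>)"

text \<open>CARD('d) * (1 + Kg) =: k bounds the norm of \<open>mean\<close>, and norm (x - mean)
  \<le> 2 * (k + 1) * max (norm x) 1. The last factor bounds the integral of 1 + (norm of g) powr p
  + 1.\<close>

definition Kc :: "real \<Rightarrow> real" where
  "Kc p' = (2 * (real CARD('d) * (1 + Kg) + 1)) powr p' * (1 + Kg + 1)"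

lemma sum_mean: "1 \<le> n \<Longrightarrow> \<eta> \<in> B \<inter> \<Theta> \<Longrightarrow> (\<Sum>i=1..n. mean n i \<eta>) = 0"
  using g_mean_zero[of n \<eta>] by (simp add: mean_def vec_eq_iff)

lemma centered_moment:
  assumes n: "1 \<le> n" and i: "1 \<le> i" and \<eta>: "\<eta> \<in> B \<inter> \<Theta>" and p': "2 < p'" "p' \<le> p"
  shows "integrable (P i \<eta>) (\<lambda>y. norm (g n i \<eta> y - mean n i \<eta>) powr p')"
    "(\<integral>y. norm (g n i \<eta> y - mean n i \<eta>) powr p' \<partial>P i \<eta>) \<le> Kc p'"
    "(\<integral>y. u \<bullet> (g n i \<eta> y - mean n i \<eta>) \<partial>P i \<eta>) = 0"
    "(\<integral>y. (u \<bullet> (g n i \<eta> y - mean n i \<eta>))\<^sup>2 \<partial>P i \<eta>) = u \<bullet> (cov (P i \<eta>) (g n i \<eta>) *v u)"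
proof -
  have \<eta>T: "\<eta> \<in> \<Theta>" "\<eta> \<in> B" using \<eta> by auto
  interpret prob_space "P i \<eta>" by (rule prob_law[OF i \<eta>T(1)])
  have ps: "prob (space (\<gamma> i)) = 1" using prob_space by simp
  note gp = gh_props[OF i mm[OF n] norm_vv_le[OF n] \<eta>T(2)]
  note gi = square_integrable_moment(2,3)[OF i \<eta>T(1) gp(1) gp(2)[OF \<eta>]]
  have sq: "square_integrable (P i \<eta>) (g n i \<eta>)" by (rule gp(3)[OF \<eta>])
  have gm[measurable]: "g n i \<eta> \<in> borel_measurable (P i \<eta>)" using gp(1) by (simp cong: measurable_cong_sets)
  define k where "k = real CARD('d) * (1 + Kg)"
  have k0: "0 \<le> k" using Kg by (simp add: k_def)
  have pw: "x powr a \<le> 1 + x powr p" if "0 \<le> x" "0 \<le> a" "a \<le> p" for x a :: real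
  proof (cases "x \<le> 1")
    case True
    then have "x powr a \<le> 1 powr a" using that by (intro powr_mono2) auto
    moreover have "0 \<le> x powr p" by simp
    ultimately show ?thesis unfolding powr_one_eq_one by linarith
  next
    case False
    then have "x powr a \<le> x powr p" using that by (intro powr_mono) auto
    then show ?thesis by linarith
  qed
  have mean_bound: "norm (mean n i \<eta>) \<le> k"
  proof -
    have "\<bar>mean n i \<eta> $ j\<bar> \<le> 1 + Kg" for j
    proof -
      have "\<bar>mean n i \<eta> $ j\<bar> \<le> (\<integral>y. \<bar>g n i \<eta> y $ j\<bar> \<partial>P i \<eta>)"
        unfolding mean_def by (simp add: integral_abs_bound)
      also have "\<dots> \<le> (\<integral>y. 1 + norm (g n i \<eta> y) powr p \<partial>P i \<eta>)"
      proof (rule integral_mono)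
        show "integrable (P i \<eta>) (\<lambda>y. \<bar>g n i \<eta> y $ j\<bar>)" using square_integrable_inner(3)[OF sq] by simp
        show "integrable (P i \<eta>) (\<lambda>y. 1 + norm (g n i \<eta> y) powr p)" using gi(1) by simp
        show "\<bar>g n i \<eta> y $ j\<bar> \<le> 1 + norm (g n i \<eta> y) powr p" for y
          using component_le_norm_cart[of "g n i \<eta> y" j] pw[of "norm (g n i \<eta> y)" 1] p by simp
      qed
      also have "\<dots> \<le> 1 + Kg" using gi Kg by (simp add: ps)
      finally show ?thesis .
    qed
    then have "(\<Sum>j\<in>UNIV. \<bar>mean n i \<eta> $ j\<bar>) \<le> (\<Sum>j\<in>(UNIV::'d set). 1 + Kg)" by (intro sum_mono)
    with norm_le_l1_cart[of "mean n i \<eta>"] show ?thesis by (simp add: k_def)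
  qed
  have pt: "norm (x - mean n i \<eta>) powr p' \<le> (2 * (k + 1)) powr p' * (1 + norm x powr p + 1)" for x
  proof -
    have "norm (x - mean n i \<eta>) \<le> norm x + k" using norm_triangle_ineq4[of x "mean n i \<eta>"] mean_bound by linarith
    also have "\<dots> \<le> (2 * (k + 1)) * max (norm x) 1"
    proof -
      have "norm x \<le> 1 * max (norm x) 1" "k \<le> k * max (norm x) 1"
        using k0 mult_left_mono[of 1 "max (norm x) 1" k] by auto
      moreover have "0 \<le> k * max (norm x) 1" using k0 by (intro mult_nonneg_nonneg) auto
      moreover have "(2 * (k + 1)) * max (norm x) 1 = 2 * (k * max (norm x) 1) + 2 * max (norm x) 1" by (simp add: algebra_simps)
      ultimately show ?thesis by linarith
    qed
    finally have "norm (x - mean n i \<eta>) powr p' \<le> ((2 * (k + 1)) * max (norm x) 1) powr p'"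
      using p' by (intro powr_mono2) auto
    also have "\<dots> = (2 * (k + 1)) powr p' * max (norm x) 1 powr p'" using k0 by (simp add: powr_mult)
    also have "max (norm x) 1 powr p' \<le> 1 + norm x powr p + 1"
      using pw[of "norm x" p'] p' by (auto simp: max_def intro: add_increasing)
    finally show ?thesis by (simp add: mult_left_mono)
  qed
  have bi: "integrable (P i \<eta>) (\<lambda>y. (2 * (k + 1)) powr p' * (1 + norm (g n i \<eta> y) powr p + 1))"
    using gi(1) by simp
  show ci: "integrable (P i \<eta>) (\<lambda>y. norm (g n i \<eta> y - mean n i \<eta>) powr p')"
    by (rule Bochner_Integration.integrable_bound[OF bi]) (use pt in \<open>auto intro!: AE_I2 order_trans[OF _ abs_ge_self]\<close>)
  have "(\<integral>y. norm (g n i \<eta> y - mean n i \<eta>) powr p' \<partial>P i \<eta>) \<le> (\<integral>y. (2 * (k + 1)) powr p' * (1 + norm (g n i \<eta> y) powr p + 1) \<partial>P i \<eta>)"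
    using ci bi pt by (intro integral_mono)
  also have "\<dots> = (2 * (k + 1)) powr p' * (1 + (\<integral>y. norm (g n i \<eta> y) powr p \<partial>P i \<eta>) + 1)"
    using gi(1) by (simp add: ps)
  also have "\<dots> \<le> (2 * (k + 1)) powr p' * (1 + Kg + 1)" using gi(2) Kg by (intro mult_left_mono add_mono) auto
  finally show "(\<integral>y. norm (g n i \<eta> y - mean n i \<eta>) powr p' \<partial>P i \<eta>) \<le> Kc p'" by (simp add: Kc_def k_def)
  have um: "u \<bullet> mean n i \<eta> = (\<integral>y. u \<bullet> g n i \<eta> y \<partial>P i \<eta>)"
    using square_integrable_inner(3)[OF sq] by (simp add: mean_def inner_vec_def)
  show "(\<integral>y. u \<bullet> (g n i \<eta> y - mean n i \<eta>) \<partial>P i \<eta>) = 0"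
    using square_integrable_inner(1)[OF sq, of u] by (simp add: inner_diff_right um ps)
  show "(\<integral>y. (u \<bullet> (g n i \<eta> y - mean n i \<eta>))\<^sup>2 \<partial>P i \<eta>) = u \<bullet> (cov (P i \<eta>) (g n i \<eta>) *v u)"
    unfolding cov_inner_centered[OF sq] inner_diff_right um power2_eq_square ..
qed

lemma standardizable:
  assumes n: "1 \<le> n" and \<eta>: "\<eta> \<in> B \<inter> \<Theta>" and p': "2 < p'" "p' \<le> p"
    and coer: "\<And>x. c * real n * (norm x)\<^sup>2 \<le> x \<bullet> (J n \<eta> *v x)"
  shows "standardizable_sum p' c (Kc p') n (M \<eta>) (\<lambda>i w. g n i \<eta> (Y i w) - mean n i \<eta>) (J n \<eta>)"
proof -
  have \<eta>T: "\<eta> \<in> \<Theta>" "\<eta> \<in> B" using \<eta> by auto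
  have gm: "g n i \<eta> \<in> borel_measurable (\<gamma> i)" if "i \<in> {1..n}" for i
    using gh_props(1)[OF _ mm[OF n] norm_vv_le[OF n] \<eta>T(2)] that by simp
  have trans: "(\<integral>w. h (Y i w) \<partial>M \<eta>) = (\<integral>y. h y \<partial>P i \<eta>)" "integrable (M \<eta>) (\<lambda>w. h (Y i w)) \<longleftrightarrow> integrable (P i \<eta>) h"
    if "i \<in> {1..n}" "h \<in> borel_measurable (\<gamma> i)" for h :: "obs \<Rightarrow> real" and i
  proof -
    have i: "1 \<le> i" using that by simp
    show "(\<integral>w. h (Y i w) \<partial>M \<eta>) = (\<integral>y. h y \<partial>P i \<eta>)" "integrable (M \<eta>) (\<lambda>w. h (Y i w)) \<longleftrightarrow> integrable (P i \<eta>) h"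
      unfolding law_distr[OF i \<eta>T(1)]
      by (rule integral_distr[OF Y_measurable[OF i \<eta>T(1)] that(2), symmetric],
          rule integrable_distr_eq[OF Y_measurable[OF i \<eta>T(1)] that(2), symmetric])
  qed
  have cm: "(\<lambda>y. g n i \<eta> y - mean n i \<eta>) \<in> borel_measurable (\<gamma> i)" if "i \<in> {1..n}" for i
    using gm[OF that] by measurable
  show ?thesis
    unfolding standardizable_sum_def
  proof (intro conjI ballI allI)
    show "prob_space (M \<eta>)" by (rule prob_M[OF \<eta>T(1)])
    show "prob_space.indep_vars (M \<eta>) (\<lambda>_. borel) (\<lambda>i w. g n i \<eta> (Y i w) - mean n i \<eta>) {1..n}"
      by (rule indep_transformed[OF \<eta>T(1) cm])
    fix i assume i: "i \<in> {1..n}"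
    then have i1: "1 \<le> i" by simp
    note [measurable] = cm[OF i]
    note C = centered_moment[OF n i1 \<eta> p']
    have m1: "(\<lambda>y. norm (g n i \<eta> y - mean n i \<eta>) powr p') \<in> borel_measurable (\<gamma> i)" by measurable
    show "integrable (M \<eta>) (\<lambda>w. norm (g n i \<eta> (Y i w) - mean n i \<eta>) powr p')"
      using trans(2)[OF i m1] C(1) by simp
    show "(\<integral>w. norm (g n i \<eta> (Y i w) - mean n i \<eta>) powr p' \<partial>M \<eta>) \<le> Kc p'"
      using trans(1)[OF i m1] C(2) by simp
    show "(\<integral>w. u \<bullet> (g n i \<eta> (Y i w) - mean n i \<eta>) \<partial>M \<eta>) = 0" for u
    proof -
      have "(\<lambda>y. u \<bullet> (g n i \<eta> y - mean n i \<eta>)) \<in> borel_measurable (\<gamma> i)" by measurable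
      from trans(1)[OF i this] C(3)[of u] show ?thesis by simp
    qed
  next
    show "u \<bullet> (J n \<eta> *v u) = (\<Sum>i=1..n. \<integral>w. (u \<bullet> (g n i \<eta> (Y i w) - mean n i \<eta>))\<^sup>2 \<partial>M \<eta>)" for u
      unfolding J_inner
    proof (rule sum.cong[OF refl])
      fix i assume i: "i \<in> {1..n}"
      then have i1: "1 \<le> i" by simp
      note [measurable] = cm[OF i]
      have "(\<lambda>y. (u \<bullet> (g n i \<eta> y - mean n i \<eta>))\<^sup>2) \<in> borel_measurable (\<gamma> i)" by measurable
      from trans(1)[OF i this] centered_moment(4)[OF n i1 \<eta> p', of u]
      show "u \<bullet> (cov (P i \<eta>) (g n i \<eta>) *v u) = (\<integral>w. (u \<bullet> (g n i \<eta> (Y i w) - mean n i \<eta>))\<^sup>2 \<partial>M \<eta>)" by simp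
    qed
    show "x \<bullet> (J n \<eta> *v y) = y \<bullet> (J n \<eta> *v x)" for x y by (rule J_sym[OF n \<eta>])
    show "c * real n * (norm u)\<^sup>2 \<le> u \<bullet> (J n \<eta> *v u)" for u by (rule coer)
  qed
qed

text \<open>The radius comes from \<open>J_uniformly_coercive\<close> and so does not depend on n;
  \<open>n0\<close> comes from \<open>uniform_clt\<close> and depends only on the constants valid
  within that radius.\<close>

lemma local_uniform_coverage:
  assumes e: "0 < e" and \<alpha>: "0 < \<alpha>" "\<alpha> < 1"
  shows "\<exists>r n0. 0 < r \<and> (\<forall>n\<ge>n0. \<forall>\<eta>\<in>\<Theta>. dist \<eta> \<theta>0 < r \<longrightarrow>
    \<bar>measure (completion (M \<eta>)) {w \<in> space (M \<eta>). test_stat_ext M Y \<Theta> L n \<eta> (\<lambda>i. Y i w)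
        \<le> quantile (chi_square CARD('d)) (1 - \<alpha>)} - (1 - \<alpha>)\<bar> < e)"
proof -
  obtain c r where cr: "0 < c" "0 < r" "r \<le> \<rho>0"
    "\<forall>n\<ge>1. \<forall>\<eta>\<in>\<Theta>. dist \<eta> \<theta>0 < r \<longrightarrow> (\<forall>x. c * real n * (norm x)\<^sup>2 \<le> x \<bullet> (J n \<eta> *v x))"
    using J_uniformly_coercive by blast
  \<comment> \<open>The characteristic function bound works for exponents in (2,3]; moments of order
    p control those of order \<open>p'\<close>.\<close>
  define p' where "p' = min p 3"
  have p': "2 < p'" "p' \<le> 3" "p' \<le> p" using p by (auto simp: p'_def)
  obtain n0 where n0: "\<forall>n P (\<xi> :: nat \<Rightarrow> 'w \<Rightarrow> real ^ 'd) A x. n0 \<le> n \<longrightarrow> standardizable_sum p' c (Kc p') n P \<xi> A \<longrightarrow>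
     (\<forall>w. A *v x w = (\<Sum>i=1..n. \<xi> i w)) \<longrightarrow>
     \<bar>measure P {w \<in> space P. (\<Sum>i=1..n. \<xi> i w) \<bullet> x w \<le> quantile (chi_square CARD('d)) (1 - \<alpha>)} - (1 - \<alpha>)\<bar> < e"
    using uniform_clt[OF p'(1,2) cr(1) e \<alpha>] by blast
  have "\<bar>measure (completion (M \<eta>)) {w \<in> space (M \<eta>). test_stat_ext M Y \<Theta> L n \<eta> (\<lambda>i. Y i w)
        \<le> quantile (chi_square CARD('d)) (1 - \<alpha>)} - (1 - \<alpha>)\<bar> < e"
    if nn: "max n0 1 \<le> n" and \<eta>: "\<eta> \<in> \<Theta>" "dist \<eta> \<theta>0 < r" for n \<eta>
  proof -
    have n: "1 \<le> n" "n0 \<le> n" using nn by auto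
    have \<eta>B: "\<eta> \<in> B \<inter> \<Theta>" using \<eta> cr(3) by (simp add: dist_commute)
    have coer: "\<forall>\<eta>\<in>\<Theta>. dist \<eta> \<theta>0 < r \<longrightarrow> (\<forall>x. c * real n * (norm x)\<^sup>2 \<le> x \<bullet> (J n \<eta> *v x))"
      using cr(4) n by blast
    have coer': "c * real n * (norm x)\<^sup>2 \<le> x \<bullet> (J n \<eta> *v x)" for x using coer \<eta> by blast
    have "invertible (J n \<eta>)"
      unfolding invertible_iff_ker
    proof (intro allI impI)
      fix x assume "J n \<eta> *v x = 0"
      then have "c * real n * (norm x)\<^sup>2 \<le> 0" using coer'[of x] by simp
      then show "x = 0" using cr(1) n by (simp add: mult_le_0_iff)
    qed
    note inv = matrix_inv_vector[OF this]
    define \<xi> where "\<xi> i w = g n i \<eta> (Y i w) - mean n i \<eta>" for i w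
    define x where "x w = matrix_inv (J n \<eta>) *v (\<Sum>i=1..n. \<xi> i w)" for w
    have st: "standardizable_sum p' c (Kc p') n (M \<eta>) \<xi> (J n \<eta>)"
      unfolding \<xi>_def by (rule standardizable[OF n(1) \<eta>B p'(1,3) coer'])
    have Jx: "J n \<eta> *v x w = (\<Sum>i=1..n. \<xi> i w)" for w unfolding x_def by (rule inv)
    \<comment> \<open>The subtracted means add up to 0, so the centred sum is the one occurring in
      the statistic.\<close>
    have sum_\<xi>: "(\<Sum>i=1..n. \<xi> i w) = (\<Sum>i=1..n. g n i \<eta> (Y i w))" for w
      using sum_mean[OF n(1) \<eta>B] by (simp add: \<xi>_def sum_subtractf)
    have "AE w in M \<eta>. test_stat_ext M Y \<Theta> L n \<eta> (\<lambda>i. Y i w) = (\<Sum>i=1..n. \<xi> i w) \<bullet> x w"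
      using AE_good_data[OF n(1) \<eta>(1)]
    proof eventually_elim
      case (elim w)
      show ?case unfolding sum_\<xi>
        by (rule test_stat_ext_eq[OF n(1) cr(1,3) coer \<eta> elim]) (use Jx[of w] sum_\<xi> in simp)
    qed
    then have "measure (completion (M \<eta>)) {w \<in> space (M \<eta>). test_stat_ext M Y \<Theta> L n \<eta> (\<lambda>i. Y i w)
        \<le> quantile (chi_square CARD('d)) (1 - \<alpha>)}
      = measure (M \<eta>) {w \<in> space (M \<eta>). (\<Sum>i=1..n. \<xi> i w) \<bullet> x w \<le> quantile (chi_square CARD('d)) (1 - \<alpha>)}"
      by (intro measure_completion_AE_eq prob_M \<eta>(1) uniform_laplace_bound(1)[OF st p'(1,2) cr(1) n(1) Jx])
    then show ?thesis using n0[rule_format, OF n(2) st Jx] by simp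
  qed
  then show ?thesis using cr(2) by blast
qed

end

section \<open>Coverage on compact sets\<close>

lemma law_AE_transfer:
  assumes "common_null_sets \<Theta> \<gamma> f" "1 \<le> i" "\<theta> \<in> \<Theta>" "\<theta>' \<in> \<Theta>" "AE y in law \<gamma> f i \<theta>. Q y"
  shows "AE y in law \<gamma> f i \<theta>'. Q y"
proof -
  have "null_sets (law \<gamma> f i \<theta>) = null_sets (law \<gamma> f i \<theta>')"
    using assms(1-4) unfolding common_null_sets_def by blast
  with assms(5) show ?thesis unfolding eventually_ae_filter by (simp add: law_def)
qed

text \<open>Relates the product sigma-algebra over n coordinates to the Borel sets of functions on
  all of \<open>nat\<close>: elements of the product space are extensional, so the remaining
  coordinates are constantly \<open>undefined\<close>.\<close>

lemma identity_borel_measurable_PiM: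
  "(\<lambda>y. y) \<in> borel_measurable (\<Pi>\<^sub>M j\<in>{..<n::nat}. (borel :: real measure))"
proof (rule measurable_coordinatewise_then_product)
  fix k
  show "(\<lambda>y. y k) \<in> borel_measurable (\<Pi>\<^sub>M j\<in>{..<n}. (borel :: real measure))"
  proof (cases "k < n")
    case True
    then show ?thesis by (intro measurable_component_singleton) auto
  next
    case False
    then have "y k = undefined" if "y \<in> space (\<Pi>\<^sub>M j\<in>{..<n}. (borel :: real measure))" for y
      using that by (auto simp: space_PiM PiE_def extensional_def)
    then show ?thesis by (rule measurable_cong[THEN iffD2]) simp_all
  qed
qed

lemma parameter_center_exists:
  fixes \<Theta> :: "(real ^ 'd) set" and M :: "real ^ 'd \<Rightarrow> 'w measure"
  assumes im: "independent_model M Y \<Theta> r \<gamma> f" and pd: "partials_determined \<Theta>"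
    and cn: "common_null_sets \<Theta> \<gamma> f" and sm: "smooth_with_moments \<Theta> \<gamma> f L \<rho> k \<delta>"
    and \<theta>0: "\<theta>0 \<in> \<Theta>"
  shows "\<exists>S K. parameter_center \<Theta> M Y \<gamma> f L \<theta>0 (\<rho> \<theta>0) (k \<theta>0) (2 + \<delta> \<theta>0) K S"
proof -
  let ?B = "ball \<theta>0 (\<rho> \<theta>0)"
  define good where "good i A \<longleftrightarrow>
      (\<forall>y\<in>A. \<forall>\<theta> \<in> ?B \<inter> \<Theta>. 0 < f i \<theta> y \<and> L i \<theta> y = ln (f i \<theta> y)) \<and>
      (\<forall>y\<in>A. \<forall>\<theta> \<in> ?B. \<forall>js j. length js < k \<theta>0 \<longrightarrow> has_partial j (partials js (\<lambda>\<eta>. L i \<eta> y)) \<theta>) \<and>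
      (\<forall>js. 1 \<le> length js \<and> length js \<le> k \<theta>0 \<longrightarrow>
         continuous_on (?B \<times> A) (\<lambda>(\<theta>, y). partials js (\<lambda>\<eta>. L i \<eta> y) \<theta>))" for i A
  have sm0: "0 < \<rho> \<theta>0" "2 \<le> k \<theta>0" "0 < \<delta> \<theta>0"
    "\<forall>i\<ge>1. \<exists>A\<subseteq>space (\<gamma> i). (AE y in law \<gamma> f i \<theta>0. y \<in> A) \<and> good i A"
    and sup: "\<forall>js. length js \<le> k \<theta>0 \<longrightarrow>
          (SUP i\<in>{1..}. SUP (\<theta>, \<theta>t) \<in> (?B \<inter> \<Theta>) \<times> ?B.
             \<integral>\<^sup>+y. ennreal (\<bar>partials js (\<lambda>\<eta>. L i \<eta> y) \<theta>t\<bar> powr (2 + \<delta> \<theta>0)) \<partial>law \<gamma> f i \<theta>) < \<infinity>"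
    using sm[unfolded smooth_with_moments_def, rule_format, OF \<theta>0] unfolding good_def by blast+
  have "\<forall>i. \<exists>S. 1 \<le> i \<longrightarrow> S \<in> sets (\<gamma> i) \<and> (AE y in law \<gamma> f i \<theta>0. y \<in> S) \<and> good i S"
  proof
    fix i
    show "\<exists>S. 1 \<le> i \<longrightarrow> S \<in> sets (\<gamma> i) \<and> (AE y in law \<gamma> f i \<theta>0. y \<in> S) \<and> good i S"
    proof (cases "1 \<le> i")
      case True
      then obtain A where A: "A \<subseteq> space (\<gamma> i)" "AE y in law \<gamma> f i \<theta>0. y \<in> A" "good i A" using sm0(4) by blast
      from A(2) obtain N where N: "{y \<in> space (law \<gamma> f i \<theta>0). \<not> y \<in> A} \<subseteq> N" "N \<in> null_sets (law \<gamma> f i \<theta>0)"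
        unfolding eventually_ae_filter by blast
      \<comment> \<open>The given set of full measure need not be measurable; removing a measurable
        null set that covers its complement yields a measurable subset of it.\<close>
      define S where "S = space (\<gamma> i) - N"
      have SA: "S \<subseteq> A" using N(1) by (auto simp: S_def law_def)
      have "S \<in> sets (\<gamma> i)" using null_setsD2[OF N(2)] by (auto simp: S_def law_def)
      moreover have "AE y in law \<gamma> f i \<theta>0. y \<in> S"
        using AE_not_in[OF N(2)] by (auto simp: S_def law_def elim!: AE_mp intro!: AE_I2)
      moreover have "good i S"
        unfolding good_def
      proof (intro conjI)
        show "\<forall>js. 1 \<le> length js \<and> length js \<le> k \<theta>0 \<longrightarrow>
            continuous_on (?B \<times> S) (\<lambda>(\<theta>, y). partials js (\<lambda>\<eta>. L i \<eta> y) \<theta>)"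
        proof (intro allI impI)
          fix js :: "'d list" assume "1 \<le> length js \<and> length js \<le> k \<theta>0"
          then have "continuous_on (?B \<times> A) (\<lambda>(\<theta>, y). partials js (\<lambda>\<eta>. L i \<eta> y) \<theta>)"
            using A(3) unfolding good_def by blast
          then show "continuous_on (?B \<times> S) (\<lambda>(\<theta>, y). partials js (\<lambda>\<eta>. L i \<eta> y) \<theta>)"
            by (rule continuous_on_subset) (use SA in auto)
        qed
      qed (use A(3) SA in \<open>unfold good_def, blast+\<close>)
      ultimately show ?thesis by blast
    qed simp
  qed
  from choice[OF this] obtain S where S: "\<forall>i. 1 \<le> i \<longrightarrow> S i \<in> sets (\<gamma> i) \<and> (AE y in law \<gamma> f i \<theta>0. y \<in> S i) \<and> good i (S i)"
    by blast
  have S1: "S i \<in> sets (\<gamma> i)" "AE y in law \<gamma> f i \<theta>0. y \<in> S i" "good i (S i)" if "1 \<le> i" for i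
    using S that by blast+
  define W where "W js = (SUP i\<in>{1..}. SUP (\<theta>, \<theta>t) \<in> (?B \<inter> \<Theta>) \<times> ?B.
             \<integral>\<^sup>+y. ennreal (\<bar>partials js (\<lambda>\<eta>. L i \<eta> y) \<theta>t\<bar> powr (2 + \<delta> \<theta>0)) \<partial>law \<gamma> f i \<theta>)" for js
  define Js where "Js = {js :: 'd list. set js \<subseteq> UNIV \<and> length js \<le> k \<theta>0}"
  have fin: "finite Js" unfolding Js_def by (rule finite_lists_length_le) simp
  \<comment> \<open>Only finitely many coordinate lists have length at most
    \<open>k \<theta>0\<close>, so the finite suprema add up to one common bound.\<close>
  define K where "K = (\<Sum>js\<in>Js. enn2real (W js))"
  have K0: "0 \<le> K" unfolding K_def by (intro sum_nonneg) auto
  have mom: "(\<integral>\<^sup>+y. ennreal (\<bar>partials js (\<lambda>\<eta>. L i \<eta> y) \<theta>t\<bar> powr (2 + \<delta> \<theta>0)) \<partial>law \<gamma> f i \<theta>) \<le> ennreal K"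
    if "1 \<le> i" "\<theta> \<in> ?B \<inter> \<Theta>" "\<theta>t \<in> ?B" "length js \<le> k \<theta>0" for i \<theta> \<theta>t js
  proof -
    have "(\<integral>\<^sup>+y. ennreal (\<bar>partials js (\<lambda>\<eta>. L i \<eta> y) \<theta>t\<bar> powr (2 + \<delta> \<theta>0)) \<partial>law \<gamma> f i \<theta>) \<le> W js"
      unfolding W_def using that by (intro SUP_upper2[of i] SUP_upper2[of "(\<theta>, \<theta>t)"]) auto
    also have "W js = ennreal (enn2real (W js))" using sup that(4) by (simp add: W_def)
    also have "\<dots> \<le> ennreal K"
      unfolding K_def using fin that(4) by (intro ennreal_leI member_le_sum) (auto simp: Js_def)
    finally show ?thesis .
  qed
  have im1: "sets (\<gamma> i) = sets (\<Pi>\<^sub>M j\<in>{..<r i}. (borel :: real measure))" if "1 \<le> i" for i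
    using im that unfolding independent_model_def by blast
  have im2: "prob_space (M \<theta>)" "prob_space.indep_vars (M \<theta>) \<gamma> Y {1..}" if "\<theta> \<in> \<Theta>" for \<theta>
    using im that unfolding independent_model_def by blast+
  have im3: "\<forall>y\<in>space (\<gamma> i). 0 \<le> f i \<theta> y" "distributed (M \<theta>) (\<gamma> i) (Y i) (\<lambda>y. ennreal (f i \<theta> y))"
    if "1 \<le> i" "\<theta> \<in> \<Theta>" for i \<theta>
    using im that unfolding independent_model_def by blast+
  have "parameter_center \<Theta> M Y \<gamma> f L \<theta>0 (\<rho> \<theta>0) (k \<theta>0) (2 + \<delta> \<theta>0) K S"
  proof (rule parameter_center.intro)
    show "f i \<theta> \<in> borel_measurable (\<gamma> i)" if "1 \<le> i" "\<theta> \<in> \<Theta>" for i \<theta>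
    proof -
      have "(\<lambda>y. enn2real (ennreal (f i \<theta> y))) \<in> borel_measurable (\<gamma> i)"
        using distributed_borel_measurable[OF im3(2)[OF that]] by (intro measurable_compose[OF _ borel_measurable_enn2real]) auto
      moreover have "enn2real (ennreal (f i \<theta> y)) = f i \<theta> y" if "y \<in> space (\<gamma> i)" for y
        using im3(1)[OF \<open>1 \<le> i\<close> \<open>\<theta> \<in> \<Theta>\<close>] that by simp
      ultimately show ?thesis by (simp cong: measurable_cong)
    qed
    show "Y i \<in> measurable (M \<theta>) (\<gamma> i)" if "1 \<le> i" "\<theta> \<in> \<Theta>" for i \<theta>
      by (rule distributed_measurable[OF im3(2)[OF that]])
    show "distr (M \<theta>) (\<gamma> i) (Y i) = law \<gamma> f i \<theta>" if "1 \<le> i" "\<theta> \<in> \<Theta>" for i \<theta>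
      unfolding law_def by (rule distributed_distr_eq_density[OF im3(2)[OF that]])
    show "(\<lambda>y. y) \<in> borel_measurable (\<gamma> i)" if "1 \<le> i" for i
      using identity_borel_measurable_PiM[of "r i"] by (simp cong: measurable_cong_sets[OF im1[OF that] refl])
    show "AE y in law \<gamma> f i \<theta>'. Q y" if "1 \<le> i" "\<theta> \<in> \<Theta>" "\<theta>' \<in> \<Theta>" "AE y in law \<gamma> f i \<theta>. Q y" for i \<theta> \<theta>' Q
      by (rule law_AE_transfer[OF cn that])
    show "0 \<le> f i \<theta> y" if "1 \<le> i" "\<theta> \<in> \<Theta>" "y \<in> space (\<gamma> i)" for i \<theta> y
      using im3(1)[OF that(1,2)] that(3) by blast
    show "0 < f i \<theta> y \<and> L i \<theta> y = ln (f i \<theta> y)" if "1 \<le> i" "y \<in> S i" "\<theta> \<in> ?B \<inter> \<Theta>" for i y \<theta>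
      using S1(3)[OF that(1)] that(2,3) unfolding good_def by blast
    show "has_partial j (partials js (\<lambda>\<eta>. L i \<eta> y)) \<theta>" if "1 \<le> i" "y \<in> S i" "\<theta> \<in> ?B" "length js < k \<theta>0" for i y \<theta> js j
      using S1(3)[OF that(1)] that(2-4) unfolding good_def by blast
    show "continuous_on (?B \<times> S i) (\<lambda>(\<theta>, y). partials js (\<lambda>\<eta>. L i \<eta> y) \<theta>)"
      if "1 \<le> i" "1 \<le> length js" "length js \<le> k \<theta>0" for i js
      using S1(3)[OF that(1)] that(2,3) unfolding good_def by blast
  qed (use im2 pd \<theta>0 sm0(1-3) K0 S1(1,2) mom in \<open>simp_all\<close>)
  then show ?thesis by blast
qed

lemma modified_center_exists:
  fixes \<Theta> :: "(real ^ 'd) set" and M :: "real ^ 'd \<Rightarrow> 'w measure"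
  assumes pc: "parameter_center \<Theta> M Y \<gamma> f L \<theta>0 (\<rho> \<theta>0) (k \<theta>0) p K S"
    and ci: "comparable_information M Y \<Theta> L"
    and nd: "nondegenerate_mod_score M Y \<Theta> L \<rho> k \<kappa> v"
    and dn: "dense_noncritical M Y \<Theta> L"
  shows "\<exists>c1 c2. modified_center \<Theta> M Y \<gamma> f L \<theta>0 (\<rho> \<theta>0) (k \<theta>0) p K S
    (\<lambda>n j. \<kappa> \<theta>0 n j - 1) (v \<theta>0) c1 c2"
proof -
  interpret parameter_center \<Theta> M Y \<gamma> f L \<theta>0 "\<rho> \<theta>0" "k \<theta>0" p K S by (rule pc)
  obtain c1 c2 where c: "continuous_on \<Theta> c1" "continuous_on \<Theta> c2"
    and c12: "\<forall>\<theta>\<in>\<Theta>. 0 < c1 \<theta> \<and> 0 < c2 \<theta> \<and>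
          (\<forall>i\<ge>1. loewner_le (c1 \<theta> *\<^sub>R info M Y L 1 \<theta>) (info M Y L i \<theta>) \<and>
                  loewner_le (info M Y L i \<theta>) (c2 \<theta> *\<^sub>R info M Y L 1 \<theta>))"
    using ci unfolding comparable_information_def by blast
  have nd0: "1 \<le> \<kappa> \<theta>0 n j" "\<kappa> \<theta>0 n j \<le> k \<theta>0" "v \<theta>0 n j \<bullet> v \<theta>0 n j' = (if j = j' then 1 else 0)"
    "pos_definite (mod_info_n M Y L \<kappa> v n \<theta>0)"
    "l + 2 \<le> \<kappa> \<theta>0 n j \<Longrightarrow> \<theta>t \<in> B \<Longrightarrow> \<theta>t $ j = \<theta>0 $ j \<Longrightarrow>
      AE w in M \<theta>0. vpartial j l (\<lambda>\<eta>. score_n L n \<eta> (\<lambda>i. Y i w)) \<theta>t \<bullet> v \<theta>0 n j = 0"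
    if "1 \<le> n" for n j j' l \<theta>t
    using nd[unfolded nondegenerate_mod_score_def, rule_format, OF \<theta>0 that] by blast+
  have m: "Suc (\<kappa> \<theta>0 n j - 1) \<le> k \<theta>0" if "1 \<le> n" for n j using nd0(1,2)[OF that, of j] by simp
  have "modified_center \<Theta> M Y \<gamma> f L \<theta>0 (\<rho> \<theta>0) (k \<theta>0) p K S (\<lambda>n j. \<kappa> \<theta>0 n j - 1) (v \<theta>0) c1 c2"
  proof unfold_locales
    show "Suc (\<kappa> \<theta>0 n j - 1) \<le> k \<theta>0" if "1 \<le> n" for n j by (rule m[OF that])
    show "v \<theta>0 n j \<bullet> v \<theta>0 n j' = (if j = j' then 1 else 0)" if "1 \<le> n" for n j j' by (rule nd0(3)[OF that])
    show "AE w in M \<theta>0. (\<Sum>i=1..n. dvec i l j \<theta>t (Y i w)) \<bullet> v \<theta>0 n j = 0"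
      if n: "1 \<le> n" and l: "l < \<kappa> \<theta>0 n j - 1" and \<theta>t: "\<theta>t \<in> B" "\<theta>t $ j = \<theta>0 $ j" for n l j \<theta>t
    proof -
      \<comment> \<open>Here l < \<kappa> - 1 with truncated subtraction, which is the same as l + 2
        \<le> \<kappa>.\<close>
      have l': "l + 2 \<le> \<kappa> \<theta>0 n j" "Suc l \<le> k \<theta>0" using l m[OF n, of j] by auto
      from nd0(5)[OF n l'(1) \<theta>t] AE_Y_S[OF \<theta>0, of n] show ?thesis
      proof eventually_elim
        case (elim w)
        have "vpartial j l (\<lambda>\<eta>. score_n L n \<eta> (\<lambda>i. Y i w)) \<theta>t = (\<Sum>i=1..n. dvec i l j \<theta>t (Y i w))"
          by (rule vpartial_score_n[OF \<theta>t(1) l'(2)]) (use elim(2) in blast)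
        with elim(1) show ?case by simp
      qed
    qed
    show "pos_definite (\<Sum>i=1..n. cov (P i \<theta>0) (gh i (\<lambda>j. \<kappa> \<theta>0 n j - 1) (v \<theta>0 n) \<theta>0))" if n: "1 \<le> n" for n
    proof -
      have "norm (v \<theta>0 n j) \<le> 1" for j using nd0(3)[OF n, of j j] by (simp add: norm_eq_sqrt_inner)
      with mod_info_n_eq[of \<kappa> n v] m[OF n] show ?thesis using nd0(4)[OF n] by simp
    qed
    show "0 < c1 \<theta>" "0 < c2 \<theta>" if "\<theta> \<in> \<Theta>" for \<theta> using c12 that by auto
    show "c1 \<theta> * (x \<bullet> (cov (P 1 \<theta>) (sc 1 \<theta>) *v x)) \<le> x \<bullet> (cov (P i \<theta>) (sc i \<theta>) *v x) \<and>
        x \<bullet> (cov (P i \<theta>) (sc i \<theta>) *v x) \<le> c2 \<theta> * (x \<bullet> (cov (P 1 \<theta>) (sc 1 \<theta>) *v x))"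
      if i: "1 \<le> i" and \<theta>: "\<theta> \<in> B \<inter> \<Theta>" for i \<theta> x
    proof -
      have "loewner_le (c1 \<theta> *\<^sub>R info M Y L 1 \<theta>) (info M Y L i \<theta>)" "loewner_le (info M Y L i \<theta>) (c2 \<theta> *\<^sub>R info M Y L 1 \<theta>)"
        using c12 i \<theta> by auto
      then show ?thesis
        unfolding loewner_le_def info_eq[OF i \<theta>] info_eq[OF order_refl \<theta>] matrix_vector_mult_diff_rdistrib
          inner_diff_right scaleR_matrix_vector_assoc[symmetric] inner_scaleR_right by simp
    qed
    show "\<exists>\<phi>. (\<forall>a. \<phi> a \<in> B \<inter> \<Theta> \<and> invertible (\<Sum>i=1..n. cov (P i (\<phi> a)) (sc i (\<phi> a)))) \<and> \<phi> \<longlonglongrightarrow> \<theta>"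
      if n: "1 \<le> n" and \<theta>: "\<theta> \<in> B \<inter> \<Theta>" for n \<theta>
    proof -
      obtain \<phi> where \<phi>: "\<forall>a. \<phi> a \<in> noncritical M Y \<Theta> L n" "\<phi> \<longlonglongrightarrow> \<theta>"
        using dn n \<theta> unfolding dense_noncritical_def by blast
      have "\<forall>\<^sub>F a in sequentially. \<phi> a \<in> B" using \<phi>(2) \<theta> by (intro topological_tendstoD) auto
      then obtain a0 where a0: "\<forall>a\<ge>a0. \<phi> a \<in> B" unfolding eventually_sequentially by blast
      have "\<phi> (a + a0) \<in> B \<inter> \<Theta>" "invertible (info_n M Y L n (\<phi> (a + a0)))" for a
        using a0 \<phi>(1) by (auto simp: noncritical_def)
      moreover have "(\<lambda>a. \<phi> (a + a0)) \<longlonglongrightarrow> \<theta>" using \<phi>(2) by (rule LIMSEQ_ignore_initial_segment)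
      ultimately show ?thesis by (intro exI[of _ "\<lambda>a. \<phi> (a + a0)"]) (simp only: info_n_eq[symmetric] simp_thms)
    qed
  qed (rule c)+
  then show ?thesis by blast
qed

theorem theorem2p4:
  fixes \<Theta> :: "(real ^ 'd) set"
    and M :: "real ^ 'd \<Rightarrow> 'w measure"
    and Y :: "nat \<Rightarrow> 'w \<Rightarrow> obs"
    and r :: "nat \<Rightarrow> nat"
    and \<gamma> :: "nat \<Rightarrow> obs measure"
    and f :: "nat \<Rightarrow> real ^ 'd \<Rightarrow> obs \<Rightarrow> real"
    and L :: "nat \<Rightarrow> real ^ 'd \<Rightarrow> obs \<Rightarrow> real"
    and \<rho> \<delta> :: "real ^ 'd \<Rightarrow> real"
    and k :: "real ^ 'd \<Rightarrow> nat"
    and \<kappa> :: "real ^ 'd \<Rightarrow> nat \<Rightarrow> 'd \<Rightarrow> nat"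
    and v :: "real ^ 'd \<Rightarrow> nat \<Rightarrow> 'd \<Rightarrow> real ^ 'd"
    and \<alpha> :: real
    and C :: "(real ^ 'd) set"
  assumes "independent_model M Y \<Theta> r \<gamma> f"
    and "partials_determined \<Theta>"
    and "common_null_sets \<Theta> \<gamma> f"
    and "smooth_with_moments \<Theta> \<gamma> f L \<rho> k \<delta>"
    and "comparable_information M Y \<Theta> L"
    and "nondegenerate_mod_score M Y \<Theta> L \<rho> k \<kappa> v"
    and "dense_noncritical M Y \<Theta> L"
    and "0 < \<alpha>" and "\<alpha> < 1"
    and "compact C" and "C \<noteq> {}" and "C \<subseteq> \<Theta>"
  shows "(\<lambda>n. INF \<theta>\<in>C. measure (completion (M \<theta>))
            {w \<in> space (M \<theta>). \<theta> \<in> confidence_region M Y \<Theta> L n \<alpha> (\<lambda>i. Y i w)})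
         \<longlonglongrightarrow> 1 - \<alpha>"
proof -
  let ?q = "quantile (chi_square CARD('d)) (1 - \<alpha>)"
  define h where "h n \<theta> = measure (completion (M \<theta>))
      {w \<in> space (M \<theta>). \<theta> \<in> confidence_region M Y \<Theta> L n \<alpha> (\<lambda>i. Y i w)}" for n \<theta>
  have h: "h n \<theta> = measure (completion (M \<theta>)) {w \<in> space (M \<theta>). test_stat_ext M Y \<Theta> L n \<theta> (\<lambda>i. Y i w) \<le> ?q}"
    if "\<theta> \<in> \<Theta>" for n \<theta>
    using that by (simp add: h_def confidence_region_def)
  have local: "\<exists>r n0. 0 < r \<and> (\<forall>n\<ge>n0. \<forall>\<eta>\<in>\<Theta>. dist \<eta> \<theta>0 < r \<longrightarrow> \<bar>h n \<eta> - (1 - \<alpha>)\<bar> < e)"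
    if e: "0 < e" and \<theta>0: "\<theta>0 \<in> \<Theta>" for e \<theta>0
  proof -
    obtain S K where pc: "parameter_center \<Theta> M Y \<gamma> f L \<theta>0 (\<rho> \<theta>0) (k \<theta>0) (2 + \<delta> \<theta>0) K S"
      using parameter_center_exists[OF assms(1-4) \<theta>0] by blast
    obtain c1 c2 where "modified_center \<Theta> M Y \<gamma> f L \<theta>0 (\<rho> \<theta>0) (k \<theta>0) (2 + \<delta> \<theta>0) K S
        (\<lambda>n j. \<kappa> \<theta>0 n j - 1) (v \<theta>0) c1 c2"
      using modified_center_exists[OF pc assms(5-7)] by blast
    from modified_center.local_uniform_coverage[OF this e assms(8,9)]
    show ?thesis by (simp add: h cong: ball_cong)
  qed
  have uniform: "\<exists>N. \<forall>n\<ge>N. \<forall>\<eta>\<in>C. \<bar>h n \<eta> - (1 - \<alpha>)\<bar> < e" if e: "0 < e" for e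
  proof -
    have "\<forall>\<theta>\<in>C. \<exists>x. 0 < fst x \<and> (\<forall>n\<ge>snd x. \<forall>\<eta>\<in>\<Theta>. dist \<eta> \<theta> < fst x \<longrightarrow> \<bar>h n \<eta> - (1 - \<alpha>)\<bar> < e)"
      using local[OF e] assms(12) by force
    from bchoice[OF this] obtain x where x: "\<forall>\<theta>\<in>C. 0 < fst (x \<theta>) \<and>
        (\<forall>n\<ge>snd (x \<theta>). \<forall>\<eta>\<in>\<Theta>. dist \<eta> \<theta> < fst (x \<theta>) \<longrightarrow> \<bar>h n \<eta> - (1 - \<alpha>)\<bar> < e)" by blast
    have cover: "C \<subseteq> (\<Union>\<theta>\<in>C. ball \<theta> (fst (x \<theta>)))" using x by auto
    obtain D where D: "D \<subseteq> C" "finite D" "C \<subseteq> (\<Union>\<theta>\<in>D. ball \<theta> (fst (x \<theta>)))"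
      using compactE_image[OF assms(10) _ cover] by auto
    define N where "N = Max (insert 0 ((snd \<circ> x) ` D))"
    have "\<bar>h n \<eta> - (1 - \<alpha>)\<bar> < e" if n: "N \<le> n" and \<eta>: "\<eta> \<in> C" for n \<eta>
    proof -
      obtain \<theta> where \<theta>: "\<theta> \<in> D" "dist \<eta> \<theta> < fst (x \<theta>)" using D(3) \<eta> by (auto simp: dist_commute)
      have "snd (x \<theta>) \<le> N" unfolding N_def using D(2) \<theta>(1) by (intro Max_ge) auto
      then show ?thesis using x \<theta> D(1) \<eta> n assms(12) by (meson le_trans subsetD)
    qed
    then show ?thesis by blast
  qed
  have "(\<lambda>n. INF \<theta>\<in>C. h n \<theta>) \<longlonglongrightarrow> 1 - \<alpha>"
  proof (rule LIMSEQ_I)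
    fix e :: real assume e: "0 < e"
    then have e2: "0 < e / 2" by simp
    obtain N where N: "\<forall>n\<ge>N. \<forall>\<eta>\<in>C. \<bar>h n \<eta> - (1 - \<alpha>)\<bar> < e / 2" using uniform[OF e2] by blast
    have "norm ((INF \<theta>\<in>C. h n \<theta>) - (1 - \<alpha>)) < e" if n: "N \<le> n" for n
    proof -
      obtain \<theta> where \<theta>: "\<theta> \<in> C" using assms(11) by blast
      \<comment> \<open>A strict bound may become an equality for the infimum; working with e / 2
        keeps the final inequality strict.\<close>
      have b: "1 - \<alpha> - e / 2 \<le> h n \<eta>" "h n \<eta> \<le> 1 - \<alpha> + e / 2" if "\<eta> \<in> C" for \<eta>
        using N[rule_format, OF n that] by linarith+
      have "1 - \<alpha> - e / 2 \<le> (INF \<theta>\<in>C. h n \<theta>)" using assms(11) b(1) by (rule cINF_greatest)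
      moreover have "(INF \<theta>\<in>C. h n \<theta>) \<le> h n \<theta>"
        by (rule cINF_lower[OF _ \<theta>]) (auto intro!: bdd_belowI[of _ 0] simp: h_def)
      ultimately show ?thesis using b(2)[OF \<theta>] e by simp
    qed
    then show "\<exists>no. \<forall>n\<ge>no. norm ((INF \<theta>\<in>C. h n \<theta>) - (1 - \<alpha>)) < e" by blast
  qed
  then show ?thesis by (simp add: h_def)
qed

end
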